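(* Let $d\ge 2$ and let $\alpha>1$. There exist $\bar\eta>\eta_{\mathrm c}$ and $c''_d=c''_d(\alpha)>0$ such that, for all $\eta\in(\eta_{\mathrm c},\bar\eta)$, there is $L_0(\eta,\alpha)$ such that, for all $L\geq L_0(\eta,\alpha)$, $$ \langle \varphi_0 \rangle^{+,0}_{L;0,\eta} \geq c''_2 |\log f(0,\alpha\eta)| \quad\text{if } d=2, \qquad \langle \varphi_0 \rangle^{+,0}_{L;0,\eta} \geq c''_d \sqrt{|\log f(0,\alpha\eta)|}\quad\text{if } d\geq 3. $$
   Context: Let $d\ge 2$. For an integer $L\ge 1$ set $\Lambda_L = \{-\lceil L/2\rceil+1,\ldots,\lfloor L/2\rfloor\}^d\subset\mathbb Z^d$, $\overline\Lambda_L=\{-\lceil L/2\rceil,\ldots,\lfloor L/2\rfloor+1\}^d$ and $\partial\Lambda_L=\overline\Lambda_L\setminus\Lambda_L$. Write $i\sim j$ when $\|i-j\|_1=1$. For $\eta\ge 0$ define the probability measure on $\varphi=(\varphi_i)_{i\in\overline\Lambda_L}\in\mathbb R^{\overline\Lambda_L}$ $$ \mu^{0}_{L;0,\eta} (d\varphi) = \frac1{\mathbf Z^{0}_{L;0,\eta}} \exp \Bigl[-\frac1{8d}\sum_{\substack{i,j\in\overline\Lambda_L\\ i\sim j}} (\varphi_i-\varphi_j)^2 \Bigr] \prod_{i\in\Lambda_L} \bigl( d\varphi_i + \eta\,\delta_0(d\varphi_i) \bigr) \prod_{i\in\partial\Lambda_L} \delta_0(d\varphi_i), $$ where the sum is over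 ordered pairs $(i,j)$, $d\varphi_i$ is Lebesgue measure, $\delta_0$ is the Dirac mass at $0$, and $\mathbf Z^{0}_{L;0,\eta}$ is the normalizing constant. (The subscript $0$ before $\eta$ indicates that the external potential strength $\lambda$ of the general model is set to $0$.) Let $\Omega_+ = \{\varphi_i\geq 0 \text{ for all } i\in\Lambda_L\}$ and $$ \mu^{+,0}_{L;0,\eta}(\,\cdot\,)=\mu^{0}_{L;0,\eta}(\,\cdot\mid\Omega_+), $$ with expectation denoted by $\langle\,\cdot\,\rangle^{+,0}_{L;0,\eta}$. Let $\mathbf Z^{+,0}_{L;0,\eta}=\mathbf Z^{0}_{L;0,\eta}\,\mu^{0}_{L;0,\eta}(\Omega_+)$ be the corresponding partition function (the total mass on $\Omega_+$ of the unnormalized measure above). The free energy is $$ f(0,\eta)=\lim_{L\to\infty} |\Lambda_L|^{-1}\, \log\frac{\mathbf Z^{+,0}_{L;0,\eta}}{\mathbf Z^{+,0}_{L;0,0}}. $$ The limit exists. With $\rho(\eta)=\lim_{L\to\infty}\bigl\langle |\Lambda_L|^{-1}\sum_{i\in\Lambda_L}\mathbf 1_{\{\varphi_i=0\}}\bigr\rangle^{+,0}_{L;0,\eta}$, the critical value is $$ \eta_{\mathrm c}=\inf\{\eta\ge 0:\rho(\eta)>0\}=\inf\{\eta\ge 0: f(0,\eta)>0\} $$ (the two definitions are known to be equivalent). *)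

theory Defs
  imports "HOL-Probability.Probability"
begin

definition \<Lambda> :: "nat \<Rightarrow> (int ^ 'd) set" where
  "\<Lambda> L = {i. \<forall>k. i $ k \<in> {- \<lceil>real L / 2\<rceil> + 1 .. \<lfloor>real L / 2\<rfloor>}}"

definition \<Lambda>_bar :: "nat \<Rightarrow> (int ^ 'd) set" where
  "\<Lambda>_bar L = {i. \<forall>k. i $ k \<in> {- \<lceil>real L / 2\<rceil> .. \<lfloor>real L / 2\<rfloor> + 1}}"

definition nearest :: "int ^ 'd \<Rightarrow> int ^ 'd \<Rightarrow> bool"  (infix "\<sim>\<^sub>1" 50) where
  "i \<sim>\<^sub>1 j \<longleftrightarrow> (\<Sum>k\<in>UNIV. \<bar>i $ k - j $ k\<bar>) = 1"

text \<open>The measure \<open>dx + \<eta> \<delta>\<^sub>0(dx)\<close> on the line, for \<open>\<eta> \<ge> 0\<close>; that the set function below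
  really is countably additive is \<open>emeasure_pinned_lebesgue\<close>.\<close>

definition pinned_lebesgue :: "real \<Rightarrow> real measure" where
  "pinned_lebesgue \<eta> = measure_of UNIV (sets borel)
     (\<lambda>A. emeasure lborel A + ennreal \<eta> * emeasure (return borel 0) A)"

definition site_measure :: "real \<Rightarrow> nat \<Rightarrow> int ^ 'd \<Rightarrow> real measure" where
  "site_measure \<eta> L i = (if i \<in> \<Lambda> L then pinned_lebesgue \<eta> else return borel 0)"

text \<open>Every nearest-neighbour pair is counted twice, once in each order.\<close>

definition energy :: "nat \<Rightarrow> (int ^ 'd \<Rightarrow> real) \<Rightarrow> real" where
  "energy L \<phi> = 1 / (8 * real CARD('d)) *
     (\<Sum>(i, j) \<in> {(i, j). i \<in> \<Lambda>_bar L \<and> j \<in> \<Lambda>_bar L \<and> i \<sim>\<^sub>1 j}. (\<phi> i - \<phi> j)\<^sup>2)"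

definition gibbs_weight :: "real \<Rightarrow> nat \<Rightarrow> (int ^ 'd \<Rightarrow> real) measure" where
  "gibbs_weight \<eta> L = density (Pi\<^sub>M (\<Lambda>_bar L) (site_measure \<eta> L))
     (\<lambda>\<phi>. ennreal (exp (- energy L \<phi>)))"

definition Z0 :: "'d::finite itself \<Rightarrow> real \<Rightarrow> nat \<Rightarrow> real" where
  "Z0 _ \<eta> L = measure (gibbs_weight \<eta> L) (space (gibbs_weight \<eta> L :: (int ^ 'd \<Rightarrow> real) measure))"

definition \<mu>0 :: "real \<Rightarrow> nat \<Rightarrow> (int ^ 'd \<Rightarrow> real) measure" where
  "\<mu>0 \<eta> L = scale_measure (ennreal (1 / Z0 TYPE('d) \<eta> L)) (gibbs_weight \<eta> L)"

definition \<Omega>_plus :: "real \<Rightarrow> nat \<Rightarrow> (int ^ 'd \<Rightarrow> real) set" where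
  "\<Omega>_plus \<eta> L = {\<phi> \<in> space (\<mu>0 \<eta> L). \<forall>i\<in>\<Lambda> L. \<phi> i \<ge> 0}"

text \<open>\<open>uniform_measure M A\<close> is the conditional measure \<open>M(\<cdot> | A)\<close>.\<close>

definition \<mu>_plus :: "real \<Rightarrow> nat \<Rightarrow> (int ^ 'd \<Rightarrow> real) measure" where
  "\<mu>_plus \<eta> L = uniform_measure (\<mu>0 \<eta> L) (\<Omega>_plus \<eta> L)"

definition Z_plus :: "'d::finite itself \<Rightarrow> real \<Rightarrow> nat \<Rightarrow> real" where
  "Z_plus _ \<eta> L = Z0 TYPE('d) \<eta> L * measure (\<mu>0 \<eta> L) (\<Omega>_plus \<eta> L :: (int ^ 'd \<Rightarrow> real) set)"

definition free_energy :: "'d::finite itself \<Rightarrow> real \<Rightarrow> real" where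
  "free_energy _ \<eta> = lim (\<lambda>L. ln (Z_plus TYPE('d) \<eta> L / Z_plus TYPE('d) 0 L)
     / real (card (\<Lambda> L :: (int ^ 'd) set)))"

definition \<eta>_crit :: "'d::finite itself \<Rightarrow> real" where
  "\<eta>_crit _ = Inf {\<eta>. \<eta> \<ge> 0 \<and> free_energy TYPE('d) \<eta> > 0}"

lemma sets_pinned_lebesgue [simp, measurable_cong]: "sets (pinned_lebesgue \<eta>) = sets borel"
  using sets.sigma_sets_eq[of "borel :: real measure"]
  by (simp add: pinned_lebesgue_def)

lemma space_pinned_lebesgue [simp]: "space (pinned_lebesgue \<eta>) = UNIV"
  by (simp add: pinned_lebesgue_def)

lemma emeasure_pinned_lebesgue:
  assumes "A \<in> sets borel"
  shows "emeasure (pinned_lebesgue \<eta>) A = emeasure lborel A + ennreal \<eta> * indicator A 0"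
proof -
  have "emeasure (pinned_lebesgue \<eta>) A =
      emeasure lborel A + ennreal \<eta> * emeasure (return borel 0) A"
  proof (rule emeasure_measure_of[OF pinned_lebesgue_def])
    show "countably_additive (sets (pinned_lebesgue \<eta>))
        (\<lambda>A. emeasure lborel A + ennreal \<eta> * emeasure (return borel 0) A)"
      unfolding countably_additive_def
    proof (intro allI impI)
      fix A :: "nat \<Rightarrow> real set"
      assume A: "range A \<subseteq> sets (pinned_lebesgue \<eta>)" "disjoint_family A"
      have "(\<Sum>i. emeasure lborel (A i) + ennreal \<eta> * emeasure (return borel 0) (A i)) =
        (\<Sum>i. emeasure lborel (A i)) + (\<Sum>i. ennreal \<eta> * emeasure (return borel 0) (A i))"
        by (rule suminf_add[symmetric]) auto
      also have "(\<Sum>i. ennreal \<eta> * emeasure (return borel 0) (A i)) =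
          ennreal \<eta> * (\<Sum>i. emeasure (return borel 0) (A i))"
        by (rule ennreal_suminf_cmult)
      finally show "(\<Sum>i. emeasure lborel (A i) + ennreal \<eta> * emeasure (return borel 0) (A i)) =
          emeasure lborel (\<Union>i. A i) + ennreal \<eta> * emeasure (return borel 0) (\<Union>i. A i)"
        using A by (simp add: suminf_emeasure del: emeasure_return)
    qed
  qed (use assms in \<open>auto simp: positive_def\<close>)
  then show ?thesis using assms by simp
qed

lemma sigma_finite_pinned_lebesgue: "sigma_finite_measure (pinned_lebesgue \<eta>)"
proof
  have "(\<Union>n. {- real n .. real n}) = UNIV"
  proof safe
    fix x :: real
    obtain n where "\<bar>x\<bar> \<le> real n" using real_arch_simple by blast
    then show "x \<in> (\<Union>n. {- real n .. real n})" by (auto intro!: exI[of _ n])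
  qed simp
  then show "\<exists>A. countable A \<and> A \<subseteq> sets (pinned_lebesgue \<eta>) \<and> \<Union> A = space (pinned_lebesgue \<eta>) \<and>
      (\<forall>a\<in>A. emeasure (pinned_lebesgue \<eta>) a \<noteq> \<infinity>)"
    by (intro exI[of _ "range (\<lambda>n::nat. {- real n .. real n})"])
      (auto simp: emeasure_pinned_lebesgue ennreal_mult_eq_top_iff indicator_def)
qed

lemma finite_\<Lambda>_bar: "finite (\<Lambda>_bar L :: (int ^ 'd) set)"
proof (rule finite_imageD)
  show "finite (vec_nth ` (\<Lambda>_bar L :: (int ^ 'd) set))"
    by (rule finite_subset[OF _ finite_PiE[of UNIV
      "\<lambda>_. {- \<lceil>real L / 2\<rceil> .. \<lfloor>real L / 2\<rfloor> + 1}"]]) (auto simp: \<Lambda>_bar_def PiE_def)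
qed (simp add: inj_on_def vec_nth_inject)

end

theory Submission
  imports Defs "HOL-Real_Asymp.Real_Asymp"
begin

text \<open>By convexity of \<open>log Z\<close> in \<open>log \<eta>\<close>, the density of pinned sites at \<open>\<eta>\<close> is at most about
  \<open>f(0,\<alpha>\<eta>) / log \<alpha>\<close>. Averaging over translates therefore yields a cube of side a power of
  \<open>1 / f(0,\<alpha>\<eta>)\<close> that contains no pinned site with probability at least \<open>1/2\<close>. By stochastic
  domination the height in its interior is at least half that of the unpinned positive field which
  vanishes outside this cube. It remains to bound the latter, which is entropic repulsion at the
  hard wall: integration by parts turns the wall into an upward flux, so the mean height is
  superharmonic. If it stayed below \<open>h\<close>, then pushing the field down along a profile \<open>g\<close> of
  Dirichlet energy \<open>e\<close> would show that the field is near the wall somewhere in every block with a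
  probability of order \<open>exp (- const h\<^sup>2 e)\<close>, and the resulting flux would force, by comparison
  with a parabola, a height of order \<open>n\<^sup>2 exp (- const h\<^sup>2 e)\<close> in a cube of radius \<open>n\<close>. Hence
  \<open>h\<close> is of order at least \<open>sqrt (log n)\<close>. In the plane, blocks of radius
  \<open>sqrt n\<close> carry logarithmic profiles of energy of order \<open>1 / log n\<close>; this gives \<open>h\<close> of order
  \<open>log n\<close>.\<close>

subsection \<open>Product measures on finitely supported fields\<close>

text \<open>The obstacle is that the force exerted by the wall is a density on the boundary of the
  positive cone, which is awkward to bound from below. It is therefore never written down. For a
  block \<open>b\<close>, the mean flux is compared with
  \<open>mass (above t) - mass (above 0)\<close>, the weight gained by lowering the wall under
  \<open>b\<close> by \<open>t\<close>. Association makes the conditional flux largest at the true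
  wall, so the gain relative to the total mass is at most \<open>t\<close> times the conditional
  mean flux; Gaussian tilting and Gaussian tails bound the same gain from below. Expectations are
  compared through unnormalised integrals in cross-multiplied form, so that the four functions
  theorem applies directly, atoms included. Only the average density of pins is controlled, so
  neither the position of the empty cube nor the site of large height inside it is known. Both are
  harmless: for large \<open>L\<close> the box \<open>\<Lambda> L\<close> contains the translate of
  a fixed smaller box that puts the favourable site at the origin, and heights increase with the
  domain.\<close>

abbreviation fields :: "('a \<Rightarrow> real) measure" where
  "fields \<equiv> Pi\<^sub>M UNIV (\<lambda>_. borel)"

definition site_family :: "('a \<Rightarrow> real measure) \<Rightarrow> bool" where
  "site_family M \<longleftrightarrow> (\<forall>i. sigma_finite_measure (M i) \<and> sets (M i) = sets borel)"

definition zero_ext :: "'a set \<Rightarrow> ('a \<Rightarrow> real) \<Rightarrow> 'a \<Rightarrow> real" where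
  "zero_ext D \<phi> = (\<lambda>i. if i \<in> D then \<phi> i else 0)"

text \<open>Extension by 0 puts the measures for all domains on the single measurable space
  \<open>fields\<close>. Domains can then be enlarged, translated and split by adding fields, and an
  integrand is measurable once and for all \<open>D\<close>.\<close>

definition field_measure :: "('a \<Rightarrow> real measure) \<Rightarrow> 'a set \<Rightarrow> ('a \<Rightarrow> real) measure" where
  "field_measure M D = distr (Pi\<^sub>M D M) fields (zero_ext D)"

lemma sets_field_measure [simp, measurable_cong]: "sets (field_measure M D) = sets fields"
  by (simp add: field_measure_def)

lemma space_field_measure [simp]: "space (field_measure M D) = UNIV"
  by (simp add: field_measure_def space_PiM)

lemma site_familyD:
  assumes "site_family M"
  shows "sets (M i) = sets borel" "space (M i) = UNIV" "sigma_finite_measure (M i)"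
    "product_sigma_finite M"
  using assms sets_eq_imp_space_eq[of "M i" borel]
  by (auto simp: site_family_def product_sigma_finite_def)

lemma measurable_site_family:
  assumes "site_family M"
  shows "measurable (M i) N = measurable borel N" "measurable N (M i) = measurable N borel"
  by (rule measurable_cong_sets; simp add: site_familyD(1)[OF assms])+

lemma measurable_zero_ext:
  assumes "site_family M"
  shows "zero_ext D \<in> measurable (Pi\<^sub>M D M) fields"
proof (rule measurable_PiM_single')
  fix i
  show "(\<lambda>\<phi>. zero_ext D \<phi> i) \<in> borel_measurable (Pi\<^sub>M D M)"
  proof (cases "i \<in> D")
    case True
    then have "(\<lambda>\<phi>. \<phi> i) \<in> measurable (Pi\<^sub>M D M) (M i)"
      by (rule measurable_component_singleton)
    then show ?thesis
      using True by (simp add: zero_ext_def measurable_site_family[OF assms])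
  qed (simp add: zero_ext_def)
qed auto

lemma nn_integral_field_measure:
  assumes "site_family M" "F \<in> borel_measurable fields"
  shows "(\<integral>\<^sup>+\<phi>. F \<phi> \<partial>field_measure M D) = (\<integral>\<^sup>+\<phi>. F (zero_ext D \<phi>) \<partial>Pi\<^sub>M D M)"
  unfolding field_measure_def
  by (rule nn_integral_distr[OF measurable_zero_ext[OF assms(1)]]) (use assms in simp)

lemma nn_integral_field_measure_cong:
  assumes "site_family M" "F \<in> borel_measurable fields" "G \<in> borel_measurable fields"
    and "\<And>\<phi>. (\<And>i. i \<notin> D \<Longrightarrow> \<phi> i = 0) \<Longrightarrow> F \<phi> = G \<phi>"
  shows "(\<integral>\<^sup>+\<phi>. F \<phi> \<partial>field_measure M D) = (\<integral>\<^sup>+\<phi>. G \<phi> \<partial>field_measure M D)"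
  using assms by (auto simp: nn_integral_field_measure zero_ext_def intro!: nn_integral_cong)

lemma nn_integral_field_measure_mono:
  assumes "site_family M" "F \<in> borel_measurable fields" "G \<in> borel_measurable fields"
    and "\<And>\<phi>. (\<And>i. i \<notin> D \<Longrightarrow> \<phi> i = 0) \<Longrightarrow> F \<phi> \<le> G \<phi>"
  shows "(\<integral>\<^sup>+\<phi>. F \<phi> \<partial>field_measure M D) \<le> (\<integral>\<^sup>+\<phi>. G \<phi> \<partial>field_measure M D)"
  using assms by (auto simp: nn_integral_field_measure zero_ext_def intro!: nn_integral_mono)

lemma measurable_fun_upd_fields [measurable (raw)]:
  assumes "f \<in> measurable N fields" "g \<in> borel_measurable N"
  shows "(\<lambda>x. (f x)(i := g x)) \<in> measurable N fields"
proof (rule measurable_PiM_single')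
  fix j
  have "(\<lambda>x. f x j) \<in> borel_measurable N"
    using measurable_compose[OF assms(1) measurable_component_singleton[of j UNIV]] by simp
  then show "(\<lambda>x. ((f x)(i := g x)) j) \<in> borel_measurable N"
    using assms by (cases "i = j") auto
qed auto

lemma measurable_fields_plus:
  assumes "f \<in> measurable N (fields :: ('a \<Rightarrow> real) measure)" "g \<in> measurable N fields"
  shows "(\<lambda>x. (\<lambda>i. f x i + g x i)) \<in> measurable N fields"
proof (rule measurable_PiM_single')
  fix j
  have "(\<lambda>x. f x j) \<in> borel_measurable N" "(\<lambda>x. g x j) \<in> borel_measurable N"
    using measurable_compose[OF assms(1) measurable_component_singleton[of j UNIV]]
      measurable_compose[OF assms(2) measurable_component_singleton[of j UNIV]] by auto
  then show "(\<lambda>x. f x j + g x j) \<in> borel_measurable N" by simp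
qed auto

lemma measurable_fields_component [measurable]:
  "(\<lambda>\<phi>. \<phi> i) \<in> borel_measurable (fields :: ('a \<Rightarrow> real) measure)"
  by (rule measurable_component_singleton) simp

lemma nn_integral_field_measure_empty:
  assumes "site_family M" "F \<in> borel_measurable fields"
  shows "(\<integral>\<^sup>+\<phi>. F \<phi> \<partial>field_measure M {}) = F (\<lambda>_. 0)"
proof -
  interpret product_sigma_finite M by (rule site_familyD(4)[OF assms(1)])
  show ?thesis
    unfolding nn_integral_field_measure[OF assms]
    by (subst nn_integral_empty) (auto simp: zero_ext_def)
qed

lemma zero_ext_insert: "x \<notin> D \<Longrightarrow> zero_ext (insert x D) (\<phi>(x := y)) = (zero_ext D \<phi>)(x := y)"
  by (auto simp: zero_ext_def)

lemma nn_integral_field_measure_insert: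
  assumes M: "site_family M" and D: "finite D" "x \<notin> D" and F[measurable]: "F \<in> borel_measurable fields"
  shows "(\<integral>\<^sup>+\<phi>. F \<phi> \<partial>field_measure M (insert x D)) =
    (\<integral>\<^sup>+y. (\<integral>\<^sup>+\<phi>. F (\<phi>(x := y)) \<partial>field_measure M D) \<partial>M x)"
proof -
  interpret product_sigma_finite M by (rule site_familyD(4)[OF M])
  note [measurable] = measurable_zero_ext[OF M]
  have "(\<integral>\<^sup>+\<phi>. F (\<phi>(x := y)) \<partial>field_measure M D) = (\<integral>\<^sup>+\<phi>. F ((zero_ext D \<phi>)(x := y)) \<partial>Pi\<^sub>M D M)" for y
    by (rule nn_integral_field_measure[OF M]) measurable
  then show ?thesis
    by (simp add: nn_integral_field_measure[OF M] product_nn_integral_insert_rev D zero_ext_insert)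
qed

lemma measurable_nn_integral_field_measure [measurable]:
  assumes M: "site_family M" and D: "finite D"
    and F: "case_prod F \<in> borel_measurable (N \<Otimes>\<^sub>M fields)"
  shows "(\<lambda>x. \<integral>\<^sup>+\<phi>. F x \<phi> \<partial>field_measure M D) \<in> borel_measurable N"
proof -
  interpret product_sigma_finite M by (rule site_familyD(4)[OF M])
  interpret finite_product_sigma_finite M D by standard (rule D)
  note [measurable] = measurable_zero_ext[OF M] F
  have "F x \<in> borel_measurable fields" if "x \<in> space N" for x
    using that by measurable
  then have "(\<integral>\<^sup>+\<phi>. F x \<phi> \<partial>field_measure M D) = (\<integral>\<^sup>+\<phi>. F x (zero_ext D \<phi>) \<partial>Pi\<^sub>M D M)"
    if "x \<in> space N" for x
    using that nn_integral_field_measure[OF M] by blast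
  then show ?thesis
    by (subst measurable_cong) (auto intro!: borel_measurable_nn_integral)
qed

text \<open>Fubini in additive form: on a disjoint union the field is the sum of its two
  zero-extended restrictions. This freezes the heights outside a block while the block itself is
  integrated first.\<close>

lemma nn_integral_field_measure_union:
  assumes M: "site_family M" and D: "finite D" "finite D'" "D \<inter> D' = {}"
    and F[measurable]: "F \<in> borel_measurable fields"
  shows "(\<integral>\<^sup>+\<phi>. F \<phi> \<partial>field_measure M (D \<union> D')) =
    (\<integral>\<^sup>+\<zeta>. (\<integral>\<^sup>+\<phi>. F (\<lambda>i. \<phi> i + \<zeta> i) \<partial>field_measure M D) \<partial>field_measure M D')"
proof -
  interpret product_sigma_finite M by (rule site_familyD(4)[OF M])
  note [measurable] = measurable_zero_ext[OF M] measurable_fields_plus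
  have "zero_ext (D \<union> D') (merge D' D (\<zeta>, \<phi>)) = (\<lambda>i. zero_ext D \<phi> i + zero_ext D' \<zeta> i)" for \<zeta> \<phi>
    using D(3) by (auto simp: zero_ext_def merge_def fun_eq_iff)
  then have "(\<integral>\<^sup>+\<phi>. F \<phi> \<partial>field_measure M (D \<union> D')) =
    (\<integral>\<^sup>+\<zeta>. (\<integral>\<^sup>+\<phi>. F (\<lambda>i. zero_ext D \<phi> i + zero_ext D' \<zeta> i) \<partial>Pi\<^sub>M D M) \<partial>Pi\<^sub>M D' M)"
    using D product_nn_integral_fold[of D' D "\<lambda>\<phi>. F (zero_ext (D \<union> D') \<phi>)"]
    by (simp add: nn_integral_field_measure[OF M] Un_commute Int_commute)
  also have "\<dots> = (\<integral>\<^sup>+\<zeta>. (\<integral>\<^sup>+\<phi>. F (\<lambda>i. \<phi> i + \<zeta> i) \<partial>field_measure M D) \<partial>field_measure M D')"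
    using D M by (subst nn_integral_field_measure[OF M])
      (auto intro!: nn_integral_cong simp: nn_integral_field_measure[OF M])
  finally show ?thesis .
qed

subsection \<open>The four functions theorem\<close>

text \<open>For reals, \<open>(A - a) * (A - b) \<ge> 0\<close> gives
  \<open>A * (a + b) \<le> A * A + a * b\<close>, and \<open>a * b\<close> is at most
  \<open>A * B\<close>; division by \<open>A\<close> concludes. The cases where \<open>A\<close> is
  0 or one of \<open>A\<close>, \<open>B\<close> is infinite are settled beforehand.\<close>

lemma ennreal_sum_le_of_prod_le:
  fixes a b A B :: ennreal
  assumes "a \<le> A" "b \<le> A" "a * b \<le> A * B"
  shows "a + b \<le> A + B"
proof (cases "A = \<top> \<or> B = \<top> \<or> A = 0")
  case True
  then show ?thesis using assms by (auto simp: add_increasing2)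
next
  case False
  then obtain A' B' where A: "A = ennreal A'" "A' > 0" and B: "B = ennreal B'" "B' \<ge> 0"
    by (cases A; cases B) (auto simp: less_le)
  with assms obtain a' b' where a: "a = ennreal a'" "a' \<ge> 0" and b: "b = ennreal b'" "b' \<ge> 0"
    by (cases a; cases b) (auto simp: top_unique)
  have le: "a' \<le> A'" "b' \<le> A'" "a' * b' \<le> A' * B'"
    using assms A B a b by (auto simp: ennreal_mult[symmetric] ennreal_le_iff)
  have "0 \<le> (A' - a') * (A' - b')"
    using le by simp
  then have "A' * (a' + b') \<le> A' * (A' + B')"
    using le(3) by (simp add: algebra_simps)
  then have "a' + b' \<le> A' + B'"
    using A by simp
  then show ?thesis
    using A B a b by (simp add: ennreal_plus[symmetric] ennreal_leI del: ennreal_plus)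
qed

text \<open>Twice a product of integrals is a symmetrised double integral, so for
  \<open>x \<le> y\<close> it is enough to compare \<open>f1 x * f2 y + f1 y * f2 x\<close> with
  \<open>f3 x * f4 y + f3 y * f4 x\<close>. Both summands on the left are at most
  \<open>f3 x * f4 y\<close>, and their product is controlled by the hypothesis on the
  diagonal.\<close>

lemma four_functions_real:
  fixes f1 f2 f3 f4 :: "real \<Rightarrow> ennreal"
  assumes [measurable]: "f1 \<in> borel_measurable M" "f2 \<in> borel_measurable M"
      "f3 \<in> borel_measurable M" "f4 \<in> borel_measurable M"
    and le: "\<And>x y. f1 x * f2 y \<le> f3 (min x y) * f4 (max x y)"
  shows "(\<integral>\<^sup>+x. f1 x \<partial>M) * (\<integral>\<^sup>+x. f2 x \<partial>M) \<le> (\<integral>\<^sup>+x. f3 x \<partial>M) * (\<integral>\<^sup>+x. f4 x \<partial>M)"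
proof -
  have pointwise: "f1 x * f2 y + f1 y * f2 x \<le> f3 x * f4 y + f3 y * f4 x" if "x \<le> y" for x y
  proof (rule ennreal_sum_le_of_prod_le)
    show "f1 x * f2 y \<le> f3 x * f4 y" "f1 y * f2 x \<le> f3 x * f4 y"
      using le[of x y] le[of y x] that by (auto simp: min_def max_def split: if_splits)
    have "(f1 x * f2 x) * (f1 y * f2 y) \<le> (f3 x * f4 x) * (f3 y * f4 y)"
      using mult_mono[OF le[of x x] le[of y y]] by simp
    then show "f1 x * f2 y * (f1 y * f2 x) \<le> f3 x * f4 y * (f3 y * f4 x)"
      by (simp add: ac_simps)
  qed
  have double: "(\<integral>\<^sup>+x. (\<integral>\<^sup>+y. f x * g y + f y * g x \<partial>M) \<partial>M) =
      (\<integral>\<^sup>+x. f x \<partial>M) * (\<integral>\<^sup>+x. g x \<partial>M) + (\<integral>\<^sup>+x. f x \<partial>M) * (\<integral>\<^sup>+x. g x \<partial>M)"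
    if [measurable]: "f \<in> borel_measurable M" "g \<in> borel_measurable M" for f g :: "real \<Rightarrow> ennreal"
    by (simp add: nn_integral_add nn_integral_cmult nn_integral_multc ac_simps)
  have "(\<integral>\<^sup>+x. (\<integral>\<^sup>+y. f1 x * f2 y + f1 y * f2 x \<partial>M) \<partial>M) \<le> (\<integral>\<^sup>+x. (\<integral>\<^sup>+y. f3 x * f4 y + f3 y * f4 x \<partial>M) \<partial>M)"
  proof (intro nn_integral_mono)
    fix x y
    show "f1 x * f2 y + f1 y * f2 x \<le> f3 x * f4 y + f3 y * f4 x"
      using pointwise[of x y] pointwise[of y x] by (cases "x \<le> y") (auto simp: ac_simps)
  qed
  then show ?thesis
    by (simp add: double mult_2[symmetric] ennreal_mult_le_mult_iff)
qed

theorem four_functions: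
  fixes M :: "'a \<Rightarrow> real measure"
  assumes M: "site_family M" and D: "finite D"
    and meas: "F1 \<in> borel_measurable fields" "F2 \<in> borel_measurable fields"
      "F3 \<in> borel_measurable fields" "F4 \<in> borel_measurable fields"
    and le: "\<And>\<phi> \<psi>. F1 \<phi> * F2 \<psi> \<le> F3 (\<lambda>i. min (\<phi> i) (\<psi> i)) * F4 (\<lambda>i. max (\<phi> i) (\<psi> i))"
  shows "(\<integral>\<^sup>+\<phi>. F1 \<phi> \<partial>field_measure M D) * (\<integral>\<^sup>+\<phi>. F2 \<phi> \<partial>field_measure M D)
    \<le> (\<integral>\<^sup>+\<phi>. F3 \<phi> \<partial>field_measure M D) * (\<integral>\<^sup>+\<phi>. F4 \<phi> \<partial>field_measure M D)"
  using D meas le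
proof (induction D arbitrary: F1 F2 F3 F4 rule: finite_induct)
  case empty
  then show ?case
    using empty.prems(5)[of "\<lambda>_. 0" "\<lambda>_. 0"] by (simp add: nn_integral_field_measure_empty[OF M])
next
  case (insert x D)
  note [measurable] = insert.prems(1-4)
  have meas: "(\<lambda>y. \<integral>\<^sup>+\<phi>. F (\<phi>(x := y)) \<partial>field_measure M D) \<in> borel_measurable (M x)"
    if [measurable]: "F \<in> borel_measurable fields" for F
    unfolding measurable_site_family[OF M]
    using M insert.hyps by (intro measurable_nn_integral_field_measure) measurable
  show ?case
    unfolding nn_integral_field_measure_insert[OF M insert.hyps insert.prems(1)]
      nn_integral_field_measure_insert[OF M insert.hyps insert.prems(2)]
      nn_integral_field_measure_insert[OF M insert.hyps insert.prems(3)]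
      nn_integral_field_measure_insert[OF M insert.hyps insert.prems(4)]
  proof (rule four_functions_real)
    fix y z
    have "F1 (\<phi>(x := y)) * F2 (\<psi>(x := z)) \<le>
      F3 ((\<lambda>i. min (\<phi> i) (\<psi> i))(x := min y z)) * F4 ((\<lambda>i. max (\<phi> i) (\<psi> i))(x := max y z))" for \<phi> \<psi>
      using insert.prems(5)[of "\<phi>(x := y)" "\<psi>(x := z)"]
      by (auto simp: fun_upd_def if_distrib cong: if_cong elim!: order_trans)
    then show "(\<integral>\<^sup>+\<phi>. F1 (\<phi>(x := y)) \<partial>field_measure M D) * (\<integral>\<^sup>+\<phi>. F2 (\<phi>(x := z)) \<partial>field_measure M D)
      \<le> (\<integral>\<^sup>+\<phi>. F3 (\<phi>(x := min y z)) \<partial>field_measure M D) * (\<integral>\<^sup>+\<phi>. F4 (\<phi>(x := max y z)) \<partial>field_measure M D)"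
      by (intro insert.IH) measurable
  qed (intro meas insert.prems)+
qed

section \<open>Changing the a priori measure: densities, domination, relabelling,
  translation\<close>

lemma site_family_lborel [simp]: "site_family (\<lambda>_. lborel)"
  by (simp add: site_family_def sigma_finite_lborel)

lemma site_family_pinned [simp]: "site_family (\<lambda>_. pinned_lebesgue \<eta>)"
  by (simp add: site_family_def sigma_finite_pinned_lebesgue)

lemma field_measure_cong: "(\<And>i. i \<in> D \<Longrightarrow> M i = M' i) \<Longrightarrow> field_measure M D = field_measure M' D"
  unfolding field_measure_def by (intro distr_cong PiM_cong refl)

lemma measurable_nn_integral_fun_upd:
  assumes M: "site_family M" and D: "finite D" and F[measurable]: "F \<in> borel_measurable fields"
  shows "(\<lambda>y. \<integral>\<^sup>+\<phi>. F (\<phi>(x := y)) \<partial>field_measure M D) \<in> borel_measurable borel"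
  using M D by (intro measurable_nn_integral_field_measure) measurable

lemma measurable_prod_fields [measurable]:
  fixes h :: "'a \<Rightarrow> real \<Rightarrow> ennreal"
  assumes "\<And>i. h i \<in> borel_measurable borel"
  shows "(\<lambda>\<phi>. \<Prod>i\<in>D. h i (\<phi> i)) \<in> borel_measurable fields"
  using assms by (intro borel_measurable_prod_ennreal) (auto intro!: measurable_compose[OF measurable_fields_component])

text \<open>The density is given through one-site integral identities rather than as a
  \<open>density\<close> measure. In this form it covers Lebesgue measure and the Dirac mass at 0
  alike, relative to the pinned measure.\<close>

lemma nn_integral_field_measure_density:
  assumes M: "site_family M" and M': "site_family M'" and D: "finite D"
    and h[measurable]: "\<And>i. h i \<in> borel_measurable borel"
    and eq: "\<And>i f. i \<in> D \<Longrightarrow> f \<in> borel_measurable borel \<Longrightarrow> (\<integral>\<^sup>+y. f y \<partial>M' i) = (\<integral>\<^sup>+y. h i y * f y \<partial>M i)"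
    and F: "F \<in> borel_measurable fields"
  shows "(\<integral>\<^sup>+\<phi>. F \<phi> \<partial>field_measure M' D) = (\<integral>\<^sup>+\<phi>. (\<Prod>i\<in>D. h i (\<phi> i)) * F \<phi> \<partial>field_measure M D)"
  using D eq F
proof (induction D arbitrary: F rule: finite_induct)
  case empty
  then show ?case
    by (simp add: nn_integral_field_measure_empty[OF M] nn_integral_field_measure_empty[OF M'])
next
  case (insert x D)
  note [measurable] = insert.prems(2)
  have prod: "(\<Prod>i\<in>insert x D. h i ((\<phi>(x := y)) i)) = h x y * (\<Prod>i\<in>D. h i (\<phi> i))" for \<phi> y
  proof -
    have "(\<Prod>i\<in>D. h i ((\<phi>(x := y)) i)) = (\<Prod>i\<in>D. h i (\<phi> i))"
      using insert.hyps by (intro prod.cong) auto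
    then show ?thesis using insert.hyps by simp
  qed
  have "(\<integral>\<^sup>+\<phi>. F \<phi> \<partial>field_measure M' (insert x D)) =
    (\<integral>\<^sup>+y. (\<integral>\<^sup>+\<phi>. F (\<phi>(x := y)) \<partial>field_measure M' D) \<partial>M' x)"
    by (intro nn_integral_field_measure_insert M' insert.hyps insert.prems)
  also have "\<dots> = (\<integral>\<^sup>+y. (\<integral>\<^sup>+\<phi>. (\<Prod>i\<in>D. h i (\<phi> i)) * F (\<phi>(x := y)) \<partial>field_measure M D) \<partial>M' x)"
  proof (rule nn_integral_cong)
    fix y
    have "(\<lambda>\<phi>. F (\<phi>(x := y))) \<in> borel_measurable fields" by measurable
    from insert.IH[OF insert.prems(1)[OF insertI2] this] show "(\<integral>\<^sup>+\<phi>. F (\<phi>(x := y)) \<partial>field_measure M' D)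
      = (\<integral>\<^sup>+\<phi>. (\<Prod>i\<in>D. h i (\<phi> i)) * F (\<phi>(x := y)) \<partial>field_measure M D)" .
  qed
  also have "\<dots> = (\<integral>\<^sup>+y. h x y * (\<integral>\<^sup>+\<phi>. (\<Prod>i\<in>D. h i (\<phi> i)) * F (\<phi>(x := y)) \<partial>field_measure M D) \<partial>M x)"
  proof (rule insert.prems(1))
    have "(\<lambda>\<phi>. (\<Prod>i\<in>D. h i (\<phi> i)) * F \<phi>) \<in> borel_measurable fields" by measurable
    then have "(\<lambda>y. \<integral>\<^sup>+\<phi>. (\<Prod>i\<in>D. h i ((\<phi>(x := y)) i)) * F (\<phi>(x := y)) \<partial>field_measure M D)
        \<in> borel_measurable borel"
      by (rule measurable_nn_integral_fun_upd[OF M insert.hyps(1)])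
    moreover have "(\<Prod>i\<in>D. h i ((\<phi>(x := y)) i)) = (\<Prod>i\<in>D. h i (\<phi> i))" for \<phi> y
      using insert.hyps by (intro prod.cong) auto
    ultimately show "(\<lambda>y. \<integral>\<^sup>+\<phi>. (\<Prod>i\<in>D. h i (\<phi> i)) * F (\<phi>(x := y)) \<partial>field_measure M D)
        \<in> borel_measurable borel" by simp
  qed simp
  also have "\<dots> = (\<integral>\<^sup>+y. (\<integral>\<^sup>+\<phi>. h x y * ((\<Prod>i\<in>D. h i (\<phi> i)) * F (\<phi>(x := y))) \<partial>field_measure M D) \<partial>M x)"
    by (intro nn_integral_cong nn_integral_cmult[symmetric]) measurable
  also have "\<dots> = (\<integral>\<^sup>+\<phi>. (\<Prod>i\<in>insert x D. h i (\<phi> i)) * F \<phi> \<partial>field_measure M (insert x D))"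
    by (subst nn_integral_field_measure_insert[OF M insert.hyps]) (simp_all only: prod mult.assoc, measurable)
  finally show ?case .
qed

lemma nn_integral_field_measure_mono_measure:
  assumes M: "site_family M" and M': "site_family M'" and D: "finite D"
    and le: "\<And>i f. i \<in> D \<Longrightarrow> f \<in> borel_measurable borel \<Longrightarrow> (\<integral>\<^sup>+y. f y \<partial>M i) \<le> (\<integral>\<^sup>+y. f y \<partial>M' i)"
    and F: "F \<in> borel_measurable fields"
  shows "(\<integral>\<^sup>+\<phi>. F \<phi> \<partial>field_measure M D) \<le> (\<integral>\<^sup>+\<phi>. F \<phi> \<partial>field_measure M' D)"
  using D le F
proof (induction D arbitrary: F rule: finite_induct)
  case empty
  then show ?case
    by (simp add: nn_integral_field_measure_empty[OF M] nn_integral_field_measure_empty[OF M'])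
next
  case (insert x D)
  note [measurable] = insert.prems(2)
  have "(\<integral>\<^sup>+\<phi>. F \<phi> \<partial>field_measure M (insert x D)) =
    (\<integral>\<^sup>+y. (\<integral>\<^sup>+\<phi>. F (\<phi>(x := y)) \<partial>field_measure M D) \<partial>M x)"
    by (intro nn_integral_field_measure_insert M insert.hyps insert.prems)
  also have "\<dots> \<le> (\<integral>\<^sup>+y. (\<integral>\<^sup>+\<phi>. F (\<phi>(x := y)) \<partial>field_measure M' D) \<partial>M x)"
  proof (rule nn_integral_mono)
    fix y
    have "(\<lambda>\<phi>. F (\<phi>(x := y))) \<in> borel_measurable fields" by measurable
    from insert.IH[OF insert.prems(1)[OF insertI2] this] show "(\<integral>\<^sup>+\<phi>. F (\<phi>(x := y)) \<partial>field_measure M D)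
      \<le> (\<integral>\<^sup>+\<phi>. F (\<phi>(x := y)) \<partial>field_measure M' D)" .
  qed
  also have "\<dots> \<le> (\<integral>\<^sup>+y. (\<integral>\<^sup>+\<phi>. F (\<phi>(x := y)) \<partial>field_measure M' D) \<partial>M' x)"
    by (intro insert.prems(1) measurable_nn_integral_fun_upd M' insert.hyps(1) insert.prems(2)) simp
  also have "\<dots> = (\<integral>\<^sup>+\<phi>. F \<phi> \<partial>field_measure M' (insert x D))"
    by (intro nn_integral_field_measure_insert[symmetric] M' insert.hyps insert.prems)
  finally show ?case .
qed

text \<open>A Dirac site only takes the value 0, which is already the value outside
  \<open>D\<close>. This discards the boundary layer of \<open>\<Lambda>_bar L\<close>, and
  conversely adds pinned sites to a domain.\<close>

lemma nn_integral_field_measure_return: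
  assumes M: "site_family M" and D: "finite D" "finite S" "D \<inter> S = {}"
    and S: "\<And>i. i \<in> S \<Longrightarrow> M i = return borel 0"
    and F: "F \<in> borel_measurable fields"
  shows "(\<integral>\<^sup>+\<phi>. F \<phi> \<partial>field_measure M (D \<union> S)) = (\<integral>\<^sup>+\<phi>. F \<phi> \<partial>field_measure M D)"
  using D(2,3) S
proof (induction S rule: finite_induct)
  case empty
  then show ?case by simp
next
  case (insert x S)
  have x: "finite (D \<union> S)" "x \<notin> D \<union> S" using insert D by auto
  note [measurable] = F
  have "(\<integral>\<^sup>+\<phi>. F \<phi> \<partial>field_measure M (insert x (D \<union> S))) =
    (\<integral>\<^sup>+y. (\<integral>\<^sup>+\<phi>. F (\<phi>(x := y)) \<partial>field_measure M (D \<union> S)) \<partial>return borel 0)"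
    using nn_integral_field_measure_insert[OF M x F] insert.prems by simp
  also have "\<dots> = (\<integral>\<^sup>+\<phi>. F (\<phi>(x := 0)) \<partial>field_measure M (D \<union> S))"
    by (intro nn_integral_return measurable_nn_integral_fun_upd M x F) simp
  also have "\<dots> = (\<integral>\<^sup>+\<phi>. F \<phi> \<partial>field_measure M (D \<union> S))"
  proof (intro nn_integral_field_measure_cong[OF M])
    fix \<phi> :: "'a \<Rightarrow> real"
    assume "\<And>i. i \<notin> D \<union> S \<Longrightarrow> \<phi> i = 0"
    then have "\<phi>(x := 0) = \<phi>" using x(2) by (metis fun_upd_triv)
    then show "F (\<phi>(x := 0)) = F \<phi>" by simp
  qed measurable
  finally show ?case using insert by simp
qed

lemma measurable_fields_reindex:
  "(\<lambda>\<phi> i. \<phi> (\<rho> i)) \<in> measurable (fields :: ('a \<Rightarrow> real) measure) (fields :: ('b \<Rightarrow> real) measure)"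
  by (rule measurable_PiM_single') auto

lemma nn_integral_field_measure_reindex:
  fixes \<pi> :: "'a \<Rightarrow> 'b"
  assumes m: "site_family (\<lambda>_::'a. m)" and D: "finite D"
    and inv: "\<And>i. \<rho> (\<pi> i) = i" "\<And>i. \<pi> (\<rho> i) = i"
    and F: "F \<in> borel_measurable fields"
  shows "(\<integral>\<^sup>+\<phi>. F \<phi> \<partial>field_measure (\<lambda>_. m) (\<pi> ` D)) = (\<integral>\<^sup>+\<phi>. F (\<lambda>i. \<phi> (\<rho> i)) \<partial>field_measure (\<lambda>_. m) D)"
  using D F
proof (induction D arbitrary: F rule: finite_induct)
  case empty
  have "site_family (\<lambda>_::'b. m)" using m by (simp add: site_family_def)
  note nn_integral_field_measure_empty[OF this empty.prems]
  moreover have "(\<lambda>\<phi>. F (\<lambda>i. \<phi> (\<rho> i))) \<in> borel_measurable fields" by (rule measurable_compose[OF measurable_fields_reindex empty.prems])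
  ultimately show ?case using nn_integral_field_measure_empty[OF m] by simp
next
  case (insert x D)
  note [measurable] = insert.prems
  have m': "site_family (\<lambda>_::'b. m)" using m by (simp add: site_family_def)
  have F': "(\<lambda>\<phi>. F (\<lambda>i. \<phi> (\<rho> i))) \<in> borel_measurable fields"
    by (rule measurable_compose[OF measurable_fields_reindex insert.prems])
  have "\<pi> x \<notin> \<pi> ` D" using insert.hyps inv by (metis image_iff)
  then have "(\<integral>\<^sup>+\<phi>. F \<phi> \<partial>field_measure (\<lambda>_. m) (\<pi> ` insert x D)) =
    (\<integral>\<^sup>+y. (\<integral>\<^sup>+\<phi>. F (\<phi>(\<pi> x := y)) \<partial>field_measure (\<lambda>_. m) (\<pi> ` D)) \<partial>m)"
    using nn_integral_field_measure_insert[OF m', of "\<pi> ` D" "\<pi> x" F] insert by simp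
  also have "\<dots> = (\<integral>\<^sup>+y. (\<integral>\<^sup>+\<phi>. F ((\<lambda>i. \<phi> (\<rho> i))(\<pi> x := y)) \<partial>field_measure (\<lambda>_. m) D) \<partial>m)"
    by (intro nn_integral_cong insert.IH) measurable
  also have "\<dots> = (\<integral>\<^sup>+y. (\<integral>\<^sup>+\<phi>. F (\<lambda>i. (\<phi>(x := y)) (\<rho> i)) \<partial>field_measure (\<lambda>_. m) D) \<partial>m)"
  proof -
    have "(\<lambda>i. \<phi> (\<rho> i))(\<pi> x := y) = (\<lambda>i. (\<phi>(x := y)) (\<rho> i))" for \<phi> :: "'a \<Rightarrow> real" and y
      using inv by (auto simp: fun_eq_iff)
    then show ?thesis by simp
  qed
  also have "\<dots> = (\<integral>\<^sup>+\<phi>. F (\<lambda>i. \<phi> (\<rho> i)) \<partial>field_measure (\<lambda>_. m) (insert x D))"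
    using nn_integral_field_measure_insert[OF m insert.hyps F'] by simp
  finally show ?case .
qed

lemma measurable_fields_shift:
  "(\<lambda>\<phi> i. \<phi> i + f i) \<in> measurable (fields :: ('a \<Rightarrow> real) measure) fields"
  by (rule measurable_PiM_single') auto

lemma nn_integral_lborel_shift:
  fixes f :: "real \<Rightarrow> ennreal"
  assumes "f \<in> borel_measurable borel"
  shows "(\<integral>\<^sup>+y. f (y + c) \<partial>lborel) = (\<integral>\<^sup>+y. f y \<partial>lborel)"
  using nn_integral_real_affine[of f 1 c] assms by (simp add: add.commute)

lemma nn_integral_field_measure_shift:
  assumes D: "finite D" and F: "F \<in> borel_measurable fields" and f: "\<And>i. i \<notin> D \<Longrightarrow> f i = 0"
  shows "(\<integral>\<^sup>+\<phi>. F (\<lambda>i. \<phi> i + f i) \<partial>field_measure (\<lambda>_. lborel) D) = (\<integral>\<^sup>+\<phi>. F \<phi> \<partial>field_measure (\<lambda>_. lborel) D)"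
  using D F f
proof (induction D arbitrary: F f rule: finite_induct)
  case empty
  have "f = (\<lambda>_. 0)" using empty.prems by auto
  then show ?case by simp
next
  case (insert x D)
  note [measurable] = insert.prems(1)
  let ?M = "\<lambda>_::'a. lborel :: real measure"
  have upd: "(\<lambda>i. (\<phi>(x := y)) i + f i) = (\<lambda>i. \<phi> i + (f(x := 0)) i)(x := y + f x)" for \<phi> :: "'a \<Rightarrow> real" and y
    by (auto simp: fun_eq_iff)
  have "(\<integral>\<^sup>+\<phi>. F (\<lambda>i. \<phi> i + f i) \<partial>field_measure ?M (insert x D)) =
    (\<integral>\<^sup>+y. (\<integral>\<^sup>+\<phi>. F (\<lambda>i. (\<phi>(x := y)) i + f i) \<partial>field_measure ?M D) \<partial>lborel)"
    by (rule nn_integral_field_measure_insert[OF site_family_lborel insert.hyps,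
      where F = "\<lambda>\<phi>. F (\<lambda>i. \<phi> i + f i)"])
      (rule measurable_compose[OF measurable_fields_shift insert.prems(1)])
  also have "\<dots> = (\<integral>\<^sup>+y. (\<integral>\<^sup>+\<phi>. F (\<phi>(x := y + f x)) \<partial>field_measure ?M D) \<partial>lborel)"
    unfolding upd using insert.prems(2)
    by (intro nn_integral_cong insert.IH[where F = "\<lambda>\<phi>. F (\<phi>(x := _ + f x))"]) auto
  also have "\<dots> = (\<integral>\<^sup>+y. (\<integral>\<^sup>+\<phi>. F (\<phi>(x := y)) \<partial>field_measure ?M D) \<partial>lborel)"
    by (rule nn_integral_lborel_shift[OF measurable_nn_integral_fun_upd[OF site_family_lborel
      insert.hyps(1) insert.prems(1)]])
  also have "\<dots> = (\<integral>\<^sup>+\<phi>. F \<phi> \<partial>field_measure ?M (insert x D))"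
    by (intro nn_integral_field_measure_insert[symmetric] insert.hyps insert.prems site_family_lborel)
  finally show ?case .
qed

lemma nn_integral_field_measure_prod:
  assumes M: "site_family M" and D: "finite D" and h: "\<And>i. h i \<in> borel_measurable borel"
  shows "(\<integral>\<^sup>+\<phi>. (\<Prod>i\<in>D. h i (\<phi> i)) \<partial>field_measure M D) = (\<Prod>i\<in>D. \<integral>\<^sup>+y. h i y \<partial>M i)"
proof -
  interpret product_sigma_finite M by (rule site_familyD(4)[OF M])
  have "(\<integral>\<^sup>+\<phi>. (\<Prod>i\<in>D. h i (\<phi> i)) \<partial>field_measure M D) =
    (\<integral>\<^sup>+\<phi>. (\<Prod>i\<in>D. h i (zero_ext D \<phi> i)) \<partial>Pi\<^sub>M D M)"
    by (rule nn_integral_field_measure[OF M]) (rule measurable_prod_fields[OF h])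
  also have "\<dots> = (\<integral>\<^sup>+\<phi>. (\<Prod>i\<in>D. h i (\<phi> i)) \<partial>Pi\<^sub>M D M)"
    by (intro nn_integral_cong prod.cong) (auto simp: zero_ext_def)
  also have "\<dots> = (\<Prod>i\<in>D. \<integral>\<^sup>+y. h i y \<partial>M i)"
    using D h by (intro product_nn_integral_prod) (auto simp: measurable_site_family[OF M])
  finally show ?thesis .
qed

text \<open>Induction from indicators over measurable functions, because
  \<open>pinned_lebesgue\<close> is known through its values on sets.\<close>

lemma nn_integral_pinned:
  assumes [measurable]: "f \<in> borel_measurable borel"
  shows "(\<integral>\<^sup>+y. f y \<partial>pinned_lebesgue \<eta>) = (\<integral>\<^sup>+y. f y \<partial>lborel) + ennreal \<eta> * f 0"
  using assms
proof (induction rule: borel_measurable_induct)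
  case (cong f g)
  then show ?case by (simp cong: nn_integral_cong)
next
  case (set A)
  then show ?case by (simp add: emeasure_pinned_lebesgue)
next
  case (mult u c)
  then show ?case
    by (subst (1 2) nn_integral_cmult) (auto simp: distrib_left ac_simps measurable_def)
next
  case (add u v)
  then show ?case
    by (subst (1 2) nn_integral_add) (auto simp: distrib_left ac_simps measurable_def)
next
  case (seq U)
  have m: "U i \<in> borel_measurable (pinned_lebesgue \<eta>)" "U i \<in> borel_measurable lborel" for i
    using seq(1) by (auto simp: measurable_def)
  have "(\<integral>\<^sup>+y. (SUP i. U i) y \<partial>pinned_lebesgue \<eta>) = (SUP i. \<integral>\<^sup>+y. U i y \<partial>pinned_lebesgue \<eta>)"
    using nn_integral_monotone_convergence_SUP[OF \<open>incseq U\<close> m(1)] by (simp add: image_comp)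
  also have "\<dots> = (SUP i. (\<integral>\<^sup>+y. U i y \<partial>lborel) + ennreal \<eta> * U i 0)"
    using seq by simp
  also have "\<dots> = (SUP i. \<integral>\<^sup>+y. U i y \<partial>lborel) + (SUP i. ennreal \<eta> * U i 0)"
    using \<open>incseq U\<close> by (intro ennreal_SUP_add) (auto simp: incseq_def le_fun_def intro!: nn_integral_mono mult_left_mono)
  also have "\<dots> = (\<integral>\<^sup>+y. (SUP i. U i) y \<partial>lborel) + ennreal \<eta> * (SUP i. U i) 0"
    using nn_integral_monotone_convergence_SUP[OF \<open>incseq U\<close> m(2)]
    by (simp add: image_comp SUP_mult_left_ennreal)
  finally show ?case using \<open>f = (SUP i. U i)\<close> by simp
qed

subsection \<open>The lattice\<close>

lemma nearest_commute: "(i \<sim>\<^sub>1 j) = (j \<sim>\<^sub>1 i)"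
  by (simp add: nearest_def abs_minus_commute)

lemma nearest_add_left [simp]: "(k + i \<sim>\<^sub>1 k + j) = (i \<sim>\<^sub>1 j)"
  by (simp add: nearest_def)

lemma nearest_irrefl [simp]: "\<not> (i \<sim>\<^sub>1 i)"
  by (simp add: nearest_def)

lemma nearest_axis [simp]: "i \<sim>\<^sub>1 i + axis k 1"
  by (simp add: nearest_def axis_def if_distrib cong: if_cong)

lemma nearest_coord: "i \<sim>\<^sub>1 j \<Longrightarrow> \<bar>i $ k - j $ k\<bar> \<le> 1"
  unfolding nearest_def using member_le_sum[of k UNIV "\<lambda>k. \<bar>i $ k - j $ k\<bar>"] by simp

definition cube :: "nat \<Rightarrow> (int ^ 'd) set" where
  "cube n = {i. \<forall>k. \<bar>i $ k\<bar> \<le> int n}"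

lemma finite_vec_box:
  "finite {i :: int ^ 'd. \<forall>k. i $ k \<in> {a..b}}" (is "finite ?A")
  and card_vec_box: "card {i :: int ^ 'd. \<forall>k. i $ k \<in> {a..b}} = nat (b - a + 1) ^ CARD('d)"
proof -
  have "bij_betw vec_nth ?A (PiE UNIV (\<lambda>_. {a..b}))"
    unfolding bij_betw_def
  proof
    show "inj_on vec_nth ?A" by (simp add: inj_on_def vec_nth_inject)
    show "vec_nth ` ?A = PiE UNIV (\<lambda>_. {a..b})"
    proof safe
      fix f :: "'d \<Rightarrow> int" assume "f \<in> PiE UNIV (\<lambda>_. {a..b})"
      then show "f \<in> vec_nth ` ?A"
        by (intro image_eqI[of _ _ "vec_lambda f"]) (auto simp: PiE_def Pi_def)
    qed auto
  qed
  then show "finite ?A" "card ?A = nat (b - a + 1) ^ CARD('d)"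
    using bij_betw_finite[of vec_nth ?A] bij_betw_same_card[of vec_nth ?A]
    by (auto simp: card_PiE finite_PiE)
qed

lemma vec_box_mono:
  assumes "c \<le> a" "b \<le> d"
  shows "{i :: int ^ 'd. \<forall>k. i $ k \<in> {a..b}} \<subseteq> {i. \<forall>k. i $ k \<in> {c..d}}"
proof -
  have "{a..b} \<subseteq> {c..d}" using assms by auto
  then show ?thesis by blast
qed

lemma cube_eq: "cube n = {i. \<forall>k. i $ k \<in> {- int n..int n}}"
  by (simp add: cube_def abs_le_iff minus_le_iff conj_commute)

lemma finite_cube [simp]: "finite (cube n :: (int ^ 'd) set)"
  unfolding cube_eq by (rule finite_vec_box)

lemma card_cube: "card (cube n :: (int ^ 'd) set) = (2 * n + 1) ^ CARD('d)"
  unfolding cube_eq card_vec_box by (simp add: nat_add_distrib nat_mult_distrib)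

lemma finite_\<Lambda> [simp]: "finite (\<Lambda> L :: (int ^ 'd) set)"
  unfolding \<Lambda>_def by (rule finite_vec_box)

lemma floor_plus_ceiling_half: "\<lfloor>real L / 2\<rfloor> + \<lceil>real L / 2\<rceil> = int L"
proof -
  have "\<lfloor>real L / 2\<rfloor> = int L div 2"
    using floor_divide_of_int_eq[of "int L" 2] by simp
  moreover have "\<lceil>real L / 2\<rceil> = - (- int L div 2)"
    using floor_divide_of_int_eq[of "- int L" 2] by (simp add: ceiling_def)
  ultimately show ?thesis by presburger
qed

lemma floor_half: "\<lfloor>real L / 2\<rfloor> = int (L div 2)"
  using floor_divide_of_int_eq[of "int L" 2] by (simp add: zdiv_int)

lemma ceiling_half: "\<lceil>real L / 2\<rceil> = int L - int (L div 2)"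
  using floor_plus_ceiling_half[of L] by (simp add: floor_half)

lemma card_\<Lambda>: "card (\<Lambda> L :: (int ^ 'd) set) = L ^ CARD('d)"
  unfolding \<Lambda>_def card_vec_box using floor_plus_ceiling_half[of L] by (simp add: algebra_simps)

lemma cube_subset_\<Lambda>: "2 * n + 1 \<le> L \<Longrightarrow> cube n \<subseteq> \<Lambda> L"
  unfolding cube_eq \<Lambda>_def floor_half ceiling_half
  by (rule vec_box_mono) auto

lemma \<Lambda>_subset_cube: "\<Lambda> L \<subseteq> cube L"
proof -
  have "- int L \<le> - \<lceil>real L / 2\<rceil> + 1" "\<lfloor>real L / 2\<rfloor> \<le> int L"
    unfolding floor_half ceiling_half by auto
  then show ?thesis
    unfolding cube_eq \<Lambda>_def by (rule vec_box_mono)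
qed

lemma \<Lambda>_mono: "L \<le> L' \<Longrightarrow> \<Lambda> L \<subseteq> \<Lambda> L'"
proof -
  assume "L \<le> L'"
  then have "- \<lceil>real L' / 2\<rceil> + 1 \<le> - \<lceil>real L / 2\<rceil> + 1" "\<lfloor>real L / 2\<rfloor> \<le> \<lfloor>real L' / 2\<rfloor>"
    by (auto intro!: ceiling_mono floor_mono)
  then show ?thesis unfolding \<Lambda>_def by (rule vec_box_mono)
qed

lemma \<Lambda>_subset_\<Lambda>_bar: "\<Lambda> L \<subseteq> \<Lambda>_bar L"
  unfolding \<Lambda>_def \<Lambda>_bar_def by (rule vec_box_mono) auto

lemma nearest_in_\<Lambda>_bar:
  assumes "i \<in> \<Lambda> L" "i \<sim>\<^sub>1 j"
  shows "j \<in> \<Lambda>_bar L"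
  unfolding \<Lambda>_bar_def
proof safe
  fix k
  have "i $ k \<in> {- \<lceil>real L / 2\<rceil> + 1..\<lfloor>real L / 2\<rfloor>}" using assms(1) by (auto simp: \<Lambda>_def)
  then show "j $ k \<in> {- \<lceil>real L / 2\<rceil>..\<lfloor>real L / 2\<rfloor> + 1}"
    using nearest_coord[OF assms(2), of k] by auto
qed

lemma zero_in_cube [simp]: "0 \<in> cube n"
  by (simp add: cube_def)

lemma finite_nearest [simp]: "finite {j. i \<sim>\<^sub>1 j}"
proof -
  have "{j. i \<sim>\<^sub>1 j} \<subseteq> (+) i ` cube 1"
  proof
    fix j assume "j \<in> {j. i \<sim>\<^sub>1 j}"
    then have "j - i \<in> cube 1" using nearest_coord[of i j] by (auto simp: cube_def abs_minus_commute)
    then show "j \<in> (+) i ` cube 1" by (intro image_eqI[of _ _ "j - i"]) auto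
  qed
  then show ?thesis by (rule finite_subset) simp
qed

text \<open>Kept abstract: the number of neighbours enters only as a positive constant common to all
  sites.\<close>

definition lattice_degree :: "'d::finite itself \<Rightarrow> nat" where
  "lattice_degree _ = card {j :: int ^ 'd. 0 \<sim>\<^sub>1 j}"

lemma nearest_set_eq: "{j. i \<sim>\<^sub>1 j} = (+) i ` {j. 0 \<sim>\<^sub>1 j}"
proof safe
  fix j assume "i \<sim>\<^sub>1 j"
  then have "0 \<sim>\<^sub>1 j - i" using nearest_add_left[of i 0 "j - i"] by simp
  then show "j \<in> (+) i ` {j. 0 \<sim>\<^sub>1 j}" by (intro image_eqI[of _ _ "j - i"]) auto
next
  fix j :: "int ^ 'a" assume "0 \<sim>\<^sub>1 j"
  then show "i \<sim>\<^sub>1 i + j" using nearest_add_left[of i 0 j] by simp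
qed

lemma card_nearest: "card {j. (i :: int ^ 'd) \<sim>\<^sub>1 j} = lattice_degree TYPE('d::finite)"
  unfolding nearest_set_eq[of i] lattice_degree_def by (simp add: card_image)

lemma lattice_degree_pos: "0 < lattice_degree TYPE('d::finite)"
proof -
  have "axis undefined 1 \<in> {j :: int ^ 'd. 0 \<sim>\<^sub>1 j}"
    using nearest_axis[of 0 undefined] by simp
  then show ?thesis unfolding lattice_degree_def by (intro card_gt_0_iff[THEN iffD2]) auto
qed

lemma sum_nearest_reflect:
  "(\<Sum>j | i \<sim>\<^sub>1 j. f j) = (\<Sum>j | (i :: int ^ 'd::finite) \<sim>\<^sub>1 j. f (i + i - j))"
proof (rule sum.reindex_bij_witness[where i = "\<lambda>j. i + i - j" and j = "\<lambda>j. i + i - j"])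
  fix j assume "j \<in> {j. i \<sim>\<^sub>1 j}"
  then show "i + i - j \<in> {j. i \<sim>\<^sub>1 j}"
    by (simp add: nearest_def abs_minus_commute)
  then show "i + i - j \<in> {j. i \<sim>\<^sub>1 j}" .
qed auto

definition sqnorm :: "int ^ 'd::finite \<Rightarrow> real" where
  "sqnorm i = (\<Sum>k\<in>UNIV. (real_of_int (i $ k))\<^sup>2)"

lemma sqnorm_zero [simp]: "sqnorm 0 = 0"
  by (simp add: sqnorm_def)

lemma sqnorm_coord_le: "(real_of_int (i $ k))\<^sup>2 \<le> sqnorm i"
  unfolding sqnorm_def by (rule member_le_sum) auto

lemma sqnorm_nearest:
  assumes "0 \<sim>\<^sub>1 (j :: int ^ 'd::finite)"
  shows "sqnorm j = 1"
proof -
  have "(j $ k)\<^sup>2 = \<bar>j $ k\<bar>" for k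
  proof -
    have "\<bar>j $ k\<bar> \<le> 1" using nearest_coord[OF assms, of k] by simp
    then have "j $ k = 0 \<or> j $ k = 1 \<or> j $ k = -1" by linarith
    then show ?thesis by auto
  qed
  then have "(\<Sum>k\<in>UNIV. (j $ k)\<^sup>2) = 1"
    using assms by (simp add: nearest_def)
  then have "real_of_int (\<Sum>k\<in>UNIV. (j $ k)\<^sup>2) = 1" by simp
  then show ?thesis by (simp add: sqnorm_def)
qed

text \<open>The reflection \<open>j \<mapsto> 2i - j\<close> of the neighbours of \<open>i\<close> cancels the linear terms.\<close>

lemma laplacian_sqnorm:
  "(\<Sum>j | (i :: int ^ 'd::finite) \<sim>\<^sub>1 j. sqnorm j - sqnorm i) = real (lattice_degree TYPE('d))"
proof -
  let ?N = "{j. i \<sim>\<^sub>1 j}"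
  have parallelogram: "sqnorm j + sqnorm (i + i - j) - 2 * sqnorm i = 2 * sqnorm (j - i)" for j
    unfolding sqnorm_def
    by (simp add: sum.distrib[symmetric] sum_subtractf[symmetric] sum_distrib_left power2_eq_square algebra_simps)
  have "2 * (\<Sum>j\<in>?N. sqnorm j - sqnorm i) = (\<Sum>j\<in>?N. sqnorm j) + (\<Sum>j\<in>?N. sqnorm (i + i - j)) - (\<Sum>j\<in>?N. 2 * sqnorm i)"
    using sum_nearest_reflect[of sqnorm i] by (simp add: sum_subtractf)
  also have "\<dots> = (\<Sum>j\<in>?N. 2 * sqnorm (j - i))"
    unfolding sum.distrib[symmetric] sum_subtractf[symmetric] parallelogram ..
  also have "\<dots> = (\<Sum>j\<in>?N. 2)"
  proof (rule sum.cong)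
    fix j assume "j \<in> ?N"
    then have "0 \<sim>\<^sub>1 j - i" using nearest_add_left[of i 0 "j - i"] by simp
    then show "2 * sqnorm (j - i) = 2" by (simp add: sqnorm_nearest)
  qed simp
  also have "\<dots> = 2 * real (lattice_degree TYPE('d))"
    by (simp add: card_nearest)
  finally show ?thesis by simp
qed

subsection \<open>The Dirichlet form\<close>

definition bonds :: "nat \<Rightarrow> ((int ^ 'd) \<times> (int ^ 'd)) set" where
  "bonds L = {(i, j). i \<in> \<Lambda>_bar L \<and> j \<in> \<Lambda>_bar L \<and> i \<sim>\<^sub>1 j}"

text \<open>Polarisation of \<open>energy\<close>, normalised so that the value on the diagonal is
  twice the energy and the cross term in \<open>energy_add\<close> has coefficient 1.\<close>

definition dirichlet :: "nat \<Rightarrow> (int ^ 'd \<Rightarrow> real) \<Rightarrow> (int ^ 'd \<Rightarrow> real) \<Rightarrow> real" where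
  "dirichlet L \<phi> \<psi> = 1 / (4 * real CARD('d)) * (\<Sum>(i, j)\<in>bonds L. (\<phi> i - \<phi> j) * (\<psi> i - \<psi> j))"

lemma finite_bonds [simp]: "finite (bonds L :: ((int ^ 'd) \<times> (int ^ 'd)) set)"
  by (rule finite_subset[of _ "\<Lambda>_bar L \<times> \<Lambda>_bar L"]) (auto simp: bonds_def finite_\<Lambda>_bar)

lemma energy_eq: "energy L (\<phi> :: int ^ 'd \<Rightarrow> real) = 1 / (8 * real CARD('d)) * (\<Sum>(i, j)\<in>bonds L. (\<phi> i - \<phi> j)\<^sup>2)"
  by (simp add: energy_def bonds_def)

lemma energy_nonneg: "0 \<le> energy L (\<phi> :: int ^ 'd \<Rightarrow> real)"
  by (simp add: energy_eq sum_nonneg split_beta)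

lemma energy_dirichlet: "dirichlet L \<phi> \<phi> = 2 * energy L (\<phi> :: int ^ 'd \<Rightarrow> real)"
  by (simp add: energy_eq dirichlet_def power2_eq_square)

lemma energy_add:
  fixes \<phi> \<psi> :: "int ^ 'd \<Rightarrow> real"
  shows "energy L (\<lambda>i. \<phi> i + \<psi> i) = energy L \<phi> + dirichlet L \<phi> \<psi> + energy L \<psi>"
proof -
  have "(\<Sum>(i, j)\<in>bonds L. (\<phi> i + \<psi> i - (\<phi> j + \<psi> j))\<^sup>2) = (\<Sum>(i, j)\<in>bonds L. (\<phi> i - \<phi> j)\<^sup>2)
    + 2 * (\<Sum>(i, j)\<in>bonds L. (\<phi> i - \<phi> j) * (\<psi> i - \<psi> j)) + (\<Sum>(i, j)\<in>bonds L. (\<psi> i - \<psi> j)\<^sup>2)"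
    by (simp add: split_beta power2_eq_square algebra_simps sum.distrib sum_subtractf sum_distrib_left)
  then show ?thesis
    unfolding energy_eq dirichlet_def by (simp add: add_divide_distrib)
qed

lemma energy_scale: "energy L (\<lambda>i. s * \<phi> i) = s\<^sup>2 * energy L (\<phi> :: int ^ 'd \<Rightarrow> real)"
  unfolding energy_eq
  by (simp add: sum_distrib_left split_beta power2_eq_square algebra_simps)

lemma dirichlet_commute: "dirichlet L \<phi> \<psi> = dirichlet L \<psi> (\<phi> :: int ^ 'd \<Rightarrow> real)"
  by (simp add: dirichlet_def mult.commute)

lemma dirichlet_add_left: "dirichlet L (\<lambda>i. \<phi> i + \<xi> i) \<psi> = dirichlet L \<phi> \<psi> + dirichlet L \<xi> (\<psi> :: int ^ 'd \<Rightarrow> real)"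
  unfolding dirichlet_def
  by (simp add: split_beta algebra_simps sum.distrib sum_subtractf add_divide_distrib diff_divide_distrib)

lemma dirichlet_scale_left: "dirichlet L (\<lambda>i. s * \<phi> i) \<psi> = s * dirichlet L \<phi> (\<psi> :: int ^ 'd \<Rightarrow> real)"
  unfolding dirichlet_def by (simp add: sum_distrib_left split_beta algebra_simps)

lemma dirichlet_add_right: "dirichlet L \<psi> (\<lambda>i. \<phi> i + \<xi> i) = dirichlet L \<psi> \<phi> + dirichlet L \<psi> (\<xi> :: int ^ 'd \<Rightarrow> real)"
  by (simp add: dirichlet_commute[of L \<psi>] dirichlet_add_left)

lemma dirichlet_scale_right: "dirichlet L \<psi> (\<lambda>i. s * \<phi> i) = s * dirichlet L \<psi> (\<phi> :: int ^ 'd \<Rightarrow> real)"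
  by (simp add: dirichlet_commute[of L \<psi>] dirichlet_scale_left)

text \<open>Bond by bond. If the two fields are ordered the same way at both ends, the two sides
  agree; if they are ordered oppositely, the left side is smaller by twice the product of the two
  gaps. This is the lattice condition behind every correlation inequality below.\<close>

lemma energy_min_max:
  fixes \<phi> \<psi> :: "int ^ 'd \<Rightarrow> real"
  shows "energy L (\<lambda>i. min (\<phi> i) (\<psi> i)) + energy L (\<lambda>i. max (\<phi> i) (\<psi> i)) \<le> energy L \<phi> + energy L \<psi>"
proof -
  have *: "(min a b - min c d)\<^sup>2 + (max a b - max c d)\<^sup>2 \<le> (a - c)\<^sup>2 + (b - d)\<^sup>2" for a b c d :: real
  proof -
    have "(a - b) * (c - d) \<le> 0 \<or> (a \<le> b \<and> c \<le> d) \<or> (b \<le> a \<and> d \<le> c)"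
      by (smt (verit) mult_nonneg_nonpos mult_nonneg_nonpos2)
    moreover have "(a - b) * (c - d) \<le> 0 \<Longrightarrow> ?thesis"
      by (cases "a \<le> b"; cases "c \<le> d") (auto simp: min_def max_def power2_eq_square algebra_simps)
    ultimately show ?thesis by (auto simp: min_def max_def)
  qed
  have "(\<Sum>(i, j)\<in>bonds L. (min (\<phi> i) (\<psi> i) - min (\<phi> j) (\<psi> j))\<^sup>2) + (\<Sum>(i, j)\<in>bonds L. (max (\<phi> i) (\<psi> i) - max (\<phi> j) (\<psi> j))\<^sup>2)
    \<le> (\<Sum>(i, j)\<in>bonds L. (\<phi> i - \<phi> j)\<^sup>2) + (\<Sum>(i, j)\<in>bonds L. (\<psi> i - \<psi> j)\<^sup>2)"
    unfolding sum.distrib[symmetric] by (rule sum_mono) (auto simp: *)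
  from mult_left_mono[OF this, of "1 / (8 * real CARD('d))"] show ?thesis
    unfolding energy_eq by (simp add: distrib_left add_divide_distrib)
qed

lemma measurable_energy [measurable]: "energy L \<in> borel_measurable fields"
  unfolding energy_def[abs_def] by measurable

text \<open>A bond outside \<open>bonds L\<close> has both ends outside \<open>\<Lambda> L\<close>,
  where \<open>f\<close> vanishes. Hence any finite set of oriented bonds may be charged to the
  energy, the form in which path and flow arguments need it.\<close>

lemma bonds_energy_le:
  fixes f :: "int ^ 'd \<Rightarrow> real"
  assumes f: "\<And>i. i \<notin> \<Lambda> L \<Longrightarrow> f i = 0" and Q: "finite Q" "\<And>i j. (i, j) \<in> Q \<Longrightarrow> i \<sim>\<^sub>1 j"
  shows "(\<Sum>(i, j)\<in>Q. (f i - f j)\<^sup>2) \<le> 8 * real CARD('d) * energy L f"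
proof -
  have "(\<Sum>(i, j)\<in>Q. (f i - f j)\<^sup>2) = (\<Sum>(i, j)\<in>Q \<inter> bonds L. (f i - f j)\<^sup>2)"
  proof (rule sum.mono_neutral_right[OF Q(1)], simp, rule ballI)
    fix p assume "p \<in> Q - Q \<inter> bonds L"
    then obtain i j where p: "p = (i, j)" and *: "(i, j) \<in> Q" "(i, j) \<notin> bonds L"
      by (cases p) auto
    have "i \<notin> \<Lambda> L" "j \<notin> \<Lambda> L"
      using * Q(2)[OF *(1)] nearest_in_\<Lambda>_bar[of i L j] nearest_in_\<Lambda>_bar[of j L i] \<Lambda>_subset_\<Lambda>_bar[of L]
      by (auto simp: bonds_def nearest_commute)
    then show "(case p of (i, j) \<Rightarrow> (f i - f j)\<^sup>2) = 0" using f p by simp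
  qed
  also have "\<dots> \<le> (\<Sum>(i, j)\<in>bonds L. (f i - f j)\<^sup>2)"
    by (rule sum_mono2) auto
  finally show ?thesis by (simp add: energy_eq)
qed

text \<open>The right-hand sum does not mention \<open>L\<close>; independence of the box and
  translation invariance are read off from it.\<close>

lemma energy_eq_gradient_support:
  fixes f :: "int ^ 'd \<Rightarrow> real"
  assumes f: "\<And>i. i \<notin> \<Lambda> L \<Longrightarrow> f i = 0"
  shows "energy L f = 1 / (8 * real CARD('d)) * (\<Sum>(i, j)\<in>{(i, j). i \<sim>\<^sub>1 j \<and> f i \<noteq> f j}. (f i - f j)\<^sup>2)"
proof -
  have "(\<Sum>(i, j)\<in>bonds L. (f i - f j)\<^sup>2) = (\<Sum>(i, j)\<in>{(i, j). i \<sim>\<^sub>1 j \<and> f i \<noteq> f j}. (f i - f j)\<^sup>2)"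
  proof (rule sum.mono_neutral_right[OF finite_bonds], clarify)
    fix i j assume *: "i \<sim>\<^sub>1 j" "f i \<noteq> f j"
    then have "i \<in> \<Lambda> L \<or> j \<in> \<Lambda> L" using f by metis
    then show "(i, j) \<in> bonds L"
      using * nearest_in_\<Lambda>_bar[of i L j] nearest_in_\<Lambda>_bar[of j L i] \<Lambda>_subset_\<Lambda>_bar[of L]
      by (auto simp: bonds_def nearest_commute)
  qed (auto simp: bonds_def)
  then show ?thesis by (simp add: energy_eq)
qed

lemma energy_mono_box:
  fixes f :: "int ^ 'd \<Rightarrow> real"
  assumes "\<And>i. i \<notin> \<Lambda> L \<Longrightarrow> f i = 0" "L \<le> L'"
  shows "energy L' f = energy L f"
  using assms \<Lambda>_mono[of L L'] energy_eq_gradient_support[of L f] energy_eq_gradient_support[of L' f]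
  by (auto simp: subset_iff)

lemma energy_translate:
  fixes f :: "int ^ 'd \<Rightarrow> real"
  assumes "\<And>i. i \<notin> \<Lambda> L \<Longrightarrow> f i = 0" "\<And>i. i \<notin> \<Lambda> L \<Longrightarrow> f (i - k) = 0"
  shows "energy L (\<lambda>i. f (i - k)) = energy L f"
proof -
  have "(\<Sum>(i, j)\<in>{(i, j). i \<sim>\<^sub>1 j \<and> f (i - k) \<noteq> f (j - k)}. (f (i - k) - f (j - k))\<^sup>2) =
    (\<Sum>(i, j)\<in>{(i, j). i \<sim>\<^sub>1 j \<and> f i \<noteq> f j}. (f i - f j)\<^sup>2)"
  proof (rule sum.reindex_bij_witness[where j = "\<lambda>(i, j). (i - k, j - k)" and i = "\<lambda>(i, j). (k + i, k + j)"]; clarsimp)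
    fix i j :: "int ^ 'd" assume "i \<sim>\<^sub>1 j"
    then show "i - k \<sim>\<^sub>1 j - k"
      using nearest_add_left[of "- k" i j] by simp
  qed
  then show ?thesis
    using assms by (simp add: energy_eq_gradient_support)
qed

text \<open>Walk from \<open>k\<close> along one axis until the path leaves the box, telescope, and
  apply Cauchy-Schwarz. The loss of a factor of order \<open>L\<close> is harmless, as the bound
  serves only finiteness and positive definiteness.\<close>

lemma coercive:
  fixes f :: "int ^ 'd \<Rightarrow> real"
  assumes f: "\<And>i. i \<notin> \<Lambda> L \<Longrightarrow> f i = 0"
  shows "(f k)\<^sup>2 \<le> real (2 * L + 1) * (8 * real CARD('d)) * energy L f"
proof (cases "k \<in> \<Lambda> L")
  case False
  then show ?thesis using f energy_nonneg[of L f] by simp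
next
  case True
  define e :: "int ^ 'd" where "e = axis undefined 1"
  \<comment> \<open>\<open>\<Lambda> L\<close> lies in \<open>cube L\<close>, whose coordinates
    range over an interval of length \<open>2 * L\<close>; one more step is certain to leave
    it.\<close>
  define N where "N = 2 * L + 1"
  let ?p = "\<lambda>m. k + of_nat m * e"
  have step: "?p (Suc m) = ?p m + e" for m by (simp add: algebra_simps)
  have coord: "?p m $ undefined = k $ undefined + int m" for m
    by (simp add: e_def axis_def of_nat_index)
  have inj: "inj ?p"
    by (rule injI) (metis coord add_left_cancel of_nat_eq_iff)
  have "?p N \<notin> cube L"
  proof
    assume "?p N \<in> cube L"
    then have "\<bar>?p N $ undefined\<bar> \<le> int L" unfolding cube_def by blast
    moreover have "\<bar>k $ undefined\<bar> \<le> int L" using True \<Lambda>_subset_cube unfolding cube_def by blast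
    ultimately show False unfolding coord N_def by simp
  qed
  then have "f (?p N) = 0" using f \<Lambda>_subset_cube by blast
  then have "f k = (\<Sum>m<N. f (?p m) - f (?p (Suc m)))"
    using sum_lessThan_telescope'[of "\<lambda>m. f (?p m)" N] by simp
  then have "(f k)\<^sup>2 \<le> real N * (\<Sum>m<N. (f (?p m) - f (?p (Suc m)))\<^sup>2)"
    using Cauchy_Schwarz_ineq_sum[of "\<lambda>_. 1" "\<lambda>m. f (?p m) - f (?p (Suc m))" "{..<N}"] by simp
  also have "(\<Sum>m<N. (f (?p m) - f (?p (Suc m)))\<^sup>2) = (\<Sum>(i, j)\<in>(\<lambda>m. (?p m, ?p (Suc m))) ` {..<N}. (f i - f j)\<^sup>2)"
    using inj by (subst sum.reindex) (auto simp: inj_on_def)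
  also have "\<dots> \<le> 8 * real CARD('d) * energy L f"
    using f step by (intro bonds_energy_le) (auto simp: e_def)
  finally show ?thesis by (simp add: N_def mult.assoc)
qed

subsection \<open>Positive fields\<close>

definition boltzmann :: "nat \<Rightarrow> (int ^ 'd \<Rightarrow> real) \<Rightarrow> ennreal" where
  "boltzmann L \<phi> = ennreal (exp (- energy L \<phi>))"

text \<open>Strict positivity on \<open>S\<close> encodes the absence of pins there: relative to
  weak positivity it removes the atom at 0 and otherwise only a Lebesgue null set.\<close>

definition positive_on :: "(int ^ 'd) set \<Rightarrow> (int ^ 'd) set \<Rightarrow> (int ^ 'd \<Rightarrow> real) set" where
  "positive_on A S = {\<phi>. (\<forall>i\<in>A. 0 \<le> \<phi> i) \<and> (\<forall>i\<in>S. 0 < \<phi> i)}"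

text \<open>An unnormalised expectation. \<open>D\<close> carries the sites that move,
  \<open>S\<close> those barred from touching the wall, and \<open>L\<close> only selects the box
  whose energy is used; separating the three is what lets domains be compared.\<close>

definition plus_integral :: "nat \<Rightarrow> real \<Rightarrow> (int ^ 'd) set \<Rightarrow> (int ^ 'd) set \<Rightarrow> ((int ^ 'd \<Rightarrow> real) \<Rightarrow> ennreal) \<Rightarrow> ennreal" where
  "plus_integral L \<eta> D S G =
    (\<integral>\<^sup>+\<phi>. G \<phi> * (indicator (positive_on (\<Lambda> L) S) \<phi> * boltzmann L \<phi>) \<partial>field_measure (\<lambda>_. pinned_lebesgue \<eta>) D)"

lemma measurable_boltzmann [measurable]: "boltzmann L \<in> borel_measurable fields"
  unfolding boltzmann_def[abs_def] by measurable

lemma measurable_positive_on [measurable]: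
  assumes "finite A" "finite S"
  shows "positive_on A S \<in> sets (fields :: (int ^ 'd \<Rightarrow> real) measure)"
proof -
  have "positive_on A S = (\<Inter>i\<in>A. {\<phi>. 0 \<le> \<phi> i}) \<inter> (\<Inter>i\<in>S. {\<phi>. 0 < \<phi> i})"
    by (auto simp: positive_on_def)
  moreover have "{\<phi> \<in> space fields. 0 \<le> \<phi> i} \<in> sets (fields :: (int ^ 'd \<Rightarrow> real) measure)"
    "{\<phi> \<in> space fields. 0 < \<phi> i} \<in> sets (fields :: (int ^ 'd \<Rightarrow> real) measure)" for i
    by measurable
  ultimately show ?thesis
    using assms by (auto simp: space_PiM intro!: sets.Int sets.countable_INT'')
qed

lemma boltzmann_supermodular:
  "boltzmann L \<phi> * boltzmann L \<psi> \<le> boltzmann L (\<lambda>i. min (\<phi> i) (\<psi> i)) * boltzmann L (\<lambda>i. max (\<phi> i) (\<psi> i))"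
  using energy_min_max[of L \<phi> \<psi>]
  by (simp add: boltzmann_def ennreal_mult[symmetric] exp_add[symmetric])

text \<open>Holley's criterion: the four functions theorem applied to \<open>G w1\<close>,
  \<open>w2\<close>, \<open>w1\<close>, \<open>G w2\<close>. Monotonicity of \<open>G\<close> is
  phrased through maxima, and the cross-multiplied conclusion makes sense for infinite or zero
  integrals.\<close>

lemma domination:
  fixes M :: "'a \<Rightarrow> real measure"
  assumes M: "site_family M" and D: "finite D"
    and [measurable]: "w1 \<in> borel_measurable fields" "w2 \<in> borel_measurable fields" "G \<in> borel_measurable fields"
    and w: "\<And>\<phi> \<psi>. w1 \<phi> * w2 \<psi> \<le> w1 (\<lambda>i. min (\<phi> i) (\<psi> i)) * w2 (\<lambda>i. max (\<phi> i) (\<psi> i))"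
    and G: "\<And>\<phi> \<psi>. G \<phi> \<le> G (\<lambda>i. max (\<phi> i) (\<psi> i))"
  shows "(\<integral>\<^sup>+\<phi>. G \<phi> * w1 \<phi> \<partial>field_measure M D) * (\<integral>\<^sup>+\<phi>. w2 \<phi> \<partial>field_measure M D)
    \<le> (\<integral>\<^sup>+\<phi>. w1 \<phi> \<partial>field_measure M D) * (\<integral>\<^sup>+\<phi>. G \<phi> * w2 \<phi> \<partial>field_measure M D)"
proof (rule four_functions[OF M D])
  fix \<phi> \<psi>
  have "G \<phi> * (w1 \<phi> * w2 \<psi>) \<le> G (\<lambda>i. max (\<phi> i) (\<psi> i)) * (w1 (\<lambda>i. min (\<phi> i) (\<psi> i)) * w2 (\<lambda>i. max (\<phi> i) (\<psi> i)))"
    by (intro mult_mono w G) auto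
  then show "G \<phi> * w1 \<phi> * w2 \<psi> \<le> w1 (\<lambda>i. min (\<phi> i) (\<psi> i)) * (G (\<lambda>i. max (\<phi> i) (\<psi> i)) * w2 (\<lambda>i. max (\<phi> i) (\<psi> i)))"
    by (simp add: ac_simps)
qed measurable

section \<open>Lebesgue, Dirac and pinned measures as densities of one another\<close>

lemma nn_integral_lborel_cong_nonzero:
  fixes f g :: "real \<Rightarrow> ennreal"
  assumes "\<And>y. y \<noteq> 0 \<Longrightarrow> f y = g y"
  shows "(\<integral>\<^sup>+y. f y \<partial>lborel) = (\<integral>\<^sup>+y. g y \<partial>lborel)"
proof (rule nn_integral_cong_AE)
  show "AE y in lborel. f y = g y"
    using AE_lborel_singleton[of 0] by eventually_elim (simp add: assms)
qed

text \<open>Outside \<open>D\<close> the density is \<open>1 / \<eta>\<close> on the single point 0.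
  It annihilates the Lebesgue part and turns the atom of mass \<eta> into a unit mass, so the
  smaller domain becomes a reweighting of the larger one and the two share a reference
  measure.\<close>

lemma nn_integral_subdomain:
  assumes \<eta>: "\<eta> > 0" and D: "finite D'" "D \<subseteq> D'" and F[measurable]: "F \<in> borel_measurable fields"
  shows "(\<integral>\<^sup>+\<phi>. F \<phi> \<partial>field_measure (\<lambda>_. pinned_lebesgue \<eta>) D) =
    (\<integral>\<^sup>+\<phi>. (\<Prod>i\<in>D'. if i \<in> D then 1 else ennreal (1 / \<eta>) * indicator {0} (\<phi> i)) * F \<phi>
      \<partial>field_measure (\<lambda>_. pinned_lebesgue \<eta>) D')"
proof -
  define M where "M i = (if i \<in> D then pinned_lebesgue \<eta> else return borel 0)" for i :: 'a
  have M: "site_family M"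
    using sigma_finite_pinned_lebesgue
    by (auto simp: site_family_def M_def prob_space_return prob_space_imp_sigma_finite)
  define h where "h i y = (if i \<in> D then 1 else ennreal (1 / \<eta>) * indicator {0} y)" for i :: 'a and y :: real
  have h: "h i \<in> borel_measurable borel" for i
    unfolding h_def[abs_def] by measurable
  have "(\<integral>\<^sup>+\<phi>. F \<phi> \<partial>field_measure (\<lambda>_. pinned_lebesgue \<eta>) D) = (\<integral>\<^sup>+\<phi>. F \<phi> \<partial>field_measure M D)"
    by (subst field_measure_cong[of D M "\<lambda>_. pinned_lebesgue \<eta>"]) (auto simp: M_def)
  also have "\<dots> = (\<integral>\<^sup>+\<phi>. F \<phi> \<partial>field_measure M (D \<union> (D' - D)))"
    using D finite_subset[OF D(2)] by (intro nn_integral_field_measure_return[symmetric] M) (auto simp: M_def)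
  also have "D \<union> (D' - D) = D'" using D by auto
  also have "(\<integral>\<^sup>+\<phi>. F \<phi> \<partial>field_measure M D') =
      (\<integral>\<^sup>+\<phi>. (\<Prod>i\<in>D'. h i (\<phi> i)) * F \<phi> \<partial>field_measure (\<lambda>_. pinned_lebesgue \<eta>) D')"
  proof (intro nn_integral_field_measure_density M site_family_pinned D(1) h F)
    fix i and f :: "real \<Rightarrow> ennreal"
    assume f[measurable]: "f \<in> borel_measurable borel"
    show "(\<integral>\<^sup>+y. f y \<partial>M i) = (\<integral>\<^sup>+y. h i y * f y \<partial>pinned_lebesgue \<eta>)"
    proof (cases "i \<in> D")
      case False
      have "(\<integral>\<^sup>+y. h i y * f y \<partial>lborel) = (\<integral>\<^sup>+y. 0 \<partial>(lborel :: real measure))"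
        by (rule nn_integral_lborel_cong_nonzero) (simp add: h_def False)
      then have "(\<integral>\<^sup>+y. h i y * f y \<partial>pinned_lebesgue \<eta>) = ennreal \<eta> * (ennreal (1 / \<eta>) * f 0)"
        using h f by (subst nn_integral_pinned) (auto simp: h_def False)
      also have "\<dots> = f 0"
        using \<eta> by (simp add: mult.assoc[symmetric] ennreal_mult[symmetric])
      finally show ?thesis using f by (simp add: M_def False nn_integral_return)
    qed (simp add: M_def h_def)
  qed
  finally show ?thesis by (simp add: h_def)
qed

lemma nn_integral_lborel_pinned:
  assumes D: "finite D" and F[measurable]: "F \<in> borel_measurable fields"
  shows "(\<integral>\<^sup>+\<phi>. F \<phi> \<partial>field_measure (\<lambda>_. lborel) D) =
    (\<integral>\<^sup>+\<phi>. (\<Prod>i\<in>D. if \<phi> i = 0 then 0 else 1) * F \<phi> \<partial>field_measure (\<lambda>_. pinned_lebesgue \<eta>) D)"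
proof (intro nn_integral_field_measure_density[where h = "\<lambda>_ y. if y = 0 then 0 else 1"]
    site_family_lborel site_family_pinned D F)
  fix f :: "real \<Rightarrow> ennreal"
  assume f[measurable]: "f \<in> borel_measurable borel"
  have "(\<integral>\<^sup>+y. f y \<partial>lborel) = (\<integral>\<^sup>+y. (if y = 0 then 0 else 1) * f y \<partial>lborel)"
    by (rule nn_integral_lborel_cong_nonzero) simp
  then show "(\<integral>\<^sup>+y. f y \<partial>lborel) = (\<integral>\<^sup>+y. (if y = 0 then 0 else 1) * f y \<partial>pinned_lebesgue \<eta>)"
    by (subst nn_integral_pinned) auto
qed measurable

text \<open>Multiplying the pinning strength tilts the measure by \<alpha> to the number of zeros.
  The logarithm of this tilt is linear in the number of pins, which prepares Jensen's
  inequality.\<close>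

lemma nn_integral_pinned_mult:
  assumes \<eta>: "\<eta> \<ge> 0" "\<alpha> \<ge> 0" and D: "finite D" and F[measurable]: "F \<in> borel_measurable fields"
  shows "(\<integral>\<^sup>+\<phi>. F \<phi> \<partial>field_measure (\<lambda>_. pinned_lebesgue (\<alpha> * \<eta>)) D) =
    (\<integral>\<^sup>+\<phi>. (\<Prod>i\<in>D. if \<phi> i = 0 then ennreal \<alpha> else 1) * F \<phi> \<partial>field_measure (\<lambda>_. pinned_lebesgue \<eta>) D)"
proof (intro nn_integral_field_measure_density[where h = "\<lambda>_ y. if y = 0 then ennreal \<alpha> else 1"]
    site_family_pinned D F)
  fix f :: "real \<Rightarrow> ennreal"
  assume f[measurable]: "f \<in> borel_measurable borel"
  have "(\<integral>\<^sup>+y. f y \<partial>lborel) = (\<integral>\<^sup>+y. (if y = 0 then ennreal \<alpha> else 1) * f y \<partial>lborel)"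
    by (rule nn_integral_lborel_cong_nonzero) simp
  then show "(\<integral>\<^sup>+y. f y \<partial>pinned_lebesgue (\<alpha> * \<eta>)) = (\<integral>\<^sup>+y. (if y = 0 then ennreal \<alpha> else 1) * f y \<partial>pinned_lebesgue \<eta>)"
    using \<eta> by (subst (1 2) nn_integral_pinned) (auto simp: ennreal_mult ac_simps)
qed measurable

lemma nn_integral_pinned_mono:
  assumes "\<eta> \<le> \<eta>'" and D: "finite D" and F[measurable]: "F \<in> borel_measurable fields"
  shows "(\<integral>\<^sup>+\<phi>. F \<phi> \<partial>field_measure (\<lambda>_. pinned_lebesgue \<eta>) D) \<le> (\<integral>\<^sup>+\<phi>. F \<phi> \<partial>field_measure (\<lambda>_. pinned_lebesgue \<eta>') D)"
  using assms
  by (intro nn_integral_field_measure_mono_measure site_family_pinned)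
    (auto simp: nn_integral_pinned intro!: add_left_mono mult_right_mono ennreal_leI)

lemma nn_integral_pinned_zero:
  assumes "\<eta> \<le> 0" and D: "finite D" and F[measurable]: "F \<in> borel_measurable fields"
  shows "(\<integral>\<^sup>+\<phi>. F \<phi> \<partial>field_measure (\<lambda>_. pinned_lebesgue \<eta>) D) = (\<integral>\<^sup>+\<phi>. F \<phi> \<partial>field_measure (\<lambda>_. lborel) D)"
  using assms
  by (intro antisym nn_integral_field_measure_mono_measure site_family_pinned site_family_lborel)
    (auto simp: nn_integral_pinned ennreal_neg)

text \<open>Sites of \<open>S\<close> (of \<open>S'\<close>) are forbidden to touch the wall, which replaces their a priori
  measure by Lebesgue measure; sites outside \<open>D\<close> are pinned, an event of positive mass as \<open>\<eta> > 0\<close>.\<close>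

lemma plus_integral_domination:
  fixes D :: "(int ^ 'd) set"
  assumes \<eta>: "\<eta> > 0" and sub: "S' \<subseteq> S" "S' \<subseteq> D" "D \<subseteq> D'" "S \<subseteq> D'" "D' \<subseteq> \<Lambda> L"
    and [measurable]: "G \<in> borel_measurable fields"
    and G: "\<And>\<phi> \<psi>. G \<phi> \<le> G (\<lambda>i. max (\<phi> i) (\<psi> i))"
  shows "plus_integral L \<eta> D S' G * plus_integral L \<eta> D' S (\<lambda>_. 1) \<le>
    plus_integral L \<eta> D S' (\<lambda>_. 1) * plus_integral L \<eta> D' S G"
proof -
  have fin: "finite D'" "finite S" "finite S'" "finite D"
    using sub finite_\<Lambda> by (meson finite_subset)+
  note [measurable] = measurable_positive_on[OF finite_\<Lambda>[of L] fin(2)] measurable_positive_on[OF finite_\<Lambda>[of L] fin(3)]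
  let ?h = "\<lambda>i y. if i \<in> D then 1 else ennreal (1 / \<eta>) * indicator {0} (y :: real)"
  define H :: "(int ^ 'd \<Rightarrow> real) \<Rightarrow> ennreal" where "H \<phi> = (\<Prod>i\<in>D'. ?h i (\<phi> i))" for \<phi>
  have [measurable]: "H \<in> borel_measurable fields"
    unfolding H_def[abs_def] by (rule measurable_prod_fields) measurable
  define w1 where "w1 \<phi> = H \<phi> * (indicator (positive_on (\<Lambda> L) S') \<phi> * boltzmann L \<phi>)" for \<phi>
  define w2 where "w2 \<phi> = indicator (positive_on (\<Lambda> L) S) \<phi> * boltzmann L \<phi>" for \<phi> :: "int ^ 'd \<Rightarrow> real"
  have small: "plus_integral L \<eta> D S' K = (\<integral>\<^sup>+\<phi>. K \<phi> * w1 \<phi> \<partial>field_measure (\<lambda>_. pinned_lebesgue \<eta>) D')"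
    if [measurable]: "K \<in> borel_measurable fields" for K
    unfolding plus_integral_def w1_def H_def
    by (subst nn_integral_subdomain[OF \<eta> fin(1) sub(3)]) (auto simp: ac_simps)
  have w: "w1 \<phi> * w2 \<psi> \<le> w1 (\<lambda>i. min (\<phi> i) (\<psi> i)) * w2 (\<lambda>i. max (\<phi> i) (\<psi> i))" for \<phi> \<psi>
  proof (cases "\<phi> \<in> positive_on (\<Lambda> L) S' \<and> \<psi> \<in> positive_on (\<Lambda> L) S")
    case True
    then have in': "(\<lambda>i. min (\<phi> i) (\<psi> i)) \<in> positive_on (\<Lambda> L) S'" "(\<lambda>i. max (\<phi> i) (\<psi> i)) \<in> positive_on (\<Lambda> L) S"
      using sub by (auto simp: positive_on_def less_max_iff_disj)
    \<comment> \<open>Off \<open>D\<close> the field \<phi> is pinned at 0 or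
      \<open>H \<phi>\<close> vanishes; as \<psi> is nonnegative there, the minimum is pinned too.
      This is where the wall makes pinning a decreasing event.\<close>
    have "H \<phi> \<le> H (\<lambda>i. min (\<phi> i) (\<psi> i))"
    proof (cases "\<exists>i\<in>D' - D. \<phi> i \<noteq> 0")
      case nz: True
      then have "H \<phi> = 0"
        using fin(1) unfolding H_def by (intro prod_zero) auto
      then show ?thesis by simp
    next
      case False
      have "?h i (\<phi> i) = ?h i (min (\<phi> i) (\<psi> i))" if "i \<in> D'" for i
      proof -
        have "0 \<le> \<psi> i" using True sub that by (auto simp: positive_on_def)
        then show ?thesis using False that by (auto simp: min_def)
      qed
      then show ?thesis unfolding H_def by (simp cong: prod.cong)
    qed
    then have "H \<phi> * (boltzmann L \<phi> * boltzmann L \<psi>) \<le> H (\<lambda>i. min (\<phi> i) (\<psi> i)) *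
        (boltzmann L (\<lambda>i. min (\<phi> i) (\<psi> i)) * boltzmann L (\<lambda>i. max (\<phi> i) (\<psi> i)))"
      by (intro mult_mono boltzmann_supermodular) auto
    then show ?thesis using True in' by (simp add: w1_def w2_def ac_simps)
  qed (auto simp: w1_def w2_def indicator_def)
  have m: "w1 \<in> borel_measurable fields" "w2 \<in> borel_measurable fields"
    unfolding w1_def[abs_def] w2_def[abs_def] by measurable
  have "(\<integral>\<^sup>+\<phi>. G \<phi> * w1 \<phi> \<partial>field_measure (\<lambda>_. pinned_lebesgue \<eta>) D') * (\<integral>\<^sup>+\<phi>. w2 \<phi> \<partial>field_measure (\<lambda>_. pinned_lebesgue \<eta>) D')
    \<le> (\<integral>\<^sup>+\<phi>. w1 \<phi> \<partial>field_measure (\<lambda>_. pinned_lebesgue \<eta>) D') * (\<integral>\<^sup>+\<phi>. G \<phi> * w2 \<phi> \<partial>field_measure (\<lambda>_. pinned_lebesgue \<eta>) D')"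
    by (rule domination[OF site_family_pinned fin(1) m]) (use w G in \<open>auto\<close>)
  then show ?thesis
    unfolding small[OF borel_measurable_const] small[OF \<open>G \<in> _\<close>]
    unfolding plus_integral_def w2_def[symmetric] by simp
qed

section \<open>Finiteness and positivity of partition functions\<close>

lemma nn_integral_gaussian_finite:
  assumes "a > 0"
  shows "(\<integral>\<^sup>+y. ennreal (exp (- a * y\<^sup>2)) \<partial>lborel) < \<infinity>"
proof -
  define \<sigma> where "\<sigma> = sqrt (1 / (2 * a))"
  have \<sigma>: "\<sigma> > 0" "\<sigma>\<^sup>2 = 1 / (2 * a)" using assms by (auto simp: \<sigma>_def)
  have "exp (- a * y\<^sup>2) = sqrt (2 * pi * \<sigma>\<^sup>2) * normal_density 0 \<sigma> y" for y
    using \<sigma> assms by (simp add: normal_density_def)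
  then have "(\<integral>\<^sup>+y. ennreal (exp (- a * y\<^sup>2)) \<partial>lborel) =
      ennreal (sqrt (2 * pi * \<sigma>\<^sup>2)) * (\<integral>\<^sup>+y. ennreal (normal_density 0 \<sigma> y) \<partial>lborel)"
    using \<sigma> assms by (simp add: ennreal_mult' nn_integral_cmult)
  also have "(\<integral>\<^sup>+y. ennreal (normal_density 0 \<sigma> y) \<partial>lborel) = 1"
    using prob_space.emeasure_space_1[OF prob_space_normal_density[OF \<sigma>(1), of 0]]
    by (simp add: emeasure_density)
  finally show ?thesis by simp
qed

text \<open>Coercivity, summed over the sites of \<open>D\<close>, dominates the Boltzmann factor by
  a product of one-site Gaussians. The constant \<open>c\<close> leaves room for giving away part of
  the energy to unbounded integrands.\<close>

lemma nn_integral_boltzmann_finite: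
  fixes D :: "(int ^ 'd) set"
  assumes M: "site_family M" and D: "D \<subseteq> \<Lambda> L" and c: "c > 0"
    and gauss: "\<And>i a. a > 0 \<Longrightarrow> (\<integral>\<^sup>+y. ennreal (exp (- a * y\<^sup>2)) \<partial>M i) < \<infinity>"
  shows "(\<integral>\<^sup>+\<phi>. ennreal (exp (- (c * energy L \<phi>))) \<partial>field_measure M D) < \<infinity>"
proof -
  have fin: "finite D" using D finite_\<Lambda> by (rule finite_subset)
  define K where "K = real (2 * L + 1) * (8 * real CARD('d))"
  have K: "K > 0" by (simp add: K_def)
  \<comment> \<open>The added 1 keeps the divisor positive when \<open>D\<close> is empty.\<close>
  define m where "m = real (card D + 1)"
  have m: "m > 0" by (simp add: m_def)
  define a where "a = c / (K * m)"
  have a: "a > 0" using K m c by (simp add: a_def)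
  have "(\<integral>\<^sup>+\<phi>. ennreal (exp (- (c * energy L \<phi>))) \<partial>field_measure M D) \<le>
    (\<integral>\<^sup>+\<phi>. (\<Prod>i\<in>D. ennreal (exp (- a * (\<phi> i)\<^sup>2))) \<partial>field_measure M D)"
  proof (rule nn_integral_field_measure_mono[OF M])
    fix \<phi> :: "int ^ 'd \<Rightarrow> real"
    assume \<phi>: "\<And>i. i \<notin> D \<Longrightarrow> \<phi> i = 0"
    have "(\<Sum>i\<in>D. (\<phi> i)\<^sup>2) \<le> (\<Sum>i\<in>D. K * energy L \<phi>)"
      unfolding K_def using \<phi> D by (intro sum_mono coercive) auto
    also have "\<dots> \<le> m * (K * energy L \<phi>)"
      using K energy_nonneg[of L \<phi>] by (simp add: m_def distrib_right)
    finally have "a * (\<Sum>i\<in>D. (\<phi> i)\<^sup>2) \<le> a * (m * (K * energy L \<phi>))"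
      using a by (intro mult_left_mono) auto
    also have "\<dots> = c * energy L \<phi>" using K m by (simp add: a_def field_simps)
    finally have "exp (- (c * energy L \<phi>)) \<le> exp (\<Sum>i\<in>D. - a * (\<phi> i)\<^sup>2)"
      by (simp add: sum_distrib_left sum_negf)
    then show "ennreal (exp (- (c * energy L \<phi>))) \<le> (\<Prod>i\<in>D. ennreal (exp (- a * (\<phi> i)\<^sup>2)))"
      using fin by (simp add: prod_ennreal exp_sum ennreal_leI)
  qed measurable
  also have "\<dots> = (\<Prod>i\<in>D. \<integral>\<^sup>+y. ennreal (exp (- a * y\<^sup>2)) \<partial>M i)"
    using fin by (intro nn_integral_field_measure_prod[OF M]) measurable
  also have "\<dots> < \<infinity>"
    using gauss[OF a] by (simp add: ennreal_prod_eq_top less_top[symmetric] top_unique)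
  finally show ?thesis .
qed

lemma nn_integral_gaussian_pinned_finite:
  assumes "a > 0"
  shows "(\<integral>\<^sup>+y. ennreal (exp (- a * y\<^sup>2)) \<partial>pinned_lebesgue \<eta>) < \<infinity>"
  using nn_integral_gaussian_finite[OF assms] by (subst nn_integral_pinned) (auto simp: ennreal_mult_less_top)

text \<open>Half of the energy absorbs a linear factor: a modulus is at most 1 plus the square,
  coercivity bounds the square by the energy, and \<open>x * exp (- x) \<le> 1\<close>.\<close>

lemma coordinate_boltzmann_le:
  fixes \<phi> :: "int ^ 'd \<Rightarrow> real"
  assumes "\<And>i. i \<notin> \<Lambda> L \<Longrightarrow> \<phi> i = 0"
  shows "\<bar>\<phi> k\<bar> * exp (- energy L \<phi>) \<le> (1 + 2 * (real (2 * L + 1) * (8 * real CARD('d)))) * exp (- energy L \<phi> / 2)"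
proof -
  define K where "K = real (2 * L + 1) * (8 * real CARD('d))"
  have K: "K > 0" by (simp add: K_def)
  let ?x = "energy L \<phi> / 2"
  have "\<bar>\<phi> k\<bar> \<le> 1 + (\<phi> k)\<^sup>2"
    using zero_le_power2[of "\<bar>\<phi> k\<bar> - 1"] abs_ge_zero[of "\<phi> k"] by (simp add: power2_diff)
  also have "\<dots> \<le> 1 + K * energy L \<phi>" unfolding K_def using coercive[OF assms] by simp
  also have "\<dots> = 1 + 2 * K * ?x" by simp
  finally have "\<bar>\<phi> k\<bar> * exp (- ?x) \<le> (1 + 2 * K * ?x) * exp (- ?x)" by (intro mult_right_mono) auto
  also have "\<dots> = exp (- ?x) + 2 * K * (?x * exp (- ?x))" by (simp add: algebra_simps)
  also have "\<dots> \<le> 1 + 2 * K * 1"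
  proof (intro add_mono mult_left_mono)
    show "exp (- ?x) \<le> 1" using energy_nonneg[of L \<phi>] by simp
    have "?x \<le> exp ?x" using exp_ge_add_one_self[of ?x] by linarith
    then show "?x * exp (- ?x) \<le> 1" by (simp add: exp_minus field_simps)
  qed (use K in auto)
  finally have "\<bar>\<phi> k\<bar> * exp (- ?x) * exp (- ?x) \<le> (1 + 2 * K) * exp (- ?x)"
    by (intro mult_right_mono) auto
  then show ?thesis unfolding K_def by (simp add: mult.assoc exp_add[symmetric])
qed

lemma plus_integral_finite:
  fixes D :: "(int ^ 'd) set"
  assumes D: "D \<subseteq> \<Lambda> L" and S: "S \<subseteq> D"
  shows "plus_integral L \<eta> D S (\<lambda>_. 1) < \<infinity>" "plus_integral L \<eta> D S (\<lambda>\<phi>. ennreal (\<phi> k)) < \<infinity>"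
proof -
  have fin: "finite S" using D S finite_\<Lambda> by (meson finite_subset)
  note [measurable] = measurable_positive_on[OF finite_\<Lambda>[of L] fin]
  define C where "C = 1 + 2 * (real (2 * L + 1) * (8 * real CARD('d)))"
  have C: "C \<ge> 1" by (simp add: C_def)
  let ?M = "field_measure (\<lambda>_. pinned_lebesgue \<eta>) D"
  have half: "(\<integral>\<^sup>+\<phi>. ennreal C * ennreal (exp (- energy L \<phi> / 2)) \<partial>?M) < \<infinity>"
    using nn_integral_boltzmann_finite[OF site_family_pinned D _ nn_integral_gaussian_pinned_finite, of "1 / 2"]
    by (simp add: nn_integral_cmult ennreal_mult_less_top)
  have "plus_integral L \<eta> D S (\<lambda>_. 1) \<le> (\<integral>\<^sup>+\<phi>. ennreal C * ennreal (exp (- energy L \<phi> / 2)) \<partial>?M)"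
    unfolding plus_integral_def
  proof (rule nn_integral_mono)
    fix \<phi> :: "int ^ 'd \<Rightarrow> real"
    have "1 * exp (- energy L \<phi>) \<le> C * exp (- energy L \<phi> / 2)"
      using C energy_nonneg[of L \<phi>] by (intro mult_mono) auto
    then show "1 * (indicator (positive_on (\<Lambda> L) S) \<phi> * boltzmann L \<phi>) \<le> ennreal C * ennreal (exp (- energy L \<phi> / 2))"
      using C by (auto simp: boltzmann_def indicator_def ennreal_mult[symmetric] ennreal_leI)
  qed
  also note half
  finally show "plus_integral L \<eta> D S (\<lambda>_. 1) < \<infinity>" .
  have "plus_integral L \<eta> D S (\<lambda>\<phi>. ennreal (\<phi> k)) \<le> (\<integral>\<^sup>+\<phi>. ennreal C * ennreal (exp (- energy L \<phi> / 2)) \<partial>?M)"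
    unfolding plus_integral_def
  proof (rule nn_integral_field_measure_mono[OF site_family_pinned])
    fix \<phi> :: "int ^ 'd \<Rightarrow> real"
    assume "\<And>i. i \<notin> D \<Longrightarrow> \<phi> i = 0"
    then have "\<bar>\<phi> k\<bar> * exp (- energy L \<phi>) \<le> C * exp (- energy L \<phi> / 2)"
      unfolding C_def using D by (intro coordinate_boltzmann_le) auto
    then have "\<phi> k * exp (- energy L \<phi>) \<le> C * exp (- energy L \<phi> / 2)"
      by (smt (verit) mult_right_mono exp_ge_zero)
    then show "ennreal (\<phi> k) * (indicator (positive_on (\<Lambda> L) S) \<phi> * boltzmann L \<phi>) \<le> ennreal C * ennreal (exp (- energy L \<phi> / 2))"
      using C by (auto simp: boltzmann_def indicator_def ennreal_mult[symmetric] ennreal_mult'' [symmetric] ennreal_leI)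
  qed measurable
  also note half
  finally show "plus_integral L \<eta> D S (\<lambda>\<phi>. ennreal (\<phi> k)) < \<infinity>" .
qed

lemma plus_integral_pos:
  fixes D :: "(int ^ 'd) set"
  assumes D: "D \<subseteq> \<Lambda> L" and S: "S \<subseteq> D"
  shows "plus_integral L \<eta> D S (\<lambda>_. 1) > 0"
proof -
  have fin: "finite D" "finite S" using D S finite_\<Lambda> by (meson finite_subset)+
  note [measurable] = measurable_positive_on[OF finite_\<Lambda>[of L] fin(2)]
  define C where "C = 1 / (8 * real CARD('d)) * real (card (bonds L :: ((int ^ 'd) \<times> (int ^ 'd)) set))"
  have "(0::ennreal) < ennreal (exp (- C))" by simp
  also have "\<dots> = ennreal (exp (- C)) * (\<Prod>i\<in>D. \<integral>\<^sup>+y. indicator {0<..<1} y \<partial>(lborel :: real measure))"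
    by simp
  also have "\<dots> = ennreal (exp (- C)) * (\<integral>\<^sup>+\<phi>. (\<Prod>i\<in>D. indicator {0<..<1} (\<phi> i)) \<partial>field_measure (\<lambda>_. lborel) D)"
    using fin by (subst nn_integral_field_measure_prod[OF site_family_lborel]) auto
  also have "\<dots> = (\<integral>\<^sup>+\<phi>. ennreal (exp (- C)) * (\<Prod>i\<in>D. indicator {0<..<1} (\<phi> i)) \<partial>field_measure (\<lambda>_. lborel) D)"
    by (intro nn_integral_cmult[symmetric]) measurable
  also have "\<dots> \<le> (\<integral>\<^sup>+\<phi>. 1 * (indicator (positive_on (\<Lambda> L) S) \<phi> * boltzmann L \<phi>) \<partial>field_measure (\<lambda>_. lborel) D)"
  proof (rule nn_integral_field_measure_mono[OF site_family_lborel])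
    fix \<phi> :: "int ^ 'd \<Rightarrow> real"
    assume \<phi>: "\<And>i. i \<notin> D \<Longrightarrow> \<phi> i = 0"
    show "ennreal (exp (- C)) * (\<Prod>i\<in>D. indicator {0<..<1} (\<phi> i)) \<le> 1 * (indicator (positive_on (\<Lambda> L) S) \<phi> * boltzmann L \<phi>)"
    proof (cases "\<forall>i\<in>D. \<phi> i \<in> {0<..<1}")
      case False
      then obtain i where "i \<in> D" "\<phi> i \<notin> {0<..<1}" by blast
      then have "(\<Prod>i\<in>D. indicator {0<..<1} (\<phi> i)) = (0 :: ennreal)"
        using fin by (intro prod_zero bexI[of _ i]) auto
      then show ?thesis by (simp only: mult_zero_right zero_le)
    next
      case True
      have unit: "0 \<le> \<phi> i" "\<phi> i \<le> 1" for i
        using True \<phi>[of i] by (cases "i \<in> D"; force)+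
      have "(\<phi> i - \<phi> j)\<^sup>2 \<le> 1" for i j
        using unit[of i] unit[of j] by (simp add: abs_square_le_1 abs_le_iff)
      then have "(\<Sum>(i, j)\<in>bonds L. (\<phi> i - \<phi> j)\<^sup>2) \<le> (\<Sum>(i, j)\<in>(bonds L :: ((int ^ 'd) \<times> (int ^ 'd)) set). 1)"
        by (intro sum_mono) (auto simp: split_beta)
      then have "energy L \<phi> \<le> C"
        unfolding energy_eq C_def by (intro mult_left_mono) (auto simp: split_beta)
      moreover have "\<phi> \<in> positive_on (\<Lambda> L) S"
        using unit True S by (auto simp: positive_on_def)
      ultimately show ?thesis
        using True by (simp add: boltzmann_def ennreal_leI)
    qed
  qed measurable
  also have "\<dots> \<le> plus_integral L \<eta> D S (\<lambda>_. 1)"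
    unfolding plus_integral_def
    by (rule nn_integral_field_measure_mono_measure[OF site_family_lborel site_family_pinned fin(1)])
      (auto simp: nn_integral_pinned)
  finally show ?thesis .
qed

subsection \<open>Green functions\<close>

abbreviation unit_field :: "'a \<Rightarrow> 'a \<Rightarrow> real" where
  "unit_field j \<equiv> (\<lambda>i. if i = j then 1 else 0)"

lemma dirichlet_sum_left:
  fixes \<psi> :: "int ^ 'd \<Rightarrow> real"
  assumes "finite B"
  shows "dirichlet L (\<lambda>i. \<Sum>j\<in>B. f j i) \<psi> = (\<Sum>j\<in>B. dirichlet L (f j) \<psi>)"
  using assms
proof (induction B rule: finite_induct)
  case empty
  show ?case by (simp add: dirichlet_def)
next
  case (insert x B)
  then show ?case by (simp add: dirichlet_add_left)
qed

lemma dirichlet_expand: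
  fixes \<psi> :: "int ^ 'd \<Rightarrow> real"
  assumes "finite B" "\<And>i. i \<notin> B \<Longrightarrow> f i = 0"
  shows "dirichlet L f \<psi> = (\<Sum>j\<in>B. f j * dirichlet L (unit_field j) \<psi>)"
proof -
  have "f = (\<lambda>i. \<Sum>j\<in>B. f j * unit_field j i)"
    using assms by (auto simp: fun_eq_iff if_distrib cong: if_cong)
  then have "dirichlet L f \<psi> = dirichlet L (\<lambda>i. \<Sum>j\<in>B. f j * unit_field j i) \<psi>" by simp
  also have "\<dots> = (\<Sum>j\<in>B. f j * dirichlet L (unit_field j) \<psi>)"
    using assms(1) by (simp only: dirichlet_sum_left dirichlet_scale_left)
  finally show ?thesis .
qed

lemma energy_pos:
  fixes f :: "int ^ 'd \<Rightarrow> real"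
  assumes "\<And>i. i \<notin> \<Lambda> L \<Longrightarrow> f i = 0" "f k \<noteq> 0"
  shows "energy L f > 0"
proof (rule ccontr)
  assume "\<not> energy L f > 0"
  then have "energy L f = 0" using energy_nonneg[of L f] by simp
  then show False using coercive[of L f k] assms by simp
qed

text \<open>Elimination one site at a time. The unit field at the new site \<open>x\<close>,
  corrected to be harmonic in \<open>b\<close>, has positive energy; a multiple of it repairs the
  equation at \<open>x\<close> without disturbing those already solved.\<close>

lemma dirichlet_problem_solvable:
  fixes b :: "(int ^ 'd) set"
  assumes "finite b" "b \<subseteq> \<Lambda> L"
  shows "\<exists>g. (\<forall>i. i \<notin> b \<longrightarrow> g i = 0) \<and> (\<forall>j\<in>b. dirichlet L (unit_field j) g = c j)"
  using assms
proof (induction b arbitrary: c rule: finite_induct)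
  case empty
  then show ?case by (intro exI[of _ "\<lambda>_. 0"]) auto
next
  case (insert x b)
  obtain g where g: "\<And>i. i \<notin> b \<Longrightarrow> g i = 0" "\<And>j. j \<in> b \<Longrightarrow> dirichlet L (unit_field j) g = c j"
    using insert.IH[of c] insert.prems by auto
  obtain v where v: "\<And>i. i \<notin> b \<Longrightarrow> v i = 0"
    "\<And>j. j \<in> b \<Longrightarrow> dirichlet L (unit_field j) v = dirichlet L (unit_field j) (unit_field x)"
    using insert.IH[of "\<lambda>j. dirichlet L (unit_field j) (unit_field x)"] insert.prems by auto
  define f where "f i = unit_field x i + (-1) * v i" for i
  have f0: "f i = 0" if "i \<notin> insert x b" for i using that v by (simp add: f_def)
  have fx: "f x = 1" using insert.hyps v by (simp add: f_def)
  have dir_f: "dirichlet L \<psi> f = dirichlet L \<psi> (unit_field x) - dirichlet L \<psi> v" for \<psi>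
    using dirichlet_add_right[of L \<psi> "unit_field x" "\<lambda>i. (-1) * v i"] dirichlet_scale_right[of L \<psi> "-1" v]
    by (simp add: f_def[abs_def])
  have "dirichlet L f f = (\<Sum>j\<in>insert x b. f j * dirichlet L (unit_field j) f)"
    using insert.hyps f0 by (intro dirichlet_expand) auto
  also have "\<dots> = dirichlet L (unit_field x) f"
    using insert.hyps v fx by (simp add: dir_f)
  finally have "dirichlet L (unit_field x) f = 2 * energy L f" by (simp add: energy_dirichlet)
  moreover have "energy L f > 0"
  proof (rule energy_pos)
    show "f i = 0" if "i \<notin> \<Lambda> L" for i using f0[of i] insert.prems that by blast
    show "f x \<noteq> 0" using fx by simp
  qed
  ultimately have pos: "dirichlet L (unit_field x) f > 0" by simp
  define \<tau> where "\<tau> = (c x - dirichlet L (unit_field x) g) / dirichlet L (unit_field x) f"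
  have dir_g: "dirichlet L \<psi> (\<lambda>i. g i + \<tau> * f i) = dirichlet L \<psi> g + \<tau> * dirichlet L \<psi> f" for \<psi>
    by (simp only: dirichlet_add_right dirichlet_scale_right)
  show ?case
  proof (intro exI[of _ "\<lambda>i. g i + \<tau> * f i"] conjI allI impI ballI)
    fix j assume "j \<in> insert x b"
    moreover have "dirichlet L (unit_field j) f = 0" if "j \<in> b" using that v by (simp add: dir_f)
    moreover have "\<tau> * dirichlet L (unit_field x) f = c x - dirichlet L (unit_field x) g"
      using pos by (simp add: \<tau>_def)
    ultimately show "dirichlet L (unit_field j) (\<lambda>i. g i + \<tau> * f i) = c j"
      using g unfolding dir_g by auto
  qed (use f0 g in auto)
qed

lemma dirichlet_disjoint_le:
  fixes f g :: "int ^ 'd \<Rightarrow> real"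
  assumes "\<And>i. 0 \<le> f i" "\<And>i. 0 \<le> g i" "\<And>i. f i * g i = 0"
  shows "dirichlet L f g \<le> 0"
proof -
  have "(f i - f j) * (g i - g j) \<le> 0" for i j
  proof -
    have "(f i - f j) * (g i - g j) = f i * g i + f j * g j - f i * g j - f j * g i"
      by (simp add: algebra_simps)
    then show ?thesis
      using assms(3)[of i] assms(3)[of j] mult_nonneg_nonneg[OF assms(1,2), of i j]
        mult_nonneg_nonneg[OF assms(1,2), of j i] by simp
  qed
  then have "(\<Sum>(i, j)\<in>bonds L. (f i - f j) * (g i - g j)) \<le> 0"
    by (intro sum_nonpos) (simp add: split_beta)
  then show ?thesis unfolding dirichlet_def by (intro mult_nonneg_nonpos) simp_all
qed

text \<open>\<open>g\<close> is the Green function of \<open>b\<close> with pole \<open>k\<close>,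
  and \<open>C\<close> bounds the effective resistance at \<open>k\<close>. The energy bound results
  from reading the capacity hypothesis at \<open>g\<close> itself, where
  \<open>g k = 2 * energy L g\<close>.\<close>

lemma green_function:
  fixes b :: "(int ^ 'd) set"
  assumes b: "finite b" "b \<subseteq> \<Lambda> L" and k: "k \<in> b"
    and cap: "\<And>f. (\<And>i. i \<notin> b \<Longrightarrow> f i = 0) \<Longrightarrow> (f k)\<^sup>2 \<le> C * energy L f"
  obtains g where "\<And>i. i \<notin> b \<Longrightarrow> g i = 0" "\<And>i. 0 \<le> g i" "4 * energy L g \<le> C"
    "\<And>\<phi>. (\<And>i. i \<notin> b \<Longrightarrow> \<phi> i = 0) \<Longrightarrow> dirichlet L \<phi> g = \<phi> k"
proof -
  obtain g where g: "\<And>i. i \<notin> b \<Longrightarrow> g i = 0" "\<And>j. j \<in> b \<Longrightarrow> dirichlet L (unit_field j) g = unit_field k j"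
    using dirichlet_problem_solvable[OF b, of "unit_field k"] by auto
  have rep: "dirichlet L \<phi> g = \<phi> k" if "\<And>i. i \<notin> b \<Longrightarrow> \<phi> i = 0" for \<phi>
  proof -
    have "dirichlet L \<phi> g = (\<Sum>j\<in>b. \<phi> j * unit_field k j)"
      using that b(1) g(2) by (subst dirichlet_expand[of b]) auto
    then show ?thesis using b(1) k by (simp add: if_distrib cong: if_cong)
  qed
  define p where "p i = max 0 (g i)" for i
  define n where "n i = max 0 (- g i)" for i
  have g_eq: "g = (\<lambda>i. p i + (-1) * n i)" by (auto simp: p_def n_def fun_eq_iff)
  have n0: "n i = 0" if "i \<notin> b" for i using that g by (simp add: n_def)
  \<comment> \<open>Testing the reproducing identity on the negative part: \<open>n k\<close> is
    nonnegative, yet equals a nonpositive cross term minus twice the energy of \<open>n\<close>.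
    Hence \<open>n\<close> vanishes and \<open>g\<close> is nonnegative.\<close>
  have "0 \<le> n k" by (simp add: n_def)
  also have "n k = dirichlet L n g" using rep[of n] n0 by simp
  also have "\<dots> = dirichlet L n p - dirichlet L n n"
    using dirichlet_add_right[of L n p "\<lambda>i. (-1) * n i"] dirichlet_scale_right[of L n "-1" n]
    by (simp add: g_eq)
  also have "\<dots> \<le> - 2 * energy L n"
  proof -
    have "n i * p i = 0" for i by (simp add: n_def p_def max_def)
    then have "dirichlet L n p \<le> 0"
      by (intro dirichlet_disjoint_le) (auto simp: n_def p_def)
    then show ?thesis by (simp add: energy_dirichlet)
  qed
  finally have "energy L n = 0" using energy_nonneg[of L n] by simp
  then have "n i = 0" for i using energy_pos[of L n i] n0 b(2) by (metis less_irrefl subsetD)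
  then have nonneg: "0 \<le> g i" for i by (metis max.cobounded2 n_def neg_le_0_iff_le)
  have "g k = 2 * energy L g" using rep[of g] g by (simp add: energy_dirichlet)
  moreover have "(g k)\<^sup>2 \<le> C * energy L g" using cap[of g] g by simp
  ultimately have "4 * energy L g * energy L g \<le> C * energy L g" by (simp add: power2_eq_square)
  moreover have "energy L g > 0"
  proof (rule ccontr)
    assume "\<not> energy L g > 0"
    then have "g i = 0" for i using energy_pos[of L g i] g(1) b(2) by (metis subsetD)
    then have "dirichlet L (unit_field k) g = 0" by (simp add: dirichlet_def)
    then show False using g(2)[OF k] by simp
  qed
  ultimately have "4 * energy L g \<le> C" by simp
  then show ?thesis using that g(1) nonneg rep by blast
qed

subsection \<open>Bochner integrals of fields\<close>

lemma field_measure_shift: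
  assumes "finite D" "\<And>i. i \<notin> D \<Longrightarrow> f i = 0"
  shows "distr (field_measure (\<lambda>_. lborel) D) fields (\<lambda>\<phi> i. \<phi> i + f i) = field_measure (\<lambda>_. lborel) D"
proof (rule measure_eqI)
  fix A assume "A \<in> sets (distr (field_measure (\<lambda>_. lborel) D) fields (\<lambda>\<phi> i. \<phi> i + f i))"
  then have A[measurable]: "A \<in> sets fields" by simp
  have "emeasure (distr (field_measure (\<lambda>_. lborel) D) fields (\<lambda>\<phi> i. \<phi> i + f i)) A =
    (\<integral>\<^sup>+\<phi>. indicator A \<phi> \<partial>distr (field_measure (\<lambda>_. lborel) D) fields (\<lambda>\<phi> i. \<phi> i + f i))"
    by simp
  also have "\<dots> = (\<integral>\<^sup>+\<phi>. indicator A (\<lambda>i. \<phi> i + f i) \<partial>field_measure (\<lambda>_. lborel) D)"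
    by (rule nn_integral_distr) (simp_all add: measurable_fields_shift measurable_cong_sets[OF sets_field_measure refl])
  also have "\<dots> = (\<integral>\<^sup>+\<phi>. indicator A \<phi> \<partial>field_measure (\<lambda>_. lborel) D)"
    by (rule nn_integral_field_measure_shift[OF assms(1) _ assms(2)]) simp
  finally show "emeasure (distr (field_measure (\<lambda>_. lborel) D) fields (\<lambda>\<phi> i. \<phi> i + f i)) A =
    emeasure (field_measure (\<lambda>_. lborel) D) A" by simp
qed simp

lemma integral_field_measure_shift:
  fixes F :: "('a \<Rightarrow> real) \<Rightarrow> real"
  assumes "finite D" "\<And>i. i \<notin> D \<Longrightarrow> f i = 0" "F \<in> borel_measurable fields"
  shows "(\<integral>\<phi>. F (\<lambda>i. \<phi> i + f i) \<partial>field_measure (\<lambda>_. lborel) D) = (\<integral>\<phi>. F \<phi> \<partial>field_measure (\<lambda>_. lborel) D)"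
    and "integrable (field_measure (\<lambda>_. lborel) D) (\<lambda>\<phi>. F (\<lambda>i. \<phi> i + f i)) \<longleftrightarrow>
      integrable (field_measure (\<lambda>_. lborel) D) F"
proof -
  have m: "(\<lambda>\<phi> i. \<phi> i + f i) \<in> measurable (field_measure (\<lambda>_. lborel) D) fields"
    by (simp add: measurable_fields_shift measurable_cong_sets[OF sets_field_measure refl])
  show "(\<integral>\<phi>. F (\<lambda>i. \<phi> i + f i) \<partial>field_measure (\<lambda>_. lborel) D) = (\<integral>\<phi>. F \<phi> \<partial>field_measure (\<lambda>_. lborel) D)"
    using integral_distr[OF m assms(3)] field_measure_shift[OF assms(1,2)] by simp
  show "integrable (field_measure (\<lambda>_. lborel) D) (\<lambda>\<phi>. F (\<lambda>i. \<phi> i + f i)) \<longleftrightarrow>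
      integrable (field_measure (\<lambda>_. lborel) D) F"
    using integrable_distr_eq[OF m assms(3)] field_measure_shift[OF assms(1,2)] by simp
qed

lemma AE_field_measure:
  assumes "site_family M"
    and "\<And>\<phi>. (\<And>i. i \<notin> D \<Longrightarrow> \<phi> i = 0) \<Longrightarrow> P \<phi>" "{\<phi>. P \<phi>} \<in> sets fields"
  shows "AE \<phi> in field_measure M D. P \<phi>"
  unfolding field_measure_def
  by (subst AE_distr_iff[OF measurable_zero_ext[OF assms(1)]])
    (use assms in \<open>auto simp: space_PiM zero_ext_def\<close>)

lemma UNIV_fields [simp, measurable]: "UNIV \<in> sets (fields :: ('a \<Rightarrow> real) measure)"
  using sets.top[of "fields :: ('a \<Rightarrow> real) measure"] by (simp add: space_PiM)

lemma measurable_dirichlet_shift: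
  "(\<lambda>\<phi>. dirichlet L (\<lambda>i. \<phi> i + \<zeta> i) f) \<in> borel_measurable fields"
  unfolding dirichlet_def by measurable

lemma measurable_energy_shift:
  "(\<lambda>\<phi>. energy L (\<lambda>i. \<phi> i + \<zeta> i)) \<in> borel_measurable fields"
  unfolding energy_def by measurable

text \<open>Parallelogram identity: \<phi> is a difference of two fields, so its energy is at most
  twice the sum of theirs. Integrability with zero exterior thus carries over to arbitrary exterior
  heights.\<close>

lemma energy_shift_lower: "energy L \<phi> / 2 - energy L \<zeta> \<le> energy L (\<lambda>i. \<phi> i + \<zeta> i)"
  for \<phi> \<zeta> :: "int ^ 'd \<Rightarrow> real"
proof -
  define a where "a i = \<phi> i + \<zeta> i" for i
  have "energy L (\<lambda>i. a i + (-1) * \<zeta> i) = energy L a + dirichlet L a (\<lambda>i. (-1) * \<zeta> i) + energy L (\<lambda>i. (-1) * \<zeta> i)"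
    by (rule energy_add)
  then have minus: "energy L (\<lambda>i. a i + (-1) * \<zeta> i) = energy L a - dirichlet L a \<zeta> + energy L \<zeta>"
    using dirichlet_scale_right[of L a "-1" \<zeta>] energy_scale[of L "-1" \<zeta>] by simp
  have plus: "energy L (\<lambda>i. a i + \<zeta> i) = energy L a + dirichlet L a \<zeta> + energy L \<zeta>"
    by (rule energy_add)
  have "(\<lambda>i. a i + (-1) * \<zeta> i) = \<phi>" by (simp add: a_def)
  then show ?thesis
    using minus plus energy_nonneg[of L "\<lambda>i. a i + \<zeta> i"] by (simp add: a_def[symmetric])
qed

subsection \<open>One block with given exterior heights\<close>

locale block =
  fixes L :: nat and b :: "(int ^ 'd) set" and \<zeta> :: "int ^ 'd \<Rightarrow> real"
  assumes b: "b \<subseteq> \<Lambda> L"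
    and \<zeta>_outside: "\<And>i. i \<notin> \<Lambda> L \<Longrightarrow> \<zeta> i = 0"
    and \<zeta>_nonneg: "\<And>i. 0 \<le> \<zeta> i"
    and \<zeta>_block: "\<And>i. i \<in> b \<Longrightarrow> \<zeta> i = 0"
begin

abbreviation "M \<equiv> field_measure (\<lambda>_. lborel) b"

definition w :: "(int ^ 'd \<Rightarrow> real) \<Rightarrow> real" where
  "w \<phi> = exp (- energy L (\<lambda>i. \<phi> i + \<zeta> i))"

text \<open>The first variation of the energy of the full field in direction \<open>f\<close>; it is
  the linear term produced by a shift along \<open>f\<close>.\<close>

definition dual :: "(int ^ 'd \<Rightarrow> real) \<Rightarrow> (int ^ 'd \<Rightarrow> real) \<Rightarrow> real" where
  "dual f \<phi> = dirichlet L (\<lambda>i. \<phi> i + \<zeta> i) f"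

definition above :: "real \<Rightarrow> (int ^ 'd \<Rightarrow> real) set" where
  "above a = {\<phi>. \<forall>i\<in>b. - a \<le> \<phi> i}"

lemma finite_b [simp]: "finite b"
  using b finite_\<Lambda> by (rule finite_subset)

lemma measurable_w [measurable]: "w \<in> borel_measurable fields"
  unfolding w_def[abs_def] using measurable_energy_shift by measurable

lemma measurable_dual [measurable]: "dual f \<in> borel_measurable fields"
  unfolding dual_def[abs_def] by (rule measurable_dirichlet_shift)

lemma measurable_above [measurable]: "above a \<in> sets fields"
proof -
  have "above a = (\<Inter>i\<in>b. {\<phi>. - a \<le> \<phi> i}) \<inter> space fields"
    by (auto simp: above_def space_PiM)
  moreover have "{\<phi> \<in> space fields. - a \<le> \<phi> i} \<in> sets (fields :: (int ^ 'd \<Rightarrow> real) measure)" for i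
    by measurable
  ultimately show ?thesis by (auto simp: space_PiM intro!: sets.countable_INT'')
qed

lemma w_pos: "0 < w \<phi>" and w_nonneg: "0 \<le> w \<phi>"
  by (simp_all add: w_def)

lemma w_shift: "w (\<lambda>i. \<phi> i + s * f i) = exp (- s * dual f \<phi> - s\<^sup>2 * energy L f) * w \<phi>"
proof -
  have "energy L (\<lambda>i. (\<phi> i + \<zeta> i) + s * f i) = energy L (\<lambda>i. \<phi> i + \<zeta> i) + s * dual f \<phi> + s\<^sup>2 * energy L f"
    using energy_add[of L "\<lambda>i. \<phi> i + \<zeta> i" "\<lambda>i. s * f i"]
      dirichlet_scale_right[of L "\<lambda>i. \<phi> i + \<zeta> i" s f] energy_scale[of L s f]
    by (simp add: dual_def)
  moreover have "(\<lambda>i. (\<phi> i + s * f i) + \<zeta> i) = (\<lambda>i. (\<phi> i + \<zeta> i) + s * f i)" by auto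
  ultimately show ?thesis by (simp add: w_def exp_add[symmetric])
qed

lemma w_supermodular: "w \<phi> * w \<psi> \<le> w (\<lambda>i. min (\<phi> i) (\<psi> i)) * w (\<lambda>i. max (\<phi> i) (\<psi> i))"
  using energy_min_max[of L "\<lambda>i. \<phi> i + \<zeta> i" "\<lambda>i. \<psi> i + \<zeta> i"]
  by (simp add: w_def exp_add[symmetric] min_add_distrib_left max_add_distrib_left)

lemma nn_integral_half_finite: "(\<integral>\<^sup>+\<phi>. ennreal (exp (- energy L (\<lambda>i. \<phi> i + \<zeta> i) / 2)) \<partial>M) < \<infinity>"
proof -
  have "(\<integral>\<^sup>+\<phi>. ennreal (exp (- energy L (\<lambda>i. \<phi> i + \<zeta> i) / 2)) \<partial>M) \<le>
    (\<integral>\<^sup>+\<phi>. ennreal (exp (energy L \<zeta> / 2)) * ennreal (exp (- (1 / 4 * energy L \<phi>))) \<partial>M)"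
  proof (rule nn_integral_mono)
    fix \<phi>
    have "exp (- energy L (\<lambda>i. \<phi> i + \<zeta> i) / 2) \<le> exp (energy L \<zeta> / 2 + - (1 / 4 * energy L \<phi>))"
      using energy_shift_lower[of L \<phi> \<zeta>] by simp
    then show "ennreal (exp (- energy L (\<lambda>i. \<phi> i + \<zeta> i) / 2)) \<le>
      ennreal (exp (energy L \<zeta> / 2)) * ennreal (exp (- (1 / 4 * energy L \<phi>)))"
      by (simp only: exp_add ennreal_mult'[OF exp_ge_zero, symmetric] ennreal_leI)
  qed
  also have "\<dots> < \<infinity>"
    using nn_integral_boltzmann_finite[OF site_family_lborel b, of "1 / 4"] nn_integral_gaussian_finite
    by (subst nn_integral_cmult) (auto simp: ennreal_mult_less_top)
  finally show ?thesis .
qed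

lemma integrable_half: "integrable M (\<lambda>\<phi>. exp (- energy L (\<lambda>i. \<phi> i + \<zeta> i) / 2))"
  using nn_integral_half_finite measurable_energy_shift[of L \<zeta>]
  by (intro integrableI_nonneg) auto

lemma integrable_w [simp]: "integrable M w"
proof (rule Bochner_Integration.integrable_bound[OF integrable_half])
  show "w \<in> borel_measurable M" by measurable
  show "AE \<phi> in M. norm (w \<phi>) \<le> norm (exp (- energy L (\<lambda>i. \<phi> i + \<zeta> i) / 2))"
    using energy_nonneg by (intro AE_I2) (simp add: w_def)
qed

lemma integrable_bounded_w:
  assumes [measurable]: "g \<in> borel_measurable fields" and g: "\<And>\<phi>. \<bar>g \<phi>\<bar> \<le> 1"
  shows "integrable M (\<lambda>\<phi>. g \<phi> * w \<phi>)"
proof (rule Bochner_Integration.integrable_bound[OF integrable_w])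
  show "(\<lambda>\<phi>. g \<phi> * w \<phi>) \<in> borel_measurable M" by measurable
  show "AE \<phi> in M. norm (g \<phi> * w \<phi>) \<le> norm (w \<phi>)"
    using g w_nonneg by (intro AE_I2) (simp add: abs_mult mult_left_le_one_le)
qed

lemma integrable_indicator_w:
  assumes [measurable]: "A \<in> sets fields"
  shows "integrable M (\<lambda>\<phi>. indicator A \<phi> * w \<phi>)"
  by (rule integrable_bounded_w) (auto simp: indicator_def)

lemma integrable_coordinate: "integrable M (\<lambda>\<phi>. (\<phi> i + \<zeta> i) * w \<phi>)"
proof (rule Bochner_Integration.integrable_bound[OF integrable_mult_right[OF integrable_half]])
  let ?C = "1 + 2 * (real (2 * L + 1) * (8 * real CARD('d)))"
  show "(\<lambda>\<phi>. (\<phi> i + \<zeta> i) * w \<phi>) \<in> borel_measurable M" by measurable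
  show "AE \<phi> in M. norm ((\<phi> i + \<zeta> i) * w \<phi>) \<le> norm (?C * exp (- energy L (\<lambda>i. \<phi> i + \<zeta> i) / 2))"
  proof (rule AE_field_measure[OF site_family_lborel])
    fix \<phi> :: "int ^ 'd \<Rightarrow> real" assume "\<And>i. i \<notin> b \<Longrightarrow> \<phi> i = 0"
    then have "\<bar>\<phi> i + \<zeta> i\<bar> * exp (- energy L (\<lambda>i. \<phi> i + \<zeta> i)) \<le> ?C * exp (- energy L (\<lambda>i. \<phi> i + \<zeta> i) / 2)"
      using coordinate_boltzmann_le[of L "\<lambda>i. \<phi> i + \<zeta> i" i] b \<zeta>_outside by auto
    then show "norm ((\<phi> i + \<zeta> i) * w \<phi>) \<le> norm (?C * exp (- energy L (\<lambda>i. \<phi> i + \<zeta> i) / 2))"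
      by (simp add: w_def abs_mult)
  next
    have "{\<phi> \<in> space fields. norm ((\<phi> i + \<zeta> i) * w \<phi>) \<le> norm (?C * exp (- energy L (\<lambda>i. \<phi> i + \<zeta> i) / 2))} \<in> sets fields"
      using measurable_energy_shift[of L \<zeta>] by measurable
    then show "{\<phi>. norm ((\<phi> i + \<zeta> i) * w \<phi>) \<le> norm (?C * exp (- energy L (\<lambda>i. \<phi> i + \<zeta> i) / 2))} \<in> sets fields"
      by (simp add: space_PiM)
  qed
qed

lemma integrable_dual: "integrable M (\<lambda>\<phi>. dual f \<phi> * w \<phi>)"
proof -
  have "integrable M (\<lambda>\<phi>. 1 / (4 * real CARD('d)) * (\<Sum>p\<in>bonds L.
      (f (fst p) - f (snd p)) * ((\<phi> (fst p) + \<zeta> (fst p)) * w \<phi> - (\<phi> (snd p) + \<zeta> (snd p)) * w \<phi>)))"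
    by (intro integrable_mult_right Bochner_Integration.integrable_sum Bochner_Integration.integrable_diff integrable_coordinate)
  moreover have "dual f \<phi> * w \<phi> = 1 / (4 * real CARD('d)) * (\<Sum>p\<in>bonds L.
      (f (fst p) - f (snd p)) * ((\<phi> (fst p) + \<zeta> (fst p)) * w \<phi> - (\<phi> (snd p) + \<zeta> (snd p)) * w \<phi>))" for \<phi>
    unfolding dual_def dirichlet_def mult.assoc sum_distrib_right
    by (intro arg_cong[where f = "(*) _"] sum.cong) (auto simp: algebra_simps)
  ultimately show ?thesis by simp
qed

lemma integrable_dual_indicator:
  assumes [measurable]: "A \<in> sets fields"
  shows "integrable M (\<lambda>\<phi>. dual f \<phi> * (indicator A \<phi> * w \<phi>))"
  using integrable_real_mult_indicator[OF _ integrable_dual[of f], of A]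
  by (simp add: ac_simps)

lemma integral_shift:
  fixes F :: "(int ^ 'd \<Rightarrow> real) \<Rightarrow> real"
  assumes "\<And>i. i \<notin> b \<Longrightarrow> f i = 0" "F \<in> borel_measurable fields"
  shows "(\<integral>\<phi>. F (\<lambda>i. \<phi> i + s * f i) \<partial>M) = (\<integral>\<phi>. F \<phi> \<partial>M)"
    and "integrable M (\<lambda>\<phi>. F (\<lambda>i. \<phi> i + s * f i)) \<longleftrightarrow> integrable M F"
  using integral_field_measure_shift[of b "\<lambda>i. s * f i" F] assms by auto

text \<open>Translation invariance of Lebesgue measure turns the shift formula into an exponential
  moment: under the weight \<open>w\<close>, \<open>dual f\<close> is a centred Gaussian variable of
  variance \<open>2 * energy L f\<close>, whatever the exterior.\<close>

lemma mgf_dual: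
  assumes f: "\<And>i. i \<notin> b \<Longrightarrow> f i = 0"
  shows "integrable M (\<lambda>\<phi>. exp (- s * dual f \<phi>) * w \<phi>)"
    and "(\<integral>\<phi>. exp (- s * dual f \<phi>) * w \<phi> \<partial>M) = exp (s\<^sup>2 * energy L f) * (\<integral>\<phi>. w \<phi> \<partial>M)"
proof -
  have eq: "exp (- s * dual f \<phi>) * w \<phi> = exp (s\<^sup>2 * energy L f) * w (\<lambda>i. \<phi> i + s * f i)" for \<phi>
    by (simp add: w_shift exp_diff)
  have int: "integrable M (\<lambda>\<phi>. w (\<lambda>i. \<phi> i + s * f i))"
    using integral_shift(2)[OF f measurable_w] by simp
  show "integrable M (\<lambda>\<phi>. exp (- s * dual f \<phi>) * w \<phi>)"
    unfolding eq using int by simp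
  show "(\<integral>\<phi>. exp (- s * dual f \<phi>) * w \<phi> \<partial>M) = exp (s\<^sup>2 * energy L f) * (\<integral>\<phi>. w \<phi> \<partial>M)"
    unfolding eq using integral_shift(1)[OF f measurable_w] by simp
qed

section \<open>Masses of events and association inside a block\<close>

definition mass :: "(int ^ 'd \<Rightarrow> real) set \<Rightarrow> real" where
  "mass A = (\<integral>\<phi>. indicator A \<phi> * w \<phi> \<partial>M)"

lemma mass_nonneg: "0 \<le> mass A"
  unfolding mass_def using w_nonneg by (intro integral_nonneg_AE AE_I2) simp

lemma mass_UNIV: "mass UNIV = (\<integral>\<phi>. w \<phi> \<partial>M)"
  by (simp add: mass_def)

lemma mass_mono:
  assumes "A \<subseteq> B" "A \<in> sets fields" "B \<in> sets fields"
  shows "mass A \<le> mass B"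
  unfolding mass_def using assms w_nonneg
  by (intro integral_mono integrable_indicator_w) (auto simp: indicator_def)

lemma mass_compl:
  assumes [measurable]: "A \<in> sets fields"
  shows "mass (- A) = mass UNIV - mass A"
proof -
  have "mass (- A) = (\<integral>\<phi>. indicator UNIV \<phi> * w \<phi> - indicator A \<phi> * w \<phi> \<partial>M)"
    unfolding mass_def by (intro Bochner_Integration.integral_cong) (auto simp: indicator_def)
  also have "\<dots> = mass UNIV - mass A"
    unfolding mass_def by (intro Bochner_Integration.integral_diff integrable_indicator_w) auto
  finally show ?thesis .
qed

lemma mass_above_pos: "0 < mass (above 0)"
proof -
  have "0 < (\<integral>\<^sup>+\<phi>. (\<Prod>i\<in>b. indicator {0<..<1::real} (\<phi> i)) \<partial>M)"
    by (subst nn_integral_field_measure_prod[OF site_family_lborel]) auto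
  also have "\<dots> \<le> (\<integral>\<^sup>+\<phi>. indicator (above 0) \<phi> \<partial>M)"
  proof (rule nn_integral_mono)
    fix \<phi> :: "int ^ 'd \<Rightarrow> real"
    show "(\<Prod>i\<in>b. indicator {0<..<1} (\<phi> i)) \<le> (indicator (above 0) \<phi> :: ennreal)"
    proof (cases "\<forall>i\<in>b. \<phi> i \<in> {0<..<1}")
      case False
      then obtain i where "i \<in> b" "\<phi> i \<notin> {0<..<1}" by blast
      then have "(\<Prod>i\<in>b. indicator {0<..<1} (\<phi> i)) = (0 :: ennreal)"
        by (intro prod_zero bexI[of _ i]) auto
      then show ?thesis by (simp only: zero_le)
    qed (auto simp: above_def less_imp_le)
  qed
  finally have "\<not> (AE \<phi> in M. indicator (above 0) \<phi> = (0::ennreal))"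
    by (subst nn_integral_0_iff_AE[symmetric]) auto
  then have "\<not> (AE \<phi> in M. indicator (above 0) \<phi> * w \<phi> = 0)"
    using w_pos by (auto simp: indicator_def less_le elim!: eventually_mono)
  moreover have "mass (above 0) = 0 \<longleftrightarrow> (AE \<phi> in M. indicator (above 0) \<phi> * w \<phi> = 0)"
    unfolding mass_def using w_nonneg
    by (intro integral_nonneg_eq_0_iff_AE integrable_indicator_w) auto
  ultimately show ?thesis using mass_nonneg[of "above 0"] by linarith
qed

lemma mass_UNIV_pos: "0 < mass UNIV"
  using mass_above_pos mass_mono[of "above 0" UNIV] by (auto intro: order.strict_trans2)

text \<open>The lattice condition on \<open>A\<close> and \<open>B\<close> says that
  \<open>B\<close> is the higher of two conditionings, so an increasing \<open>G\<close> has the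
  larger conditional mean on \<open>B\<close>. Real integrals replace extended ones here because the
  fluxes treated next are signed.\<close>

lemma fkg:
  assumes [measurable]: "A \<in> sets fields" "B \<in> sets fields" "G \<in> borel_measurable fields"
    and G: "\<And>\<phi>. 0 \<le> G \<phi>" "\<And>\<phi> \<psi>. G \<phi> \<le> G (\<lambda>i. max (\<phi> i) (\<psi> i))"
    and AB: "\<And>\<phi> \<psi>. \<phi> \<in> A \<Longrightarrow> \<psi> \<in> B \<Longrightarrow> (\<lambda>i. min (\<phi> i) (\<psi> i)) \<in> A \<and> (\<lambda>i. max (\<phi> i) (\<psi> i)) \<in> B"
    and int: "integrable M (\<lambda>\<phi>. G \<phi> * (indicator A \<phi> * w \<phi>))" "integrable M (\<lambda>\<phi>. G \<phi> * (indicator B \<phi> * w \<phi>))"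
  shows "(\<integral>\<phi>. G \<phi> * (indicator A \<phi> * w \<phi>) \<partial>M) * mass B \<le> mass A * (\<integral>\<phi>. G \<phi> * (indicator B \<phi> * w \<phi>) \<partial>M)"
proof -
  define v where "v E \<phi> = ennreal (indicator E \<phi> * w \<phi>)" for E \<phi>
  have [measurable]: "v E \<in> borel_measurable fields" if "E \<in> sets fields" for E
    using that unfolding v_def[abs_def] by measurable
  have "v A \<phi> * v B \<psi> \<le> v A (\<lambda>i. min (\<phi> i) (\<psi> i)) * v B (\<lambda>i. max (\<phi> i) (\<psi> i))" for \<phi> \<psi>
    using AB[of \<phi> \<psi>] w_supermodular[of \<phi> \<psi>] w_nonneg
    by (auto simp: v_def indicator_def ennreal_mult[symmetric] ennreal_leI)
  then have "(\<integral>\<^sup>+\<phi>. ennreal (G \<phi>) * v A \<phi> \<partial>M) * (\<integral>\<^sup>+\<phi>. v B \<phi> \<partial>M) \<le> (\<integral>\<^sup>+\<phi>. v A \<phi> \<partial>M) * (\<integral>\<^sup>+\<phi>. ennreal (G \<phi>) * v B \<phi> \<partial>M)"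
    using G(2) by (intro domination site_family_lborel finite_b ennreal_leI) auto
  moreover have "(\<integral>\<^sup>+\<phi>. v E \<phi> \<partial>M) = ennreal (mass E)" if "E \<in> sets fields" for E
    unfolding v_def mass_def using w_nonneg integrable_indicator_w[OF that]
    by (intro nn_integral_eq_integral) auto
  moreover have "(\<integral>\<^sup>+\<phi>. ennreal (G \<phi>) * v E \<phi> \<partial>M) = ennreal (\<integral>\<phi>. G \<phi> * (indicator E \<phi> * w \<phi>) \<partial>M)"
    if "integrable M (\<lambda>\<phi>. G \<phi> * (indicator E \<phi> * w \<phi>))" for E
    unfolding v_def ennreal_mult'[OF G(1), symmetric] using w_nonneg G(1) that
    by (intro nn_integral_eq_integral) auto
  moreover have "0 \<le> (\<integral>\<phi>. G \<phi> * (indicator E \<phi> * w \<phi>) \<partial>M)" for E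
    using w_nonneg G(1) by (intro integral_nonneg_AE AE_I2) simp
  ultimately show ?thesis
    using int mass_nonneg by (simp add: ennreal_mult[symmetric])
qed

end

section \<open>The flux out of a block and the cost of lowering the wall\<close>

lemma dirichlet_indicator_mono:
  fixes \<phi> \<psi> :: "int ^ 'd \<Rightarrow> real"
  assumes "\<And>i. i \<in> b \<Longrightarrow> \<phi> i \<le> \<psi> i"
  shows "dirichlet L (\<lambda>i. \<phi> i * indicator b i) (indicator b) \<le> dirichlet L (\<lambda>i. \<psi> i * indicator b i) (indicator b)"
proof -
  have "(\<Sum>(i, j)\<in>bonds L. (\<phi> i * indicator b i - \<phi> j * indicator b j) * (indicator b i - indicator b j))
    \<le> (\<Sum>(i, j)\<in>bonds L. (\<psi> i * indicator b i - \<psi> j * indicator b j) * (indicator b i - indicator b j))"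
    by (intro sum_mono) (auto simp: indicator_def assms)
  then show ?thesis unfolding dirichlet_def by (intro mult_left_mono) auto
qed

context block
begin

text \<open>The derivative of the energy when the whole block is raised rigidly. Bonds inside
  \<open>b\<close> drop out, and only gradients across its boundary remain.\<close>

abbreviation flux :: "(int ^ 'd \<Rightarrow> real) \<Rightarrow> real" where
  "flux \<equiv> dual (indicator b)"

definition flux_integral :: "real \<Rightarrow> real" where
  "flux_integral a = (\<integral>\<phi>. flux \<phi> * (indicator (above a) \<phi> * w \<phi>) \<partial>M)"

lemma above_add: "(\<lambda>i. \<phi> i + s * indicator b i) \<in> above a \<longleftrightarrow> \<phi> \<in> above (a + s)"
  by (auto simp: above_def algebra_simps)

text \<open>Raising the block by \<open>s\<close> maps \<open>above (a + s)\<close> onto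
  \<open>above a\<close> and multiplies the weight by
  \<open>exp (- s * flux - s\<^sup>2 * energy)\<close>. Jensen's inequality, as the tangent of the
  exponential at a bound \<open>m\<close> for the conditional mean flux, gives the factor.\<close>

lemma mass_above_step:
  assumes s: "0 \<le> s" and m: "flux_integral (a + s) \<le> m * mass (above (a + s))"
  shows "mass (above (a + s)) \<le> exp (s * m + s\<^sup>2 * energy L (indicator b)) * mass (above a)"
proof -
  let ?e = "s\<^sup>2 * energy L (indicator b)"
  let ?F = "\<lambda>\<phi>. indicator (above a) \<phi> * w \<phi>"
  let ?A = "above (a + s)"
  have shift: "(\<integral>\<phi>. ?F (\<lambda>i. \<phi> i + s * indicator b i) \<partial>M) = (\<integral>\<phi>. ?F \<phi> \<partial>M)"
    "integrable M (\<lambda>\<phi>. ?F (\<lambda>i. \<phi> i + s * indicator b i))"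
    using integral_shift[of "indicator b" ?F s] integrable_indicator_w[OF measurable_above] by auto
  have shift_eq: "?F (\<lambda>i. \<phi> i + s * indicator b i) = indicator ?A \<phi> * (exp (- s * flux \<phi> - ?e) * w \<phi>)" for \<phi>
  proof -
    have "indicator (above a) (\<lambda>i. \<phi> i + s * indicator b i) = (indicator ?A \<phi> :: real)"
      by (cases "\<phi> \<in> ?A") (use above_add[of \<phi> s a] in \<open>simp_all\<close>)
    then show ?thesis by (simp only: w_shift)
  qed
  have "exp (- (s * m + ?e)) * mass ?A \<le> exp (- (s * m + ?e)) * (mass ?A - s * (flux_integral (a + s) - m * mass ?A))"
    using m s by (intro mult_left_mono) (auto simp: mult_nonneg_nonpos)
  also have "\<dots> = (\<integral>\<phi>. exp (- (s * m + ?e)) * ((1 + s * m) * (indicator ?A \<phi> * w \<phi>) - s * (flux \<phi> * (indicator ?A \<phi> * w \<phi>))) \<partial>M)"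
  proof -
    have val: "(\<integral>\<phi>. (1 + s * m) * (indicator ?A \<phi> * w \<phi>) - s * (flux \<phi> * (indicator ?A \<phi> * w \<phi>)) \<partial>M)
        = (1 + s * m) * mass ?A - s * flux_integral (a + s)"
      unfolding mass_def flux_integral_def
      by (subst Bochner_Integration.integral_diff) (simp_all add: integrable_indicator_w integrable_dual_indicator)
    show ?thesis unfolding integral_mult_right_zero val by (simp add: algebra_simps)
  qed
  also have "\<dots> \<le> (\<integral>\<phi>. ?F (\<lambda>i. \<phi> i + s * indicator b i) \<partial>M)"
  proof (rule integral_mono[OF _ shift(2)])
    show "integrable M (\<lambda>\<phi>. exp (- (s * m + ?e)) * ((1 + s * m) * (indicator ?A \<phi> * w \<phi>) - s * (flux \<phi> * (indicator ?A \<phi> * w \<phi>))))"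
      by (intro integrable_mult_right Bochner_Integration.integrable_diff integrable_indicator_w integrable_dual_indicator) auto
    fix \<phi> :: "int ^ 'd \<Rightarrow> real"
    have "1 + (s * m - s * flux \<phi>) \<le> exp (s * m - s * flux \<phi>)" by (rule exp_ge_add_one_self)
    then have "exp (- (s * m + ?e)) * (1 + (s * m - s * flux \<phi>)) \<le> exp (- (s * m + ?e)) * exp (s * m - s * flux \<phi>)"
      by (intro mult_left_mono) auto
    also have "\<dots> = exp (- s * flux \<phi> - ?e)" by (simp add: exp_add[symmetric])
    finally have "(exp (- (s * m + ?e)) * (1 + (s * m - s * flux \<phi>))) * (indicator ?A \<phi> * w \<phi>)
        \<le> exp (- s * flux \<phi> - ?e) * (indicator ?A \<phi> * w \<phi>)"
      using w_nonneg by (intro mult_right_mono) auto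
    then show "exp (- (s * m + ?e)) * ((1 + s * m) * (indicator ?A \<phi> * w \<phi>) - s * (flux \<phi> * (indicator ?A \<phi> * w \<phi>)))
        \<le> ?F (\<lambda>i. \<phi> i + s * indicator b i)"
      unfolding shift_eq by (simp add: algebra_simps)
  qed
  also have "\<dots> = mass (above a)" unfolding shift(1) mass_def ..
  finally have "exp (- (s * m + ?e)) * mass ?A \<le> mass (above a)" .
  then have "exp (s * m + ?e) * (exp (- (s * m + ?e)) * mass ?A) \<le> exp (s * m + ?e) * mass (above a)"
    by (intro mult_left_mono) auto
  then show ?thesis by (simp only: mult.assoc[symmetric] exp_add[symmetric]) simp
qed

lemma flux_eq:
  assumes "\<And>i. i \<notin> b \<Longrightarrow> \<phi> i = 0"
  shows "dirichlet L (\<lambda>i. (\<phi> i + a) * indicator b i) (indicator b) =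
    flux \<phi> + (a * dirichlet L (indicator b) (indicator b) - dirichlet L \<zeta> (indicator b))"
proof -
  have "(\<lambda>i. (\<phi> i + a) * indicator b i) = (\<lambda>i. \<phi> i + a * indicator b i)"
    using assms by (auto simp: fun_eq_iff indicator_def)
  then show ?thesis
    using dirichlet_add_left[of L \<phi> "\<lambda>i. a * indicator b i" "indicator b"]
      dirichlet_scale_left[of L a "indicator b" "indicator b"] dirichlet_add_left[of L \<phi> \<zeta> "indicator b"]
    by (simp add: dual_def)
qed

text \<open>A lower wall lets the field sink, and the flux out of \<open>b\<close> increases with
  the heights in \<open>b\<close>; so lowering the wall can only lower the conditional mean
  flux.\<close>

lemma flux_integral_mono:
  assumes a: "0 \<le> a"
  shows "flux_integral a * mass (above 0) \<le> mass (above a) * flux_integral 0"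
proof -
  let ?\<iota> = "indicator b :: int ^ 'd \<Rightarrow> real"
  define c where "c = a * dirichlet L ?\<iota> ?\<iota> - dirichlet L \<zeta> ?\<iota>"
  \<comment> \<open>Association asks for a nonnegative function, whereas the flux is signed. Adding
    \<open>a\<close> to the heights changes it by the constant \<open>c\<close> and makes it
    nonnegative on every \<open>above e\<close> with \<open>e \<le> a\<close>; the truncation acts
    only off these events.\<close>
  define G where "G \<phi> = max 0 (dirichlet L (\<lambda>i. (\<phi> i + a) * ?\<iota> i) ?\<iota>)" for \<phi>
  have mG[measurable]: "G \<in> borel_measurable fields"
    unfolding G_def[abs_def] dirichlet_def by measurable
  have above_sub: "above 0 \<subseteq> above a" using a by (auto simp: above_def intro: order_trans[of _ 0])
  have G_eq: "AE \<phi> in M. G \<phi> * (indicator (above e) \<phi> * w \<phi>) = flux \<phi> * (indicator (above e) \<phi> * w \<phi>) + c * (indicator (above e) \<phi> * w \<phi>)"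
    if e: "e \<le> a" for e
  proof (rule AE_field_measure[OF site_family_lborel])
    fix \<phi> :: "int ^ 'd \<Rightarrow> real"
    assume \<phi>: "\<And>i. i \<notin> b \<Longrightarrow> \<phi> i = 0"
    show "G \<phi> * (indicator (above e) \<phi> * w \<phi>) = flux \<phi> * (indicator (above e) \<phi> * w \<phi>) + c * (indicator (above e) \<phi> * w \<phi>)"
    proof (cases "\<phi> \<in> above e")
      case True
      have "dirichlet L (\<lambda>i. 0 * ?\<iota> i) ?\<iota> \<le> dirichlet L (\<lambda>i. (\<phi> i + a) * ?\<iota> i) ?\<iota>"
        by (rule dirichlet_indicator_mono) (use True e in \<open>force simp: above_def\<close>)
      then have "G \<phi> = flux \<phi> + c"
        using flux_eq[of \<phi> a, OF \<phi>] by (simp add: G_def c_def dirichlet_def)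
      then show ?thesis by (simp add: algebra_simps)
    qed simp
  next
    have "{\<phi> \<in> space fields. G \<phi> * (indicator (above e) \<phi> * w \<phi>) = flux \<phi> * (indicator (above e) \<phi> * w \<phi>) + c * (indicator (above e) \<phi> * w \<phi>)} \<in> sets fields"
      by measurable
    then show "{\<phi>. G \<phi> * (indicator (above e) \<phi> * w \<phi>) = flux \<phi> * (indicator (above e) \<phi> * w \<phi>) + c * (indicator (above e) \<phi> * w \<phi>)} \<in> sets fields"
      by (simp add: space_PiM)
  qed
  have int: "integrable M (\<lambda>\<phi>. flux \<phi> * (indicator (above e) \<phi> * w \<phi>) + c * (indicator (above e) \<phi> * w \<phi>))" for e
    by (intro Bochner_Integration.integrable_add integrable_mult_right integrable_dual_indicator integrable_indicator_w) auto
  have G_int: "integrable M (\<lambda>\<phi>. G \<phi> * (indicator (above e) \<phi> * w \<phi>))"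
    and G_val: "(\<integral>\<phi>. G \<phi> * (indicator (above e) \<phi> * w \<phi>) \<partial>M) = flux_integral e + c * mass (above e)" if e: "e \<le> a" for e
  proof -
    have m: "(\<lambda>\<phi>. G \<phi> * (indicator (above e) \<phi> * w \<phi>)) \<in> borel_measurable M" by measurable
    show "integrable M (\<lambda>\<phi>. G \<phi> * (indicator (above e) \<phi> * w \<phi>))"
      using integrable_cong_AE[OF m borel_measurable_integrable[OF int] G_eq[OF e]] int by simp
    have "(\<integral>\<phi>. G \<phi> * (indicator (above e) \<phi> * w \<phi>) \<partial>M) = (\<integral>\<phi>. flux \<phi> * (indicator (above e) \<phi> * w \<phi>) + c * (indicator (above e) \<phi> * w \<phi>) \<partial>M)"
      by (rule integral_cong_AE[OF m borel_measurable_integrable[OF int] G_eq[OF e]])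
    also have "\<dots> = flux_integral e + c * mass (above e)"
      unfolding mass_def flux_integral_def
      by (subst Bochner_Integration.integral_add) (auto intro!: integrable_dual_indicator integrable_indicator_w)
    finally show "(\<integral>\<phi>. G \<phi> * (indicator (above e) \<phi> * w \<phi>) \<partial>M) = flux_integral e + c * mass (above e)" .
  qed
  have "(\<integral>\<phi>. G \<phi> * (indicator (above a) \<phi> * w \<phi>) \<partial>M) * mass (above 0) \<le> mass (above a) * (\<integral>\<phi>. G \<phi> * (indicator (above 0) \<phi> * w \<phi>) \<partial>M)"
  proof (rule fkg)
    fix \<phi> \<psi> :: "int ^ 'd \<Rightarrow> real"
    show "G \<phi> \<le> G (\<lambda>i. max (\<phi> i) (\<psi> i))"
      unfolding G_def by (intro max.mono order_refl dirichlet_indicator_mono) auto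
    assume "\<phi> \<in> above a" "\<psi> \<in> above 0"
    then show "(\<lambda>i. min (\<phi> i) (\<psi> i)) \<in> above a \<and> (\<lambda>i. max (\<phi> i) (\<psi> i)) \<in> above 0"
      using above_sub by (auto simp: above_def le_max_iff_disj)
  qed (use a in \<open>auto simp: G_def[symmetric] intro!: G_int, simp add: G_def\<close>)
  then show ?thesis unfolding G_val[OF order_refl] G_val[OF a] by (simp add: algebra_simps)
qed

text \<open>The logarithm of \<open>mass (above t)\<close> grows with slope at most the mean flux at
  the true wall. Instead of differentiating, the wall is lowered in \<open>n\<close> equal steps:
  the linear terms add up exactly and the quadratic errors sum to a multiple of
  \<open>1 / n\<close>.\<close>

lemma mass_above_le:
  assumes t: "0 \<le> t"
  shows "mass (above t) \<le> exp (t * (flux_integral 0 / mass (above 0))) * mass (above 0)"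
proof -
  define m where "m = flux_integral 0 / mass (above 0)"
  let ?e = "energy L (indicator b)"
  have m: "flux_integral a \<le> m * mass (above a)" if "0 \<le> a" for a
    using flux_integral_mono[OF that] mass_above_pos by (simp add: m_def field_simps)
  have steps: "mass (above (real k * s)) \<le> exp (real k * (s * m + s\<^sup>2 * ?e)) * mass (above 0)" if s: "0 \<le> s" for k s
  proof (induction k)
    case (Suc k)
    have "mass (above (real k * s + s)) \<le> exp (s * m + s\<^sup>2 * ?e) * mass (above (real k * s))"
      using s m by (intro mass_above_step) auto
    also have "\<dots> \<le> exp (s * m + s\<^sup>2 * ?e) * (exp (real k * (s * m + s\<^sup>2 * ?e)) * mass (above 0))"
      using Suc by (intro mult_left_mono) auto
    also have "\<dots> = exp (real (Suc k) * (s * m + s\<^sup>2 * ?e)) * mass (above 0)"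
      by (simp add: exp_add[symmetric] algebra_simps)
    finally show ?case by (simp add: algebra_simps)
  qed simp
  have "mass (above t) \<le> exp (t * m + t\<^sup>2 * ?e * inverse (real (Suc n))) * mass (above 0)" for n
  proof -
    have "mass (above (real (Suc n) * (t / real (Suc n)))) \<le>
      exp (real (Suc n) * (t / real (Suc n) * m + (t / real (Suc n))\<^sup>2 * ?e)) * mass (above 0)"
      using t by (intro steps) auto
    moreover have "real (Suc n) * (t / real (Suc n)) = t" by simp
    moreover have "real (Suc n) * (t / real (Suc n) * m + (t / real (Suc n))\<^sup>2 * ?e) =
      t * m + t\<^sup>2 * ?e * inverse (real (Suc n))"
    proof -
      define q where "q = real (Suc n)"
      have "q > 0" by (simp add: q_def)
      then show ?thesis unfolding q_def[symmetric] by (simp add: power2_eq_square field_simps)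
    qed
    ultimately show ?thesis by simp
  qed
  moreover have "(\<lambda>n. exp (t * m + t\<^sup>2 * ?e * inverse (real (Suc n))) * mass (above 0)) \<longlonglongrightarrow> exp (t * m + t\<^sup>2 * ?e * 0) * mass (above 0)"
    by (intro tendsto_intros LIMSEQ_inverse_real_of_nat)
  ultimately have "mass (above t) \<le> exp (t * m + t\<^sup>2 * ?e * 0) * mass (above 0)"
    by (intro LIMSEQ_le_const) auto
  then show ?thesis by (simp add: m_def)
qed

text \<open>The substitute for integration by parts. With \<open>m\<close> the conditional mean flux
  at the wall, \<open>mass (above 0)\<close> is at least
  \<open>exp (- (t * m)) * mass (above t)\<close>, hence at least
  \<open>(1 - t * m) * mass (above t)\<close>; the gain in mass is thus at most
  \<open>t * m * mass UNIV\<close>.\<close>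

lemma flux_integral_ge:
  assumes t: "0 \<le> t"
  shows "mass (above 0) * (mass (above t) - mass (above 0)) \<le> t * flux_integral 0 * mass UNIV"
proof -
  define m where "m = flux_integral 0 / mass (above 0)"
  note pos = mass_above_pos
  have mono: "mass (above 0) \<le> mass (above t)"
    using t by (intro mass_mono measurable_above) (auto simp: above_def intro: order_trans[of _ 0])
  have "exp (- (t * m)) * mass (above t) \<le> exp (- (t * m)) * (exp (t * m) * mass (above 0))"
    using mass_above_le[OF t] by (intro mult_left_mono) (auto simp: m_def)
  then have le: "exp (- (t * m)) * mass (above t) \<le> mass (above 0)"
    by (simp add: mult.assoc[symmetric] exp_add[symmetric])
  have "(1 - t * m) * mass (above t) \<le> exp (- (t * m)) * mass (above t)"
    using exp_ge_add_one_self[of "- (t * m)"] mass_nonneg by (intro mult_right_mono) auto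
  then have step: "mass (above t) - mass (above 0) \<le> t * m * mass (above t)"
    using le by (simp add: algebra_simps)
  have "0 \<le> t * m * mass (above t)" using step mono by linarith
  then have "0 \<le> t * m" using mono pos by (simp add: zero_le_mult_iff)
  then have "t * m * mass (above t) \<le> t * m * mass UNIV"
    by (intro mult_left_mono mass_mono) auto
  with step have "mass (above 0) * (mass (above t) - mass (above 0)) \<le> mass (above 0) * (t * m * mass UNIV)"
    using pos by (intro mult_left_mono) auto
  also have "\<dots> = t * flux_integral 0 * mass UNIV" using pos by (simp add: m_def)
  finally show ?thesis .
qed

text \<open>Tilting by a test function \<open>f\<close>: pushing the field down along \<open>f\<close> by \<open>s\<close> costs
  about \<open>exp (- s\<^sup>2 energy L f)\<close>.\<close>

lemma mass_below_ge:
  assumes f: "\<And>i. i \<notin> b \<Longrightarrow> f i = 0" "f x = 1" and e: "0 < energy L f" and s: "0 \<le> s"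
  shows "exp (- s\<^sup>2 * energy L f - 4 * s * sqrt (energy L f)) * (mass {\<phi>. \<phi> x < s} - mass UNIV / 4) \<le> mass {\<phi>. \<phi> x < 0}"
proof -
  define e where "e = energy L f"
  have e: "e > 0" using e by (simp add: e_def)
  \<comment> \<open>Chernoff's bound at \<open>?r\<close>: the products are
    \<open>?r * ?K = 8\<close> and \<open>?r\<^sup>2 * e = 4\<close>, so the exceptional event
    \<open>T\<close> has relative mass at most \<open>exp (- 4)\<close>, below one quarter.\<close>
  let ?K = "4 * sqrt e"
  let ?r = "2 / sqrt e"
  define S where "S = {\<phi> :: int ^ 'd \<Rightarrow> real. \<phi> x < s}"
  define T where "T = {\<phi>. dual f \<phi> \<le> - ?K}"
  have "{\<phi> \<in> space fields. \<phi> x < r} \<in> sets (fields :: (int ^ 'd \<Rightarrow> real) measure)" for r by measurable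
  then have lt[measurable]: "{\<phi> :: int ^ 'd \<Rightarrow> real. \<phi> x < r} \<in> sets fields" for r by (simp add: space_PiM)
  have S[measurable]: "S \<in> sets fields" unfolding S_def by (rule lt)
  have "{\<phi> \<in> space fields. dual f \<phi> \<le> - ?K} \<in> sets fields" by measurable
  then have T[measurable]: "T \<in> sets fields" by (simp add: space_PiM T_def)
  have tail: "mass T \<le> mass UNIV / 4"
  proof -
    have "mass T \<le> (\<integral>\<phi>. exp (- (?r * ?K)) * (exp (- ?r * dual f \<phi>) * w \<phi>) \<partial>M)"
      unfolding mass_def
    proof (intro integral_mono integrable_indicator_w T integrable_mult_right mgf_dual f)
      fix \<phi> :: "int ^ 'd \<Rightarrow> real"
      show "indicator T \<phi> * w \<phi> \<le> exp (- (?r * ?K)) * (exp (- ?r * dual f \<phi>) * w \<phi>)"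
      proof (cases "\<phi> \<in> T")
        case True
        then have "?r * (dual f \<phi> + ?K) \<le> 0" using e by (intro mult_nonneg_nonpos) (auto simp: T_def)
        then have "1 \<le> exp (- (?r * ?K) - ?r * dual f \<phi>)" by (simp add: algebra_simps)
        then have "1 * w \<phi> \<le> exp (- (?r * ?K) - ?r * dual f \<phi>) * w \<phi>" using w_nonneg by (intro mult_right_mono) auto
        then show ?thesis using True by (simp add: exp_diff exp_minus field_simps)
      qed (simp add: w_nonneg)
    qed auto
    also have "\<dots> = exp (- (?r * ?K)) * (exp (?r\<^sup>2 * e) * mass UNIV)"
      using mgf_dual(2)[of f ?r, OF f(1)] by (simp add: mass_UNIV e_def)
    also have "\<dots> = exp (- 4) * mass UNIV"
    proof -
      have "?r * ?K = 8" "?r\<^sup>2 * e = 4" using e by (auto simp: power_divide field_simps)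
      then show ?thesis by (simp add: mult.assoc[symmetric] exp_add[symmetric])
    qed
    also have "\<dots> \<le> 1 / 4 * mass UNIV"
    proof (intro mult_right_mono mass_nonneg)
      have "(4 :: real) \<le> exp 4" using exp_ge_add_one_self[of "4 :: real"] by simp
      then show "exp (- 4 :: real) \<le> 1 / 4" by (simp add: exp_minus field_simps)
    qed
    finally show ?thesis by simp
  qed
  have "mass S - mass UNIV / 4 \<le> mass S - mass T" using tail by simp
  also have "\<dots> \<le> mass (S - T)"
  proof -
    have "mass S - mass T = (\<integral>\<phi>. indicator S \<phi> * w \<phi> - indicator T \<phi> * w \<phi> \<partial>M)"
      unfolding mass_def by (intro Bochner_Integration.integral_diff[symmetric] integrable_indicator_w S T)
    also have "\<dots> \<le> mass (S - T)"
      unfolding mass_def using w_nonneg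
      by (intro integral_mono Bochner_Integration.integrable_diff integrable_indicator_w) (auto simp: indicator_def)
    finally show ?thesis .
  qed
  finally have "exp (- s\<^sup>2 * e - 4 * s * sqrt e) * (mass S - mass UNIV / 4) \<le> exp (- s\<^sup>2 * e - 4 * s * sqrt e) * mass (S - T)"
    by (intro mult_left_mono) auto
  also have "\<dots> = (\<integral>\<phi>. exp (- s\<^sup>2 * e - 4 * s * sqrt e) * (indicator (S - T) \<phi> * w \<phi>) \<partial>M)"
    by (simp add: mass_def)
  \<comment> \<open>As \<open>f x = 1\<close>, the shift carries \<open>\<phi> x < s\<close> into
    \<open>\<phi> x < 0\<close>; outside \<open>T\<close> the weight changes by no less than the
    displayed factor.\<close>
  also have "\<dots> \<le> (\<integral>\<phi>. indicator {\<phi>. \<phi> x < 0} (\<lambda>i. \<phi> i + (- s) * f i) * w (\<lambda>i. \<phi> i + (- s) * f i) \<partial>M)"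
  proof (rule integral_mono)
    show "integrable M (\<lambda>\<phi>. exp (- s\<^sup>2 * e - 4 * s * sqrt e) * (indicator (S - T) \<phi> * w \<phi>))"
      by (intro integrable_mult_right integrable_indicator_w) auto
    show "integrable M (\<lambda>\<phi>. indicator {\<phi>. \<phi> x < 0} (\<lambda>i. \<phi> i + (- s) * f i) * w (\<lambda>i. \<phi> i + (- s) * f i))"
      using integral_shift(2)[of f "\<lambda>\<phi>. indicator {\<phi>. \<phi> x < 0} \<phi> * w \<phi>" "- s"] f(1) integrable_indicator_w[OF lt]
      by auto
    fix \<phi> :: "int ^ 'd \<Rightarrow> real"
    show "exp (- s\<^sup>2 * e - 4 * s * sqrt e) * (indicator (S - T) \<phi> * w \<phi>) \<le>
      indicator {\<phi>. \<phi> x < 0} (\<lambda>i. \<phi> i + (- s) * f i) * w (\<lambda>i. \<phi> i + (- s) * f i)"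
    proof (cases "\<phi> \<in> S - T")
      case True
      have "s * (- ?K) \<le> s * dual f \<phi>" using True s by (intro mult_left_mono) (auto simp: T_def)
      then have "exp (- s\<^sup>2 * e - 4 * s * sqrt e) \<le> exp (- (- s) * dual f \<phi> - (- s)\<^sup>2 * energy L f)"
        by (simp add: e_def)
      then have "exp (- s\<^sup>2 * e - 4 * s * sqrt e) * w \<phi> \<le> w (\<lambda>i. \<phi> i + (- s) * f i)"
        unfolding w_shift using w_nonneg by (intro mult_right_mono)
      then show ?thesis using True f(2) by (simp add: S_def)
    qed (simp add: w_nonneg)
  qed
  also have "\<dots> = mass {\<phi>. \<phi> x < 0}"
    using integral_shift(1)[of f "\<lambda>\<phi>. indicator {\<phi>. \<phi> x < 0} \<phi> * w \<phi>" "- s"] f(1) by (simp add: mass_def)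
  finally show ?thesis by (simp add: S_def e_def)
qed

text \<open>Exponential Chebyshev bound for \<open>dual g\<close>, with \<open>g\<close> the Green
  function at \<open>k\<close>. Since \<open>g\<close> and \<zeta> are nonnegative with disjoint
  supports, \<open>dual g \<phi> \<le> \<phi> k\<close>: exterior heights only push the field up, so
  the bound does not depend on \<zeta>.\<close>

lemma mass_tail_le:
  assumes k: "k \<in> b" and C: "C > 0" and t: "0 \<le> t"
    and cap: "\<And>f. (\<And>i. i \<notin> b \<Longrightarrow> f i = 0) \<Longrightarrow> (f k)\<^sup>2 \<le> C * energy L f"
  shows "mass {\<phi>. \<phi> k < - t} \<le> exp (- (t\<^sup>2 / C)) * mass UNIV"
proof -
  obtain g where g: "\<And>i. i \<notin> b \<Longrightarrow> g i = 0" "\<And>i. 0 \<le> g i" "4 * energy L g \<le> C"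
    "\<And>\<phi>. (\<And>i. i \<notin> b \<Longrightarrow> \<phi> i = 0) \<Longrightarrow> dirichlet L \<phi> g = \<phi> k"
    using green_function[OF finite_b b k cap] by blast
  \<comment> \<open>The minimiser of \<open>- (r * t) + r\<^sup>2 * (C / 4)\<close>.\<close>
  define r where "r = 2 * t / C"
  have r: "0 \<le> r" using t C by (simp add: r_def)
  have "{\<phi> \<in> space fields. \<phi> k < - t} \<in> sets (fields :: (int ^ 'd \<Rightarrow> real) measure)" by measurable
  then have lt[measurable]: "{\<phi> :: int ^ 'd \<Rightarrow> real. \<phi> k < - t} \<in> sets fields" by (simp add: space_PiM)
  have dual_le: "dual g \<phi> \<le> \<phi> k" if "\<And>i. i \<notin> b \<Longrightarrow> \<phi> i = 0" for \<phi>
  proof -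
    have "\<zeta> i * g i = 0" for i using g(1) \<zeta>_block by (cases "i \<in> b") auto
    then have "dirichlet L \<zeta> g \<le> 0" using g(2) \<zeta>_nonneg by (intro dirichlet_disjoint_le) auto
    then show ?thesis using dirichlet_add_left[of L \<phi> \<zeta> g] g(4)[of \<phi>, OF that] by (simp add: dual_def)
  qed
  have "mass {\<phi>. \<phi> k < - t} \<le> (\<integral>\<phi>. exp (- (r * t)) * (exp (- r * dual g \<phi>) * w \<phi>) \<partial>M)"
    unfolding mass_def
  proof (intro integral_mono_AE integrable_indicator_w lt integrable_mult_right mgf_dual g(1))
    show "AE \<phi> in M. indicator {\<phi>. \<phi> k < - t} \<phi> * w \<phi> \<le> exp (- (r * t)) * (exp (- r * dual g \<phi>) * w \<phi>)"
    proof (rule AE_field_measure[OF site_family_lborel])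
      fix \<phi> :: "int ^ 'd \<Rightarrow> real"
      assume \<phi>: "\<And>i. i \<notin> b \<Longrightarrow> \<phi> i = 0"
      show "indicator {\<phi>. \<phi> k < - t} \<phi> * w \<phi> \<le> exp (- (r * t)) * (exp (- r * dual g \<phi>) * w \<phi>)"
      proof (cases "\<phi> k < - t")
        case True
        have "r * (dual g \<phi> + t) \<le> 0" using True dual_le[of \<phi>, OF \<phi>] r by (intro mult_nonneg_nonpos) auto
        then have "1 \<le> exp (- (r * t) - r * dual g \<phi>)" by (simp add: algebra_simps)
        then have "1 * w \<phi> \<le> exp (- (r * t) - r * dual g \<phi>) * w \<phi>" using w_nonneg by (intro mult_right_mono) auto
        then show ?thesis using True by (simp add: exp_diff exp_minus field_simps)
      qed (simp add: w_nonneg)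
    next
      have "{\<phi> \<in> space fields. indicator {\<phi>. \<phi> k < - t} \<phi> * w \<phi> \<le> exp (- (r * t)) * (exp (- r * dual g \<phi>) * w \<phi>)} \<in> sets fields"
        by measurable
      then show "{\<phi>. indicator {\<phi>. \<phi> k < - t} \<phi> * w \<phi> \<le> exp (- (r * t)) * (exp (- r * dual g \<phi>) * w \<phi>)} \<in> sets fields"
        by (simp add: space_PiM)
    qed
  qed auto
  also have "\<dots> = exp (- (r * t)) * (exp (r\<^sup>2 * energy L g) * mass UNIV)"
    using mgf_dual(2)[of g r, OF g(1)] by (simp add: mass_UNIV)
  also have "\<dots> \<le> exp (- (r * t)) * (exp (r\<^sup>2 * (C / 4)) * mass UNIV)"
  proof -
    have "r\<^sup>2 * energy L g \<le> r\<^sup>2 * (C / 4)" using g(3) by (intro mult_left_mono) auto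
    then show ?thesis using mass_nonneg by (intro mult_left_mono mult_right_mono) auto
  qed
  also have "\<dots> = exp (- (t\<^sup>2 / C)) * mass UNIV"
  proof -
    have "- (r * t) + r\<^sup>2 * (C / 4) = - (t\<^sup>2 / C)"
      using C by (simp add: r_def power2_eq_square field_simps)
    then show ?thesis by (simp add: mult.assoc[symmetric] exp_add[symmetric])
  qed
  finally show ?thesis .
qed

end

context block
begin

lemma measurable_less [measurable]: "{\<phi> :: int ^ 'd \<Rightarrow> real. \<phi> x < r} \<in> sets fields"
proof -
  have "{\<phi> \<in> space fields. \<phi> x < r} \<in> sets (fields :: (int ^ 'd \<Rightarrow> real) measure)" by measurable
  then show ?thesis by (simp add: space_PiM)
qed

text \<open>If the repelled field is often below \<open>s\<close> at \<open>x\<close>, the flux must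
  be large. By association the field without wall is below \<open>s\<close> at least as often;
  tilting along \<open>f\<close> takes it below 0; up to Gaussian tails below \<open>- t\<close>,
  these fields belong to the mass gained in passing from \<open>above 0\<close> to
  \<open>above t\<close>, which the flux controls. The terms with \<open>\<kappa> / 4\<close> and
  \<open>card b\<close> are the losses in the tilting and in the tails.\<close>

lemma block_inequality:
  assumes x: "x \<in> b" and f: "\<And>i. i \<notin> b \<Longrightarrow> f i = 0" "f x = 1" and s: "0 \<le> s" and t: "0 \<le> t" and C: "C > 0"
    and cap: "\<And>k g. k \<in> b \<Longrightarrow> (\<And>i. i \<notin> b \<Longrightarrow> g i = 0) \<Longrightarrow> (g k)\<^sup>2 \<le> C * energy L g"
  defines "\<kappa> \<equiv> exp (- s\<^sup>2 * energy L f - 4 * s * sqrt (energy L f))"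
  shows "\<kappa> * mass ({\<phi>. \<phi> x < s} \<inter> above 0) \<le> t * flux_integral 0 + (\<kappa> / 4 + real (card b) * exp (- (t\<^sup>2 / C))) * mass (above 0)"
proof -
  define W where "W = mass UNIV"
  define W0 where "W0 = mass (above 0)"
  define Q where "Q = mass ({\<phi>. \<phi> x < s} \<inter> above 0)"
  define \<tau> where "\<tau> = real (card b) * exp (- (t\<^sup>2 / C))"
  have W: "0 < W" "0 < W0" by (simp_all add: W_def W0_def mass_UNIV_pos mass_above_pos)
  have e: "0 < energy L f"
  proof (rule energy_pos[of L f x])
    show "f i = 0" if "i \<notin> \<Lambda> L" for i using f(1)[of i] b that by blast
  qed (use f(2) in simp)
  have le: "{\<phi> :: int ^ 'd \<Rightarrow> real. s \<le> \<phi> x} = - {\<phi>. \<phi> x < s}" by auto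
  have ge[measurable]: "{\<phi> :: int ^ 'd \<Rightarrow> real. s \<le> \<phi> x} \<in> sets fields"
    using sets.compl_sets[OF measurable_less[of x s]] by (simp add: le space_PiM Compl_eq_Diff_UNIV)
  have low: "mass {\<phi>. \<phi> x < 0} \<le> W - W0"
    unfolding W_def W0_def mass_compl[OF measurable_above, symmetric]
    using x sets.compl_sets[OF measurable_above[of 0]]
    by (intro mass_mono) (auto simp: above_def space_PiM Compl_eq_Diff_UNIV not_le)
  have tail: "W - mass (above t) \<le> \<tau> * W"
  proof -
    have "mass (- above t) \<le> (\<integral>\<phi>. (\<Sum>k\<in>b. indicator {\<phi>. \<phi> k < - t} \<phi> * w \<phi>) \<partial>M)"
      unfolding mass_def
    proof (rule integral_mono)
      show "integrable M (\<lambda>\<phi>. indicator (- above t) \<phi> * w \<phi>)"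
        using sets.compl_sets[OF measurable_above[of t]]
        by (intro integrable_indicator_w) (auto simp: space_PiM Compl_eq_Diff_UNIV)
      show "integrable M (\<lambda>\<phi>. \<Sum>k\<in>b. indicator {\<phi>. \<phi> k < - t} \<phi> * w \<phi>)"
        by (intro Bochner_Integration.integrable_sum integrable_indicator_w) auto
      fix \<phi> :: "int ^ 'd \<Rightarrow> real"
      show "indicator (- above t) \<phi> * w \<phi> \<le> (\<Sum>k\<in>b. indicator {\<phi>. \<phi> k < - t} \<phi> * w \<phi>)"
      proof (cases "\<phi> \<in> above t")
        case False
        then obtain k where k: "k \<in> b" "\<phi> k < - t" by (auto simp: above_def not_le)
        then have "indicator {\<phi>. \<phi> k < - t} \<phi> * w \<phi> \<le> (\<Sum>k\<in>b. indicator {\<phi>. \<phi> k < - t} \<phi> * w \<phi>)"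
          using w_nonneg by (intro member_le_sum) auto
        then show ?thesis using k False by simp
      qed (auto intro!: sum_nonneg simp: w_nonneg)
    qed
    also have "\<dots> = (\<Sum>k\<in>b. mass {\<phi>. \<phi> k < - t})"
      unfolding mass_def by (intro Bochner_Integration.integral_sum integrable_indicator_w) auto
    also have "\<dots> \<le> (\<Sum>k\<in>b. exp (- (t\<^sup>2 / C)) * W)"
      unfolding W_def using C t cap by (intro sum_mono mass_tail_le) auto
    finally show ?thesis by (simp add: mass_compl \<tau>_def W_def)
  qed
  have "mass {\<phi>. s \<le> \<phi> x} * W0 \<le> W * mass ({\<phi>. s \<le> \<phi> x} \<inter> above 0)"
  proof -
    have ind: "indicator {\<phi>. s \<le> \<phi> x} \<phi> * (indicator E \<phi> * w \<phi>) = indicator ({\<phi>. s \<le> \<phi> x} \<inter> E) \<phi> * w \<phi>" for E \<phi>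
      by (simp add: indicator_inter_arith)
    have "(\<integral>\<phi>. indicator {\<phi>. s \<le> \<phi> x} \<phi> * (indicator UNIV \<phi> * w \<phi>) \<partial>M) * mass (above 0) \<le>
      mass UNIV * (\<integral>\<phi>. indicator {\<phi>. s \<le> \<phi> x} \<phi> * (indicator (above 0) \<phi> * w \<phi>) \<partial>M)"
    proof (rule fkg)
      fix \<phi> \<psi> :: "int ^ 'd \<Rightarrow> real"
      show "indicator {\<phi>. s \<le> \<phi> x} \<phi> \<le> (indicator {\<phi>. s \<le> \<phi> x} (\<lambda>i. max (\<phi> i) (\<psi> i)) :: real)"
        by (auto simp: indicator_def)
      assume "\<psi> \<in> above 0"
      then show "(\<lambda>i. min (\<phi> i) (\<psi> i)) \<in> UNIV \<and> (\<lambda>i. max (\<phi> i) (\<psi> i)) \<in> above 0"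
        by (auto simp: above_def le_max_iff_disj)
    qed (unfold ind, auto intro!: integrable_indicator_w)
    then show ?thesis unfolding ind by (simp add: mass_def W_def W0_def)
  qed
  moreover have "mass {\<phi>. s \<le> \<phi> x} = W - mass {\<phi>. \<phi> x < s}"
    unfolding le W_def by (rule mass_compl) measurable
  moreover have "mass ({\<phi>. s \<le> \<phi> x} \<inter> above 0) = W0 - Q"
  proof -
    have "Q + mass ({\<phi>. s \<le> \<phi> x} \<inter> above 0) = (\<integral>\<phi>. indicator ({\<phi>. \<phi> x < s} \<inter> above 0) \<phi> * w \<phi> + indicator ({\<phi>. s \<le> \<phi> x} \<inter> above 0) \<phi> * w \<phi> \<partial>M)"
      unfolding Q_def mass_def by (intro Bochner_Integration.integral_add[symmetric] integrable_indicator_w) auto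
    also have "\<dots> = W0"
      unfolding W0_def mass_def by (intro Bochner_Integration.integral_cong) (auto simp: indicator_def)
    finally show ?thesis by simp
  qed
  ultimately have fkg: "W * Q \<le> W0 * mass {\<phi>. \<phi> x < s}" by (simp add: algebra_simps)
  have "\<kappa> * (mass {\<phi>. \<phi> x < s} - W / 4) \<le> mass {\<phi>. \<phi> x < 0}"
    unfolding \<kappa>_def W_def using f e s by (intro mass_below_ge) auto
  then have "\<kappa> * (mass {\<phi>. \<phi> x < s} - W / 4) - \<tau> * W \<le> mass (above t) - W0"
    using low tail by simp
  then have "W0 * (\<kappa> * (mass {\<phi>. \<phi> x < s} - W / 4) - \<tau> * W) \<le> W0 * (mass (above t) - W0)"
    using W by (intro mult_left_mono) auto
  also have "\<dots> \<le> t * flux_integral 0 * W"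
    unfolding W0_def W_def by (rule flux_integral_ge[OF t])
  finally have 1: "\<kappa> * (W0 * mass {\<phi>. \<phi> x < s}) - W0 * (\<kappa> / 4 * W) - W0 * (\<tau> * W) \<le> t * flux_integral 0 * W"
    by (simp add: algebra_simps)
  have "\<kappa> * (W * Q) \<le> \<kappa> * (W0 * mass {\<phi>. \<phi> x < s})"
    using fkg by (intro mult_left_mono) (auto simp: \<kappa>_def)
  with 1 have "W * (\<kappa> * Q) \<le> W * (t * flux_integral 0 + (\<kappa> / 4 + \<tau>) * W0)"
    by (simp add: algebra_simps)
  then show ?thesis using W by (simp add: Q_def W0_def \<tau>_def)
qed

end

section \<open>Integrating the block inequality over the exterior\<close>

lemma block_zero_exterior: "D \<subseteq> \<Lambda> L \<Longrightarrow> block L D (\<lambda>_. 0)"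
  by (simp add: block_def)

lemma (in block) integrable_dirichlet_masked:
  "integrable M (\<lambda>\<phi>. dirichlet L (\<lambda>i. (\<phi> i + \<zeta> i) * g i) f * (indicator (above a) \<phi> * w \<phi>))"
proof -
  have "integrable M (\<lambda>\<phi>. 1 / (4 * real CARD('d)) * (\<Sum>p\<in>bonds L. (f (fst p) - f (snd p)) *
      (g (fst p) * ((\<phi> (fst p) + \<zeta> (fst p)) * w \<phi>) - g (snd p) * ((\<phi> (snd p) + \<zeta> (snd p)) * w \<phi>))))"
    by (intro integrable_mult_right Bochner_Integration.integrable_sum Bochner_Integration.integrable_diff integrable_coordinate)
  moreover have "dirichlet L (\<lambda>i. (\<phi> i + \<zeta> i) * g i) f * w \<phi> = 1 / (4 * real CARD('d)) * (\<Sum>p\<in>bonds L. (f (fst p) - f (snd p)) *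
      (g (fst p) * ((\<phi> (fst p) + \<zeta> (fst p)) * w \<phi>) - g (snd p) * ((\<phi> (snd p) + \<zeta> (snd p)) * w \<phi>)))" for \<phi>
    unfolding dirichlet_def mult.assoc sum_distrib_right
    by (intro arg_cong[where f = "(*) _"] sum.cong) (auto simp: algebra_simps)
  ultimately have "integrable M (\<lambda>\<phi>. dirichlet L (\<lambda>i. (\<phi> i + \<zeta> i) * g i) f * w \<phi>)" by simp
  from integrable_real_mult_indicator[OF _ this, of "above a"] show ?thesis
    by (simp add: ac_simps)
qed

lemma dirichlet_indicator_nonneg:
  fixes \<phi> :: "int ^ 'd \<Rightarrow> real"
  assumes "\<And>i. 0 \<le> \<phi> i"
  shows "0 \<le> dirichlet L (\<lambda>i. \<phi> i * indicator b i) (indicator b)"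
  using dirichlet_indicator_mono[of b "\<lambda>_. 0" \<phi> L] assms by (simp add: dirichlet_def)

text \<open>Fubini over the heights outside \<open>b\<close>. The flux has no sign, so it is split
  into the part \<open>P\<close> carried by heights in \<open>b\<close> and the part
  \<open>- N\<close> carried by exterior heights. Both \<open>P\<close> and \<open>N\<close> are
  nonnegative for positive fields; with \<open>N\<close> moved to the left, extended nonnegative
  integrals can be compared fibre by fibre.\<close>

lemma global_block_inequality:
  fixes D b :: "(int ^ 'd) set"
  assumes D: "D \<subseteq> \<Lambda> L" and bD: "b \<subseteq> D" and x: "x \<in> b"
    and f: "\<And>i. i \<notin> b \<Longrightarrow> f i = 0" "f x = 1" and s: "0 \<le> s" and t: "0 \<le> t" and C: "C > 0"
    and cap: "\<And>k g. k \<in> b \<Longrightarrow> (\<And>i. i \<notin> b \<Longrightarrow> g i = 0) \<Longrightarrow> (g k)\<^sup>2 \<le> C * energy L g"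
  defines "\<kappa> \<equiv> exp (- s\<^sup>2 * energy L f - 4 * s * sqrt (energy L f))"
  defines "v \<equiv> \<lambda>\<phi>. indicator (block.above D 0) \<phi> * block.w L (\<lambda>_. 0) \<phi>"
  shows "\<kappa> * (\<integral>\<phi>. indicator {\<phi>. \<phi> x < s} \<phi> * v \<phi> \<partial>field_measure (\<lambda>_. lborel) D) \<le>
    t * (\<integral>\<phi>. dirichlet L \<phi> (indicator b) * v \<phi> \<partial>field_measure (\<lambda>_. lborel) D)
    + (\<kappa> / 4 + real (card b) * exp (- (t\<^sup>2 / C))) * (\<integral>\<phi>. v \<phi> \<partial>field_measure (\<lambda>_. lborel) D)"
proof -
  interpret big: block L D "\<lambda>_. 0" by (rule block_zero_exterior[OF D])
  let ?\<iota> = "indicator b :: int ^ 'd \<Rightarrow> real"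
  define c where "c = \<kappa> / 4 + real (card b) * exp (- (t\<^sup>2 / C))"
  have c: "0 \<le> c" by (simp add: c_def \<kappa>_def)
  have \<kappa>: "0 \<le> \<kappa>" by (simp add: \<kappa>_def)
  define P where "P \<phi> = dirichlet L (\<lambda>i. \<phi> i * ?\<iota> i) ?\<iota>" for \<phi>
  define N where "N \<phi> = - dirichlet L (\<lambda>i. \<phi> i * (1 - ?\<iota> i)) ?\<iota>" for \<phi>
  define R1 where "R1 \<phi> = (\<kappa> * indicator {\<phi>. \<phi> x < s} \<phi> + t * N \<phi>) * v \<phi>" for \<phi>
  define R2 where "R2 \<phi> = (t * P \<phi> + c) * v \<phi>" for \<phi>
  have [measurable]: "v \<in> borel_measurable fields" "P \<in> borel_measurable fields" "N \<in> borel_measurable fields"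
    unfolding v_def P_def[abs_def] N_def[abs_def] dirichlet_def by measurable
  have R[measurable]: "R1 \<in> borel_measurable fields" "R2 \<in> borel_measurable fields"
    unfolding R1_def[abs_def] R2_def[abs_def] using big.measurable_less[of x s] by measurable
  have P_nonneg: "0 \<le> P \<phi>" and N_nonneg: "0 \<le> N \<phi>" if "\<And>i. 0 \<le> \<phi> i" for \<phi>
  proof -
    show "0 \<le> P \<phi>" unfolding P_def by (rule dirichlet_indicator_nonneg) (rule that)
    have "dirichlet L (\<lambda>i. \<phi> i * (1 - ?\<iota> i)) ?\<iota> \<le> 0"
      by (rule dirichlet_disjoint_le) (auto simp: that indicator_def)
    then show "0 \<le> N \<phi>" by (simp add: N_def)
  qed
  have split: "dirichlet L \<phi> ?\<iota> = P \<phi> - N \<phi>" for \<phi>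
  proof -
    have "\<phi> = (\<lambda>i. \<phi> i * ?\<iota> i + \<phi> i * (1 - ?\<iota> i))" by (simp add: algebra_simps)
    then have "dirichlet L \<phi> ?\<iota> = dirichlet L (\<lambda>i. \<phi> i * ?\<iota> i + \<phi> i * (1 - ?\<iota> i)) ?\<iota>" by simp
    then show ?thesis by (simp add: dirichlet_add_left P_def N_def)
  qed
  have v_nonneg: "0 \<le> v \<phi>" for \<phi> by (simp add: v_def big.w_nonneg)
  have R_nonneg: "0 \<le> R1 \<phi>" "0 \<le> R2 \<phi>" if "\<And>i. i \<notin> D \<Longrightarrow> \<phi> i = 0" for \<phi>
  proof -
    have "0 \<le> R1 \<phi> \<and> 0 \<le> R2 \<phi>"
    proof (cases "\<phi> \<in> big.above 0")
      case True
      then have "0 \<le> \<phi> i" for i using that[of i] by (cases "i \<in> D") (auto simp: big.above_def)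
      then show ?thesis
        unfolding R1_def R2_def using P_nonneg[of \<phi>] N_nonneg[of \<phi>] \<kappa> t c v_nonneg
        by (intro conjI mult_nonneg_nonneg add_nonneg_nonneg) auto
    qed (simp add: R1_def R2_def v_def)
    then show "0 \<le> R1 \<phi>" "0 \<le> R2 \<phi>" by auto
  qed
  have inner: "(\<integral>\<^sup>+\<phi>. ennreal (R1 (\<lambda>i. \<phi> i + \<zeta> i)) \<partial>field_measure (\<lambda>_. lborel) b) \<le>
    (\<integral>\<^sup>+\<phi>. ennreal (R2 (\<lambda>i. \<phi> i + \<zeta> i)) \<partial>field_measure (\<lambda>_. lborel) b)"
    if \<zeta>: "\<And>i. i \<notin> D - b \<Longrightarrow> \<zeta> i = 0" for \<zeta>
  proof (cases "\<forall>i. 0 \<le> \<zeta> i")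
    case False
    \<comment> \<open>A negative exterior height violates the wall, so the fibre contributes nothing
      to the left side; this also ensures that \<open>block\<close> is only invoked for nonnegative
      \<zeta>.\<close>
    then obtain i where i: "\<zeta> i < 0" by (auto simp: not_le)
    then have iD: "i \<in> D" "i \<notin> b" using \<zeta>[of i] by auto
    have "(\<integral>\<^sup>+\<phi>. ennreal (R1 (\<lambda>i. \<phi> i + \<zeta> i)) \<partial>field_measure (\<lambda>_. lborel) b) =
      (\<integral>\<^sup>+\<phi>. 0 \<partial>field_measure (\<lambda>_. lborel) b)"
    proof (rule nn_integral_field_measure_cong[OF site_family_lborel])
      show "(\<lambda>\<phi>. ennreal (R1 (\<lambda>i. \<phi> i + \<zeta> i))) \<in> borel_measurable fields"
        using measurable_compose[OF measurable_fields_shift R(1)] by measurable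
      fix \<phi> :: "int ^ 'd \<Rightarrow> real" assume "\<And>i. i \<notin> b \<Longrightarrow> \<phi> i = 0"
      then have "\<phi> i + \<zeta> i < 0" using i iD(2) by simp
      then have "(\<lambda>i. \<phi> i + \<zeta> i) \<notin> big.above 0" using iD(1) by (auto simp: big.above_def not_le)
      then show "ennreal (R1 (\<lambda>i. \<phi> i + \<zeta> i)) = 0" by (simp add: R1_def v_def)
    qed simp
    then show ?thesis by simp
  next
    case True
    interpret blk: block L b \<zeta>
    proof
      show "b \<subseteq> \<Lambda> L" using bD D by blast
      show "\<zeta> i = 0" if "i \<notin> \<Lambda> L" for i using \<zeta>[of i] that D by blast
      show "0 \<le> \<zeta> i" for i using True by simp
      show "\<zeta> i = 0" if "i \<in> b" for i using \<zeta>[of i] that by simp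
    qed
    define N0 where "N0 = - dirichlet L \<zeta> ?\<iota>"
    let ?J = "\<lambda>\<phi>. indicator (blk.above 0) \<phi> * blk.w \<phi>"
    have pointwise: "R1 (\<lambda>i. \<phi> i + \<zeta> i) = \<kappa> * (indicator ({\<phi>. \<phi> x < s} \<inter> blk.above 0) \<phi> * blk.w \<phi>) + t * N0 * ?J \<phi>"
      "R2 (\<lambda>i. \<phi> i + \<zeta> i) = t * (blk.flux \<phi> * ?J \<phi>) + (t * N0 + c) * ?J \<phi>"
      if \<phi>: "\<And>i. i \<notin> b \<Longrightarrow> \<phi> i = 0" for \<phi>
    proof -
      have 1: "(\<lambda>i. (\<phi> i + \<zeta> i) * ?\<iota> i) = \<phi>" "(\<lambda>i. (\<phi> i + \<zeta> i) * (1 - ?\<iota> i)) = \<zeta>"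
        using \<phi> blk.\<zeta>_block by (auto simp: fun_eq_iff indicator_def)
      have "(\<lambda>i. \<phi> i + \<zeta> i) \<in> big.above 0 \<longleftrightarrow> \<phi> \<in> blk.above 0"
      proof
        assume "(\<lambda>i. \<phi> i + \<zeta> i) \<in> big.above 0"
        then show "\<phi> \<in> blk.above 0" using bD blk.\<zeta>_block by (force simp: big.above_def blk.above_def)
      next
        assume "\<phi> \<in> blk.above 0"
        then have "0 \<le> \<phi> i" for i using \<phi>[of i] by (cases "i \<in> b") (auto simp: blk.above_def)
        then show "(\<lambda>i. \<phi> i + \<zeta> i) \<in> big.above 0" using True by (simp add: big.above_def)
      qed
      then have 2: "v (\<lambda>i. \<phi> i + \<zeta> i) = ?J \<phi>"
        by (simp add: v_def indicator_def blk.w_def big.w_def)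
      have 3: "dirichlet L \<phi> ?\<iota> = blk.flux \<phi> + N0"
        using dirichlet_add_left[of L \<phi> \<zeta> ?\<iota>] by (simp add: blk.dual_def N0_def)
      show "R1 (\<lambda>i. \<phi> i + \<zeta> i) = \<kappa> * (indicator ({\<phi>. \<phi> x < s} \<inter> blk.above 0) \<phi> * blk.w \<phi>) + t * N0 * ?J \<phi>"
      proof -
        have "N (\<lambda>i. \<phi> i + \<zeta> i) = N0" by (simp only: N_def N0_def 1)
        moreover have "indicator {\<phi>. \<phi> x < s} (\<lambda>i. \<phi> i + \<zeta> i) = (indicator {\<phi>. \<phi> x < s} \<phi> :: real)"
          using blk.\<zeta>_block[OF x] by (simp add: indicator_def)
        ultimately show ?thesis by (simp add: R1_def 2 indicator_inter_arith algebra_simps)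
      qed
      show "R2 (\<lambda>i. \<phi> i + \<zeta> i) = t * (blk.flux \<phi> * ?J \<phi>) + (t * N0 + c) * ?J \<phi>"
      proof -
        have "P (\<lambda>i. \<phi> i + \<zeta> i) = blk.flux \<phi> + N0" by (simp only: P_def 1 3)
        then show ?thesis by (simp add: R2_def 2 algebra_simps)
      qed
    qed
    have shiftm: "(\<lambda>\<phi>. R1 (\<lambda>i. \<phi> i + \<zeta> i)) \<in> borel_measurable fields" "(\<lambda>\<phi>. R2 (\<lambda>i. \<phi> i + \<zeta> i)) \<in> borel_measurable fields"
      by (rule measurable_compose[OF measurable_fields_shift R(1)], rule measurable_compose[OF measurable_fields_shift R(2)])
    have supp: "R1 (\<lambda>i. \<phi> i + \<zeta> i) \<ge> 0" "R2 (\<lambda>i. \<phi> i + \<zeta> i) \<ge> 0" if "\<And>i. i \<notin> b \<Longrightarrow> \<phi> i = 0" for \<phi>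
    proof -
      have "\<phi> i + \<zeta> i = 0" if "i \<notin> D" for i
        using \<zeta>[of i] \<open>\<And>i. i \<notin> b \<Longrightarrow> \<phi> i = 0\<close>[of i] that bD by auto
      then show "R1 (\<lambda>i. \<phi> i + \<zeta> i) \<ge> 0" "R2 (\<lambda>i. \<phi> i + \<zeta> i) \<ge> 0"
        using R_nonneg[of "\<lambda>i. \<phi> i + \<zeta> i"] by auto
    qed
    have eval: "(\<integral>\<^sup>+\<phi>. ennreal (R (\<lambda>i. \<phi> i + \<zeta> i)) \<partial>blk.M) = ennreal (\<integral>\<phi>. R' \<phi> \<partial>blk.M)"
      if m: "(\<lambda>\<phi>. R (\<lambda>i. \<phi> i + \<zeta> i)) \<in> borel_measurable fields" and int: "integrable blk.M R'"
        and eq: "\<And>\<phi>. (\<And>i. i \<notin> b \<Longrightarrow> \<phi> i = 0) \<Longrightarrow> R (\<lambda>i. \<phi> i + \<zeta> i) = R' \<phi> \<and> 0 \<le> R (\<lambda>i. \<phi> i + \<zeta> i)"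
      for R R' :: "(int ^ 'd \<Rightarrow> real) \<Rightarrow> real"
    proof -
      have m': "R' \<in> borel_measurable fields"
        using borel_measurable_integrable[OF int] by (simp add: measurable_cong_sets[OF sets_field_measure refl])
      have "(\<integral>\<^sup>+\<phi>. ennreal (R (\<lambda>i. \<phi> i + \<zeta> i)) \<partial>blk.M) = (\<integral>\<^sup>+\<phi>. ennreal (R' \<phi>) \<partial>blk.M)"
        by (rule nn_integral_field_measure_cong[OF site_family_lborel]) (use m m' eq in auto)
      also have "\<dots> = ennreal (\<integral>\<phi>. R' \<phi> \<partial>blk.M)"
      proof (rule nn_integral_eq_integral[OF int])
        have "{\<phi> \<in> space fields. 0 \<le> R' \<phi>} \<in> sets fields" using m' by measurable
        then have m0: "{\<phi>. 0 \<le> R' \<phi>} \<in> sets fields" by (simp add: space_PiM)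
        show "AE \<phi> in blk.M. 0 \<le> R' \<phi>"
        proof (rule AE_field_measure[OF site_family_lborel _ m0])
          fix \<phi> :: "int ^ 'd \<Rightarrow> real" assume "\<And>i. i \<notin> b \<Longrightarrow> \<phi> i = 0"
          from eq[of \<phi>, OF this] show "0 \<le> R' \<phi>" by simp
        qed
      qed
      finally show ?thesis .
    qed
    have iJ: "integrable blk.M ?J" by (intro blk.integrable_indicator_w) measurable
    have iQ: "integrable blk.M (\<lambda>\<phi>. indicator ({\<phi>. \<phi> x < s} \<inter> blk.above 0) \<phi> * blk.w \<phi>)"
      by (intro blk.integrable_indicator_w) measurable
    have iF: "integrable blk.M (\<lambda>\<phi>. blk.flux \<phi> * ?J \<phi>)"
      by (intro blk.integrable_dual_indicator) measurable
    have "(\<integral>\<^sup>+\<phi>. ennreal (R1 (\<lambda>i. \<phi> i + \<zeta> i)) \<partial>blk.M) =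
        ennreal (\<integral>\<phi>. \<kappa> * (indicator ({\<phi>. \<phi> x < s} \<inter> blk.above 0) \<phi> * blk.w \<phi>) + t * N0 * ?J \<phi> \<partial>blk.M)"
      using pointwise(1) supp(1)
      by (intro eval shiftm Bochner_Integration.integrable_add integrable_mult_right iQ iJ) auto
    also have "(\<integral>\<phi>. \<kappa> * (indicator ({\<phi>. \<phi> x < s} \<inter> blk.above 0) \<phi> * blk.w \<phi>) + t * N0 * ?J \<phi> \<partial>blk.M) =
        \<kappa> * blk.mass ({\<phi>. \<phi> x < s} \<inter> blk.above 0) + t * N0 * blk.mass (blk.above 0)"
      unfolding blk.mass_def
      by (subst Bochner_Integration.integral_add) (auto intro: iQ iJ simp: mult.assoc)
    also have "ennreal \<dots> \<le> ennreal (t * blk.flux_integral 0 + (t * N0 + c) * blk.mass (blk.above 0))"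
      using blk.block_inequality[of x f s t C] x f s t C cap
      by (intro ennreal_leI) (auto simp: \<kappa>_def c_def algebra_simps)
    also have "t * blk.flux_integral 0 + (t * N0 + c) * blk.mass (blk.above 0) =
        (\<integral>\<phi>. t * (blk.flux \<phi> * ?J \<phi>) + (t * N0 + c) * ?J \<phi> \<partial>blk.M)"
      unfolding blk.mass_def blk.flux_integral_def
      by (subst Bochner_Integration.integral_add) (auto intro: iF iJ simp: mult.assoc)
    also have "ennreal \<dots> = (\<integral>\<^sup>+\<phi>. ennreal (R2 (\<lambda>i. \<phi> i + \<zeta> i)) \<partial>blk.M)"
      using pointwise(2) supp(2)
      by (intro eval[symmetric] shiftm Bochner_Integration.integrable_add integrable_mult_right iF iJ) auto
    finally show ?thesis .
  qed
  have finb: "finite b" "finite (D - b)" using finite_subset[OF bD big.finite_b] big.finite_b by simp_all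
  have D_eq: "D = b \<union> (D - b)" using bD by auto
  have union: "(\<integral>\<^sup>+\<phi>. ennreal (R \<phi>) \<partial>big.M) = (\<integral>\<^sup>+\<zeta>. (\<integral>\<^sup>+\<phi>. ennreal (R (\<lambda>i. \<phi> i + \<zeta> i))
      \<partial>field_measure (\<lambda>_. lborel) b) \<partial>field_measure (\<lambda>_. lborel) (D - b))"
    if "R \<in> borel_measurable fields" for R
    using nn_integral_field_measure_union[OF site_family_lborel finb, of "\<lambda>\<phi>. ennreal (R \<phi>)"] that D_eq by auto
  have "(\<integral>\<^sup>+\<phi>. ennreal (R1 \<phi>) \<partial>big.M) \<le> (\<integral>\<^sup>+\<phi>. ennreal (R2 \<phi>) \<partial>big.M)"
    unfolding union[OF R(1)] union[OF R(2)]
  proof (rule nn_integral_field_measure_mono[OF site_family_lborel])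
    have m: "(\<lambda>\<zeta>. \<integral>\<^sup>+\<phi>. ennreal (R (\<lambda>i. \<phi> i + \<zeta> i)) \<partial>field_measure (\<lambda>_. lborel) b) \<in> borel_measurable fields"
      if [measurable]: "R \<in> borel_measurable fields" for R
    proof (rule measurable_nn_integral_field_measure[OF site_family_lborel finb(1)])
      have "(\<lambda>p. (\<lambda>i. snd p i + fst p i)) \<in> measurable (fields \<Otimes>\<^sub>M fields) (fields :: (int ^ 'd \<Rightarrow> real) measure)"
        by (rule measurable_fields_plus) auto
      from measurable_compose[OF this that]
      show "(\<lambda>(\<zeta>, \<phi>). ennreal (R (\<lambda>i. \<phi> i + \<zeta> i))) \<in> borel_measurable (fields \<Otimes>\<^sub>M fields)"
        by (simp add: split_beta')
    qed
    show "(\<lambda>\<zeta>. \<integral>\<^sup>+\<phi>. ennreal (R1 (\<lambda>i. \<phi> i + \<zeta> i)) \<partial>field_measure (\<lambda>_. lborel) b) \<in> borel_measurable fields"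
      "(\<lambda>\<zeta>. \<integral>\<^sup>+\<phi>. ennreal (R2 (\<lambda>i. \<phi> i + \<zeta> i)) \<partial>field_measure (\<lambda>_. lborel) b) \<in> borel_measurable fields"
      by (rule m[OF R(1)], rule m[OF R(2)])
  qed (rule inner)
  moreover have int: "integrable big.M (\<lambda>\<phi>. \<kappa> * (indicator {\<phi>. \<phi> x < s} \<phi> * v \<phi>) + t * (N \<phi> * v \<phi>))"
    "integrable big.M (\<lambda>\<phi>. t * (P \<phi> * v \<phi>) + c * v \<phi>)"
    and parts: "integrable big.M (\<lambda>\<phi>. indicator {\<phi>. \<phi> x < s} \<phi> * v \<phi>)" "integrable big.M (\<lambda>\<phi>. N \<phi> * v \<phi>)"
      "integrable big.M (\<lambda>\<phi>. P \<phi> * v \<phi>)" "integrable big.M v"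
  proof -
    have "indicator {\<phi>. \<phi> x < s} \<phi> * v \<phi> = indicator ({\<phi>. \<phi> x < s} \<inter> big.above 0) \<phi> * big.w \<phi>" for \<phi>
      by (simp add: v_def indicator_inter_arith)
    then show 1: "integrable big.M (\<lambda>\<phi>. indicator {\<phi>. \<phi> x < s} \<phi> * v \<phi>)"
      using big.integrable_indicator_w[of "{\<phi>. \<phi> x < s} \<inter> big.above 0"] by simp
    show 2: "integrable big.M (\<lambda>\<phi>. P \<phi> * v \<phi>)"
      using big.integrable_dirichlet_masked[of ?\<iota> ?\<iota> 0] by (simp add: P_def v_def)
    show 3: "integrable big.M (\<lambda>\<phi>. N \<phi> * v \<phi>)"
      using big.integrable_dirichlet_masked[of "\<lambda>i. 1 - ?\<iota> i" ?\<iota> 0] by (simp add: N_def v_def)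
    show 4: "integrable big.M v"
      unfolding v_def by (rule big.integrable_indicator_w) measurable
    show "integrable big.M (\<lambda>\<phi>. \<kappa> * (indicator {\<phi>. \<phi> x < s} \<phi> * v \<phi>) + t * (N \<phi> * v \<phi>))"
      "integrable big.M (\<lambda>\<phi>. t * (P \<phi> * v \<phi>) + c * v \<phi>)"
      using 1 2 3 4 by auto
  qed
  moreover have R_eq: "R1 = (\<lambda>\<phi>. \<kappa> * (indicator {\<phi>. \<phi> x < s} \<phi> * v \<phi>) + t * (N \<phi> * v \<phi>))"
    "R2 = (\<lambda>\<phi>. t * (P \<phi> * v \<phi>) + c * v \<phi>)"
    by (simp_all add: R1_def R2_def fun_eq_iff algebra_simps)
  moreover have AE: "AE \<phi> in big.M. 0 \<le> R1 \<phi>" "AE \<phi> in big.M. 0 \<le> R2 \<phi>"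
  proof -
    have "{\<phi> \<in> space fields. 0 \<le> R1 \<phi>} \<in> sets fields" "{\<phi> \<in> space fields. 0 \<le> R2 \<phi>} \<in> sets fields"
      by measurable
    then show "AE \<phi> in big.M. 0 \<le> R1 \<phi>" "AE \<phi> in big.M. 0 \<le> R2 \<phi>"
      using R_nonneg by (intro AE_field_measure[OF site_family_lborel]; simp add: space_PiM)+
  qed
  ultimately have "ennreal (\<integral>\<phi>. R1 \<phi> \<partial>big.M) \<le> ennreal (\<integral>\<phi>. R2 \<phi> \<partial>big.M)"
    using nn_integral_eq_integral[of big.M R1] nn_integral_eq_integral[of big.M R2] by auto
  moreover have "0 \<le> (\<integral>\<phi>. R2 \<phi> \<partial>big.M)" by (rule integral_nonneg_AE[OF AE(2)])
  ultimately have "(\<integral>\<phi>. R1 \<phi> \<partial>big.M) \<le> (\<integral>\<phi>. R2 \<phi> \<partial>big.M)" by simp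
  moreover have "(\<integral>\<phi>. R1 \<phi> \<partial>big.M) = \<kappa> * (\<integral>\<phi>. indicator {\<phi>. \<phi> x < s} \<phi> * v \<phi> \<partial>big.M) + t * (\<integral>\<phi>. N \<phi> * v \<phi> \<partial>big.M)"
    unfolding R_eq by (subst Bochner_Integration.integral_add) (use parts in auto)
  moreover have "(\<integral>\<phi>. R2 \<phi> \<partial>big.M) = t * (\<integral>\<phi>. P \<phi> * v \<phi> \<partial>big.M) + c * (\<integral>\<phi>. v \<phi> \<partial>big.M)"
    unfolding R_eq by (subst Bochner_Integration.integral_add) (use parts in auto)
  moreover have "t * (\<integral>\<phi>. dirichlet L \<phi> ?\<iota> * v \<phi> \<partial>big.M) = t * (\<integral>\<phi>. P \<phi> * v \<phi> \<partial>big.M) - t * (\<integral>\<phi>. N \<phi> * v \<phi> \<partial>big.M)"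
    unfolding split left_diff_distrib
    by (subst Bochner_Integration.integral_diff) (use parts in \<open>auto simp: right_diff_distrib\<close>)
  ultimately show ?thesis unfolding c_def[symmetric] by linarith
qed

subsection \<open>The mean profile of a repelled field\<close>

definition plus_weight :: "nat \<Rightarrow> (int ^ 'd) set \<Rightarrow> (int ^ 'd \<Rightarrow> real) \<Rightarrow> real" where
  "plus_weight L D \<phi> = indicator (block.above D 0) \<phi> * block.w L (\<lambda>_. 0) \<phi>"

text \<open>The mean of the field on \<open>D\<close> without pinning, conditioned to stay above the
  wall and with zero heights outside \<open>D\<close>.\<close>

definition mean_height :: "nat \<Rightarrow> (int ^ 'd) set \<Rightarrow> int ^ 'd \<Rightarrow> real" where
  "mean_height L D k = (\<integral>\<phi>. \<phi> k * plus_weight L D \<phi> \<partial>field_measure (\<lambda>_. lborel) D) /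
    (\<integral>\<phi>. plus_weight L D \<phi> \<partial>field_measure (\<lambda>_. lborel) D)"

context
  fixes L :: nat and D :: "(int ^ 'd) set"
  assumes D: "D \<subseteq> \<Lambda> L"
begin

interpretation big: block L D "\<lambda>_. 0"
  by (rule block_zero_exterior[OF D])

lemma plus_weight_nonneg: "0 \<le> plus_weight L D \<phi>"
  by (simp add: plus_weight_def big.w_nonneg)

lemma plus_weight_eq: "plus_weight L D \<phi> = indicator {\<phi>. \<forall>i\<in>D. 0 \<le> \<phi> i} \<phi> * exp (- energy L \<phi>)"
  by (simp add: plus_weight_def big.above_def big.w_def)

lemma measurable_plus_weight: "plus_weight L D \<in> borel_measurable fields"
  unfolding plus_weight_def[abs_def] by measurable

lemma integrable_plus_weight: "integrable big.M (plus_weight L D)"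
  unfolding plus_weight_def[abs_def] by (rule big.integrable_indicator_w) measurable

lemma integral_plus_weight_pos: "0 < (\<integral>\<phi>. plus_weight L D \<phi> \<partial>big.M)"
  using big.mass_above_pos by (simp add: big.mass_def plus_weight_def)

lemma integrable_height: "integrable big.M (\<lambda>\<phi>. \<phi> k * plus_weight L D \<phi>)"
  using integrable_real_mult_indicator[OF _ big.integrable_coordinate[of k], of "big.above 0"]
  by (simp add: plus_weight_def ac_simps)

lemma AE_height_nonneg: "AE \<phi> in big.M. 0 \<le> \<phi> k * plus_weight L D \<phi>"
proof (rule AE_field_measure[OF site_family_lborel])
  fix \<phi> :: "int ^ 'd \<Rightarrow> real" assume "\<And>i. i \<notin> D \<Longrightarrow> \<phi> i = 0"
  then show "0 \<le> \<phi> k * plus_weight L D \<phi>"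
    by (cases "k \<in> D") (auto simp: plus_weight_eq indicator_def)
next
  note measurable_plus_weight[measurable]
  have "{\<phi> \<in> space fields. 0 \<le> \<phi> k * plus_weight L D \<phi>} \<in> sets fields" by measurable
  then show "{\<phi>. 0 \<le> \<phi> k * plus_weight L D \<phi>} \<in> sets fields" by (simp add: space_PiM)
qed

lemma mean_height_nonneg: "0 \<le> mean_height L D k"
  unfolding mean_height_def using AE_height_nonneg integral_plus_weight_pos
  by (intro divide_nonneg_pos integral_nonneg_AE) auto

lemma mean_height_outside: "k \<notin> D \<Longrightarrow> mean_height L D k = 0"
proof -
  assume k: "k \<notin> D"
  note measurable_plus_weight[measurable]
  have "{\<phi> \<in> space fields. \<phi> k * plus_weight L D \<phi> = 0} \<in> sets fields" by measurable
  then have "AE \<phi> in big.M. \<phi> k * plus_weight L D \<phi> = 0"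
    by (intro AE_field_measure[OF site_family_lborel]) (use k in \<open>auto simp: space_PiM\<close>)
  then have "(\<integral>\<phi>. \<phi> k * plus_weight L D \<phi> \<partial>big.M) = (\<integral>\<phi>. 0 \<partial>big.M)"
    by (intro integral_cong_AE) auto
  then show ?thesis by (simp add: mean_height_def)
qed

lemma integral_dirichlet_mean:
  "(\<integral>\<phi>. dirichlet L \<phi> f * plus_weight L D \<phi> \<partial>big.M) =
    dirichlet L (mean_height L D) f * (\<integral>\<phi>. plus_weight L D \<phi> \<partial>big.M)"
proof -
  define Z where "Z = (\<integral>\<phi>. plus_weight L D \<phi> \<partial>big.M)"
  have Z: "Z > 0" using integral_plus_weight_pos by (simp add: Z_def)
  have mean: "(\<integral>\<phi>. \<phi> k * plus_weight L D \<phi> \<partial>big.M) = mean_height L D k * Z" for k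
    using Z by (simp add: mean_height_def Z_def)
  have "(\<integral>\<phi>. dirichlet L \<phi> f * plus_weight L D \<phi> \<partial>big.M) =
    (\<integral>\<phi>. 1 / (4 * real CARD('d)) * (\<Sum>p\<in>bonds L. (f (fst p) - f (snd p)) *
      (\<phi> (fst p) * plus_weight L D \<phi> - \<phi> (snd p) * plus_weight L D \<phi>)) \<partial>big.M)"
    unfolding dirichlet_def mult.assoc sum_distrib_right
    by (intro Bochner_Integration.integral_cong arg_cong[where f = "(*) _"] sum.cong) (auto simp: algebra_simps)
  also have "\<dots> = 1 / (4 * real CARD('d)) * (\<Sum>p\<in>bonds L. (f (fst p) - f (snd p)) *
      (mean_height L D (fst p) * Z - mean_height L D (snd p) * Z))"
    unfolding integral_mult_right_zero mean[symmetric]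
    by (subst Bochner_Integration.integral_sum)
      (auto intro!: integrable_mult_right Bochner_Integration.integrable_diff integrable_height
        simp: Bochner_Integration.integral_diff[OF integrable_height integrable_height])
  also have "\<dots> = dirichlet L (mean_height L D) f * Z"
    unfolding dirichlet_def mult.assoc sum_distrib_right
    by (intro arg_cong[where f = "(*) _"] sum.cong) (auto simp: algebra_simps)
  finally show ?thesis by (simp add: Z_def)
qed

lemma markov_height:
  assumes s: "s > 0" "2 * mean_height L D k \<le> s"
  shows "(\<integral>\<phi>. plus_weight L D \<phi> \<partial>big.M) / 2 \<le> (\<integral>\<phi>. indicator {\<phi>. \<phi> k < s} \<phi> * plus_weight L D \<phi> \<partial>big.M)"
proof -
  define Z where "Z = (\<integral>\<phi>. plus_weight L D \<phi> \<partial>big.M)"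
  define Q where "Q = (\<integral>\<phi>. indicator {\<phi>. \<phi> k < s} \<phi> * plus_weight L D \<phi> \<partial>big.M)"
  have Z: "Z > 0" using integral_plus_weight_pos by (simp add: Z_def)
  note measurable_plus_weight[measurable]
  have iQ: "integrable big.M (\<lambda>\<phi>. indicator {\<phi>. \<phi> k < s} \<phi> * plus_weight L D \<phi>)"
    using integrable_real_mult_indicator[OF _ integrable_plus_weight, of "{\<phi>. \<phi> k < s}"]
    by (simp add: ac_simps)
  have "s * (Z - Q) = (\<integral>\<phi>. s * (plus_weight L D \<phi> - indicator {\<phi>. \<phi> k < s} \<phi> * plus_weight L D \<phi>) \<partial>big.M)"
    using iQ integrable_plus_weight by (simp add: Z_def Q_def)
  also have "\<dots> \<le> (\<integral>\<phi>. \<phi> k * plus_weight L D \<phi> \<partial>big.M)"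
  proof (rule integral_mono_AE)
    show "AE \<phi> in big.M. s * (plus_weight L D \<phi> - indicator {\<phi>. \<phi> k < s} \<phi> * plus_weight L D \<phi>) \<le> \<phi> k * plus_weight L D \<phi>"
      using AE_height_nonneg[of k]
    proof eventually_elim
      case (elim \<phi>)
      then show ?case
        using plus_weight_nonneg[of \<phi>] by (cases "\<phi> k < s") (auto intro: mult_right_mono)
    qed
  qed (use iQ integrable_plus_weight integrable_height in auto)
  also have "\<dots> = mean_height L D k * Z" using Z by (simp add: mean_height_def Z_def)
  also have "\<dots> \<le> s / 2 * Z" using s Z by (intro mult_right_mono) auto
  finally have "s * (Z - Q) \<le> s * (Z / 2)" by simp
  then have "Z - Q \<le> Z / 2" using s by simp
  then show ?thesis by (simp add: Z_def Q_def)
qed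

text \<open>A mean height of at most \<open>s / 2\<close> gives \<open>\<phi> x < s\<close> with
  probability at least one half, by Markov's inequality. The tilting loss in the block inequality
  costs one quarter, and one quarter remains.\<close>

lemma mean_flux_ge:
  assumes bD: "b \<subseteq> D" and x: "x \<in> b" and f: "\<And>i. i \<notin> b \<Longrightarrow> f i = 0" "f x = 1"
    and s: "0 < s" "2 * mean_height L D x \<le> s" and t: "0 < t" and C: "C > 0"
    and cap: "\<And>k g. k \<in> b \<Longrightarrow> (\<And>i. i \<notin> b \<Longrightarrow> g i = 0) \<Longrightarrow> (g k)\<^sup>2 \<le> C * energy L g"
  shows "(exp (- s\<^sup>2 * energy L f - 4 * s * sqrt (energy L f)) / 4 - real (card b) * exp (- (t\<^sup>2 / C))) / t
    \<le> dirichlet L (mean_height L D) (indicator b)"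
proof -
  define Z where "Z = (\<integral>\<phi>. plus_weight L D \<phi> \<partial>big.M)"
  have Z: "Z > 0" using integral_plus_weight_pos by (simp add: Z_def)
  define \<kappa> where "\<kappa> = exp (- s\<^sup>2 * energy L f - 4 * s * sqrt (energy L f))"
  define \<tau> where "\<tau> = real (card b) * exp (- (t\<^sup>2 / C))"
  have "\<kappa> * (\<integral>\<phi>. indicator {\<phi>. \<phi> x < s} \<phi> * plus_weight L D \<phi> \<partial>big.M) \<le>
      t * (\<integral>\<phi>. dirichlet L \<phi> (indicator b) * plus_weight L D \<phi> \<partial>big.M) + (\<kappa> / 4 + \<tau>) * Z"
    using global_block_inequality[OF D bD x, of f s t C] f s t C cap
    by (simp add: \<kappa>_def \<tau>_def Z_def plus_weight_def)
  moreover have "\<kappa> * (Z / 2) \<le> \<kappa> * (\<integral>\<phi>. indicator {\<phi>. \<phi> x < s} \<phi> * plus_weight L D \<phi> \<partial>big.M)"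
    using markov_height[OF s] by (intro mult_left_mono) (auto simp: Z_def \<kappa>_def)
  ultimately have "\<kappa> * (Z / 2) \<le> t * (dirichlet L (mean_height L D) (indicator b) * Z) + (\<kappa> / 4 + \<tau>) * Z"
    by (simp add: integral_dirichlet_mean Z_def)
  then have "Z * (\<kappa> / 4 - \<tau>) \<le> Z * (t * dirichlet L (mean_height L D) (indicator b))"
    by (simp add: algebra_simps)
  then have "\<kappa> / 4 - \<tau> \<le> t * dirichlet L (mean_height L D) (indicator b)" using Z by simp
  then show ?thesis using t by (simp add: \<kappa>_def \<tau>_def field_simps)
qed

end

subsection \<open>The minimum principle\<close>

lemma dirichlet_unit_field:
  fixes u :: "int ^ 'd::finite \<Rightarrow> real"
  assumes i: "i \<in> \<Lambda> L"
  shows "dirichlet L (unit_field i) u = 1 / (2 * real CARD('d)) * (\<Sum>j | i \<sim>\<^sub>1 j. u i - u j)"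
proof -
  have bond: "(i, j) \<in> bonds L \<longleftrightarrow> i \<sim>\<^sub>1 j" "(j, i) \<in> bonds L \<longleftrightarrow> i \<sim>\<^sub>1 j" for j
    using i nearest_in_\<Lambda>_bar[OF i] \<Lambda>_subset_\<Lambda>_bar by (auto simp: bonds_def nearest_commute)
  have "(\<Sum>(k, l)\<in>bonds L. (unit_field i k - unit_field i l) * (u k - u l)) =
    (\<Sum>(k, l)\<in>bonds L. (if k = i then u i - u l else 0)) + (\<Sum>(k, l)\<in>bonds L. (if l = i then u i - u k else 0))"
    unfolding sum.distrib[symmetric] by (intro sum.cong) (auto simp: algebra_simps)
  also have "(\<Sum>(k, l)\<in>bonds L. (if k = i then u i - u l else 0)) = (\<Sum>p\<in>Pair i ` {j. i \<sim>\<^sub>1 j}. u i - u (snd p))"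
    by (rule sum.mono_neutral_cong_right) (auto simp: bond)
  also have "\<dots> = (\<Sum>j | i \<sim>\<^sub>1 j. u i - u j)"
    by (subst sum.reindex) (auto simp: inj_on_def)
  also have "(\<Sum>(k, l)\<in>bonds L. (if l = i then u i - u k else 0)) = (\<Sum>p\<in>(\<lambda>j. (j, i)) ` {j. i \<sim>\<^sub>1 j}. u i - u (fst p))"
    by (rule sum.mono_neutral_cong_right) (auto simp: bond)
  also have "\<dots> = (\<Sum>j | i \<sim>\<^sub>1 j. u i - u j)"
    by (subst sum.reindex) (auto simp: inj_on_def)
  finally show ?thesis by (simp add: dirichlet_def)
qed

text \<open>Summation by parts, the link from a lower bound on the block flux to superharmonicity of
  block sums of the mean profile.\<close>

lemma dirichlet_indicator:
  fixes u :: "int ^ 'd::finite \<Rightarrow> real"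
  assumes b: "b \<subseteq> \<Lambda> L"
  shows "dirichlet L u (indicator b) = 1 / (2 * real CARD('d)) * (\<Sum>i\<in>b. \<Sum>j | i \<sim>\<^sub>1 j. u i - u j)"
proof -
  have "dirichlet L u (indicator b) = (\<Sum>i\<in>b. indicator b i * dirichlet L (unit_field i) u)"
    using finite_subset[OF b finite_\<Lambda>] by (subst dirichlet_commute, intro dirichlet_expand) auto
  also have "\<dots> = (\<Sum>i\<in>b. 1 / (2 * real CARD('d)) * (\<Sum>j | i \<sim>\<^sub>1 j. u i - u j))"
    using b by (intro sum.cong) (auto simp: dirichlet_unit_field subset_iff)
  finally show ?thesis by (simp add: sum_distrib_left)
qed

text \<open>Add to \<open>U\<close> a paraboloid that uses up half of the available
  superharmonicity. The sum cannot attain its minimum over the cube in the interior, so it does on a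
  face, where the paraboloid alone is at least of order the square of \<open>m\<close>.\<close>

lemma minimum_principle:
  fixes U :: "int ^ 'd::finite \<Rightarrow> real"
  assumes U: "\<And>x. 0 \<le> U x" and F: "F > 0" and superharmonic: "\<And>x. x \<in> cube m \<Longrightarrow> F \<le> (\<Sum>j | x \<sim>\<^sub>1 j. U x - U j)"
  shows "F / (2 * real (lattice_degree TYPE('d))) * (real m)\<^sup>2 \<le> U 0"
proof -
  define q where "q = F / (2 * real (lattice_degree TYPE('d)))"
  have q: "q > 0" using F lattice_degree_pos[where 'd = 'd] by (simp add: q_def)
  define W where "W x = U x + q * sqnorm x" for x
  have "0 \<in> (cube m :: (int ^ 'd) set)" by simp
  then have "W ` cube m \<noteq> {}" by blast
  moreover have "finite (W ` cube m)" by simp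
  ultimately have "finite (W ` cube m)" "W ` cube m \<noteq> {}" by auto
  then have "Min (W ` cube m) \<in> W ` cube m" by (rule Min_in)
  then obtain x where x: "x \<in> cube m" "W x = Min (W ` cube m)" by auto
  have min: "W x \<le> W j" if "j \<in> cube m" for j using that x by simp
  have "\<exists>k. \<bar>x $ k\<bar> = int m"
  proof (rule ccontr)
    assume "\<nexists>k. \<bar>x $ k\<bar> = int m"
    then have inner: "\<bar>x $ k\<bar> < int m" for k using x(1) unfolding cube_def by (metis (mono_tags) mem_Collect_eq order_le_less)
    have "(\<Sum>j | x \<sim>\<^sub>1 j. W x - W j) \<le> 0"
    proof (rule sum_nonpos)
      fix j assume "j \<in> {j. x \<sim>\<^sub>1 j}"
      then have near: "\<bar>x $ k - j $ k\<bar> \<le> 1" for k using nearest_coord by blast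
      have "\<bar>j $ k\<bar> \<le> int m" for k using near[of k] inner[of k] by linarith
      then have "j \<in> cube m" by (simp add: cube_def)
      then show "W x - W j \<le> 0" using min by simp
    qed
    moreover have "(\<Sum>j | x \<sim>\<^sub>1 j. W x - W j) = (\<Sum>j | x \<sim>\<^sub>1 j. U x - U j) - q * (\<Sum>j | x \<sim>\<^sub>1 j. sqnorm j - sqnorm x)"
      unfolding W_def sum_distrib_left sum_subtractf[symmetric] by (intro sum.cong) (auto simp: algebra_simps)
    moreover have "q * real (lattice_degree TYPE('d)) = F / 2"
      using lattice_degree_pos[where 'd = 'd] by (simp add: q_def)
    ultimately have "F \<le> F / 2"
      using superharmonic[OF x(1)] by (simp add: laplacian_sqnorm)
    then show False using F by simp
  qed
  then obtain k where "\<bar>x $ k\<bar> = int m" by blast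
  then have "(real m)\<^sup>2 = (real_of_int (x $ k))\<^sup>2"
    by (metis of_int_abs of_int_of_nat_eq power2_abs)
  also have "\<dots> \<le> sqnorm x" by (rule sqnorm_coord_le)
  finally have "q * (real m)\<^sup>2 \<le> W x" using q U[of x] by (simp add: W_def add_increasing mult_left_mono)
  also have "\<dots> \<le> W 0" by (rule min) simp
  finally show ?thesis by (simp add: W_def q_def)
qed

lemma sum_nearest_shift: "(\<Sum>j | (x :: int ^ 'd::finite) \<sim>\<^sub>1 j. f j) = (\<Sum>e | 0 \<sim>\<^sub>1 e. f (x + e))"
  unfolding nearest_set_eq[of x] by (subst sum.reindex) auto

text \<open>The profile, summed over a cube, is strictly superharmonic.\<close>

lemma mean_height_lower_bound:
  fixes f :: "int ^ 'd::finite \<Rightarrow> real"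
  assumes n: "r + m \<le> n" "2 * n + 1 \<le> L" and f: "\<And>i. i \<notin> cube r \<Longrightarrow> f i = 0" "f 0 = 1"
    and h: "0 < h" "\<And>k :: int ^ 'd. mean_height L (cube n) k \<le> h" and t: "0 < t" and C: "C > 0"
    and cap: "\<And>(k :: int ^ 'd) g. (\<And>i. i \<notin> \<Lambda> L \<Longrightarrow> g i = 0) \<Longrightarrow> (\<exists>x. \<forall>i. i \<notin> (+) x ` cube r \<longrightarrow> g i = 0) \<Longrightarrow> (g k)\<^sup>2 \<le> C * energy L g"
    and \<kappa>: "\<kappa> \<le> exp (- (2 * h)\<^sup>2 * energy L f - 4 * (2 * h) * sqrt (energy L f))" "0 < \<kappa>"
    and \<tau>: "real ((2 * r + 1) ^ CARD('d)) * exp (- (t\<^sup>2 / C)) \<le> \<kappa> / 8"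
  shows "\<kappa> / (8 * t) * (real CARD('d) / real (lattice_degree TYPE('d))) * (real m)\<^sup>2 \<le> real ((2 * r + 1) ^ CARD('d)) * h"
proof -
  let ?D = "cube n :: (int ^ 'd) set"
  let ?u = "mean_height L ?D"
  have D: "?D \<subseteq> \<Lambda> L" using n(2) by (rule cube_subset_\<Lambda>)
  \<comment> \<open>Summation over the block commutes with the Laplacian, so the flux out of the
    cube around \<open>x\<close> is, up to a constant factor, the negative Laplacian of
    \<open>U\<close> at \<open>x\<close>.\<close>
  define U where "U x = (\<Sum>y\<in>cube r. ?u (x + y))" for x
  define F where "F = 2 * real CARD('d) * (\<kappa> / (8 * t))"
  have F: "F > 0" using \<kappa> t by (simp add: F_def)
  have "F \<le> (\<Sum>j | x \<sim>\<^sub>1 j. U x - U j)" if x: "x \<in> cube m" for x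
  proof -
    let ?b = "(+) x ` cube r"
    have bD: "?b \<subseteq> ?D"
    proof
      fix z assume "z \<in> ?b"
      then obtain y where y: "z = x + y" "y \<in> cube r" by auto
      have "\<bar>z $ k\<bar> \<le> int n" for k
      proof -
        have "\<bar>x $ k\<bar> \<le> int m" "\<bar>y $ k\<bar> \<le> int r" using x y(2) by (auto simp: cube_def)
        then show ?thesis using n(1) y(1) by simp
      qed
      then show "z \<in> ?D" by (simp add: cube_def)
    qed
    have xb: "x \<in> ?b" using zero_in_cube by force
    have card_b: "card ?b = (2 * r + 1) ^ CARD('d)" by (simp add: card_image card_cube)
    define g where "g i = f (i - x)" for i
    have g: "g i = 0" if "i \<notin> ?b" for i
    proof -
      have "i - x \<notin> cube r" using that by (metis add_diff_cancel_left' image_eqI add.commute diff_add_cancel)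
      then show ?thesis by (simp add: g_def f)
    qed
    have g\<Lambda>: "g i = 0" if "i \<notin> \<Lambda> L" for i using that g bD D by blast
    have f\<Lambda>: "f i = 0" if "i \<notin> \<Lambda> L" for i
    proof -
      have "2 * r + 1 \<le> L" using n by simp
      then show ?thesis using cube_subset_\<Lambda>[of r L] that f(1) by blast
    qed
    have energy_g: "energy L g = energy L f"
      using energy_translate[of L f x] f\<Lambda> g\<Lambda> by (simp add: g_def[abs_def])
    have "(exp (- (2 * h)\<^sup>2 * energy L g - 4 * (2 * h) * sqrt (energy L g)) / 4 - real (card ?b) * exp (- (t\<^sup>2 / C))) / t
      \<le> dirichlet L ?u (indicator ?b)"
    proof (rule mean_flux_ge[OF D bD xb])
      show "g i = 0" if "i \<notin> ?b" for i by (rule g[OF that])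
      show "g x = 1" by (simp add: g_def f)
      show "2 * ?u x \<le> 2 * h" using h by simp
      fix k and p :: "int ^ 'd \<Rightarrow> real" assume p: "\<And>i. i \<notin> ?b \<Longrightarrow> p i = 0"
      show "(p k)\<^sup>2 \<le> C * energy L p"
      proof (rule cap)
        show "p i = 0" if "i \<notin> \<Lambda> L" for i using p[of i] that bD D by blast
        show "\<exists>x. \<forall>i. i \<notin> (+) x ` cube r \<longrightarrow> p i = 0" using p by blast
      qed
    qed (use h t C in auto)
    \<comment> \<open>The tail hypothesis consumes half of the available
      \<open>\<kappa> / 4\<close>.\<close>
    moreover have "\<kappa> / 8 / t \<le> (exp (- (2 * h)\<^sup>2 * energy L g - 4 * (2 * h) * sqrt (energy L g)) / 4 - real (card ?b) * exp (- (t\<^sup>2 / C))) / t"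
    proof (rule divide_right_mono)
      show "\<kappa> / 8 \<le> exp (- (2 * h)\<^sup>2 * energy L g - 4 * (2 * h) * sqrt (energy L g)) / 4 - real (card ?b) * exp (- (t\<^sup>2 / C))"
        using \<kappa>(1) \<tau> unfolding energy_g card_b by linarith
    qed (use t in linarith)
    moreover have "dirichlet L ?u (indicator ?b) = 1 / (2 * real CARD('d)) * (\<Sum>i\<in>?b. \<Sum>j | i \<sim>\<^sub>1 j. ?u i - ?u j)"
      using bD D by (intro dirichlet_indicator) auto
    ultimately have "\<kappa> / (8 * t) \<le> 1 / (2 * real CARD('d)) * (\<Sum>i\<in>?b. \<Sum>j | i \<sim>\<^sub>1 j. ?u i - ?u j)"
      by simp
    then have "F \<le> 2 * real CARD('d) * (1 / (2 * real CARD('d)) * (\<Sum>i\<in>?b. \<Sum>j | i \<sim>\<^sub>1 j. ?u i - ?u j))"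
      unfolding F_def by (intro mult_left_mono) auto
    also have "\<dots> = (\<Sum>i\<in>?b. \<Sum>j | i \<sim>\<^sub>1 j. ?u i - ?u j)" by simp
    also have "\<dots> = (\<Sum>y\<in>cube r. \<Sum>e | 0 \<sim>\<^sub>1 e. ?u (x + y) - ?u (x + y + e))"
    proof -
      have "(\<Sum>i\<in>?b. \<Sum>j | i \<sim>\<^sub>1 j. ?u i - ?u j) = (\<Sum>y\<in>cube r. \<Sum>j | x + y \<sim>\<^sub>1 j. ?u (x + y) - ?u j)"
        by (subst sum.reindex) auto
      then show ?thesis by (simp only: sum_nearest_shift[where f = "\<lambda>j. _ - ?u j"])
    qed
    also have "\<dots> = (\<Sum>e | 0 \<sim>\<^sub>1 e. \<Sum>y\<in>cube r. ?u (x + y) - ?u (x + y + e))"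
      by (rule sum.swap)
    also have "\<dots> = (\<Sum>j | x \<sim>\<^sub>1 j. U x - U j)"
      by (subst sum_nearest_shift) (simp add: U_def sum_subtractf add.assoc add.left_commute add.commute)
    finally show ?thesis .
  qed
  then have "F / (2 * real (lattice_degree TYPE('d))) * (real m)\<^sup>2 \<le> U 0"
    using F mean_height_nonneg[OF D] by (intro minimum_principle) (auto simp: U_def intro: sum_nonneg)
  also have "U 0 \<le> (\<Sum>y\<in>(cube r :: (int ^ 'd) set). h)" unfolding U_def by (intro sum_mono h)
  also have "\<dots> = real ((2 * r + 1) ^ CARD('d)) * h" by (simp only: sum_constant card_cube)
  finally show ?thesis by (simp add: F_def field_simps)
qed

subsection \<open>Logarithmic capacity estimates in the plane\<close>

lemma sum_inverse_le_ln: "N \<ge> 1 \<Longrightarrow> (\<Sum>n<N. 1 / (real n + 1)) \<le> 1 + ln (real N)"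
proof (induction N rule: nat_induct_at_least)
  case (Suc N)
  have "1 / (real N + 1) \<le> ln (real (Suc N)) - ln (real N)"
  proof -
    have "ln (real N / real (Suc N)) \<le> real N / real (Suc N) - 1"
      using Suc by (intro ln_le_minus_one) auto
    also have "\<dots> = - (1 / (real N + 1))" by (simp add: field_simps)
    finally show ?thesis using Suc by (simp add: ln_div)
  qed
  then show ?case using Suc by simp
qed simp

text \<open>The flow of Polya's urn: from the antidiagonal point \<open>(x, n - x)\<close> send the mass fraction
  \<open>(x + 1) / (n + 2)\<close> to the right and \<open>(n - x + 1) / (n + 2)\<close> upwards. It keeps the uniform
  distribution on antidiagonals, so its energy up to distance \<open>N\<close> is of order \<open>ln N\<close>.\<close>

lemma antidiagonal_average_step:
  fixes F :: "nat \<Rightarrow> nat \<Rightarrow> real"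
  defines "A \<equiv> \<lambda>n. (\<Sum>x\<le>n. F x (n - x)) / (real n + 1)"
  shows "(real n + 1) * (A n - A (Suc n))\<^sup>2 \<le>
    (\<Sum>x\<le>n. (F x (n - x) - F (Suc x) (n - x))\<^sup>2) + (\<Sum>x\<le>n. (F x (n - x) - F x (Suc (n - x)))\<^sup>2)"
proof -
  define d where "d p = (if snd p then F (fst p) (n - fst p) - F (Suc (fst p)) (n - fst p)
    else F (fst p) (n - fst p) - F (fst p) (Suc (n - fst p)))" for p :: "nat \<times> bool"
  \<comment> \<open>The flow multiplied by \<open>(n + 1) * (n + 2)\<close> to clear denominators;
    \<open>True\<close> marks rightward bonds, \<open>False\<close> upward ones, and
    \<open>d\<close> holds the gradient along them.\<close>
  define c where "c p = (if snd p then real (fst p) + 1 else real (n - fst p) + 1)" for p :: "nat \<times> bool"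
  let ?I = "{..n} \<times> (UNIV :: bool set)"
  have sum_I: "(\<Sum>p\<in>?I. G p) = (\<Sum>x\<le>n. G (x, True) + G (x, False))" for G :: "nat \<times> bool \<Rightarrow> real"
    by (simp add: sum.cartesian_product' UNIV_bool add.commute)
  \<comment> \<open>The next antidiagonal. A point \<open>z\<close> on it receives weight
    \<open>z\<close> from the left and \<open>n + 1 - z\<close> from below; their sum does not
    depend on \<open>z\<close>, which is why the uniform distribution is preserved.\<close>
  define g where "g z = F z (Suc n - z)" for z
  have 1: "(\<Sum>x\<le>n. (real x + 1) * F (Suc x) (n - x)) = (\<Sum>z\<le>Suc n. real z * g z)"
    by (subst sum.atMost_Suc_shift) (simp add: g_def add.commute)
  have 2: "(\<Sum>x\<le>n. (real (n - x) + 1) * F x (Suc (n - x))) = (\<Sum>z\<le>Suc n. (real (Suc n) - real z) * g z)"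
    by (simp add: g_def Suc_diff_le of_nat_diff algebra_simps cong: sum.cong_simp)
  have "(\<Sum>p\<in>?I. c p * d p) = (\<Sum>x\<le>n. (real n + 2) * F x (n - x)) -
      ((\<Sum>x\<le>n. (real x + 1) * F (Suc x) (n - x)) + (\<Sum>x\<le>n. (real (n - x) + 1) * F x (Suc (n - x))))"
    unfolding sum_I c_def d_def sum.distrib[symmetric] sum_subtractf[symmetric]
    by (intro sum.cong) (auto simp: of_nat_diff algebra_simps)
  also have "\<dots> = (real n + 2) * (\<Sum>x\<le>n. F x (n - x)) - real (Suc n) * (\<Sum>z\<le>Suc n. g z)"
    unfolding 1 2 sum.distrib[symmetric] sum_distrib_left by (simp add: algebra_simps)
  also have "\<dots> = (real n + 1) * (real n + 2) * (A n - A (Suc n))"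
  proof -
    define a b where "a = (\<Sum>x\<le>n. F x (n - x))" and "b = (\<Sum>z\<le>Suc n. g z)"
    define q where "q = real n"
    have A: "A n = a / (q + 1)" "A (Suc n) = b / (q + 2)" "real (Suc n) = q + 1" "real n = q"
      by (simp_all add: A_def a_def b_def g_def q_def add.commute del: sum.atMost_Suc)
    have "0 \<le> q" by (simp add: q_def)
    then have "(q + 1) * (q + 2) * (a / (q + 1) - b / (q + 2)) = (q + 2) * a - (q + 1) * b"
      by (simp add: divide_simps)
    then show ?thesis unfolding a_def[symmetric] b_def[symmetric] A by simp
  qed
  finally have cd: "(\<Sum>p\<in>?I. c p * d p) = (real n + 1) * (real n + 2) * (A n - A (Suc n))" .
  have "(\<Sum>p\<in>?I. (c p)\<^sup>2) \<le> (\<Sum>x\<le>n. (real n + 1) * (real n + 2))"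
    unfolding sum_I
  proof (rule sum_mono)
    fix x assume "x \<in> {..n}"
    then have x: "real x \<le> real n" "real (n - x) = real n - real x" by (auto simp: of_nat_diff)
    have "(c (x, True))\<^sup>2 + (c (x, False))\<^sup>2 = (real x + 1) * (real x + 1) + (real n - real x + 1) * (real n - real x + 1)"
      by (simp add: c_def x power2_eq_square)
    also have "\<dots> \<le> (real n + 1) * (real x + 1) + (real n + 1) * (real n - real x + 1)"
      using x by (intro add_mono mult_right_mono) auto
    also have "\<dots> = (real n + 1) * (real n + 2)" by (simp add: algebra_simps)
    finally show "(c (x, True))\<^sup>2 + (c (x, False))\<^sup>2 \<le> (real n + 1) * (real n + 2)" .
  qed
  also have "\<dots> = (real n + 1) * (real n + 1) * (real n + 2)" by simp
  finally have c2: "(\<Sum>p\<in>?I. (c p)\<^sup>2) \<le> (real n + 1) * (real n + 1) * (real n + 2)" .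
  have "((real n + 1) * (real n + 2) * (A n - A (Suc n)))\<^sup>2 \<le> (\<Sum>p\<in>?I. (c p)\<^sup>2) * (\<Sum>p\<in>?I. (d p)\<^sup>2)"
    unfolding cd[symmetric] by (rule Cauchy_Schwarz_ineq_sum)
  also have "\<dots> \<le> (real n + 1) * (real n + 1) * (real n + 2) * (\<Sum>p\<in>?I. (d p)\<^sup>2)"
    using c2 by (intro mult_right_mono sum_nonneg) auto
  finally have "((real n + 1) * (real n + 1) * (real n + 2)) * ((real n + 2) * (A n - A (Suc n))\<^sup>2) \<le>
      ((real n + 1) * (real n + 1) * (real n + 2)) * (\<Sum>p\<in>?I. (d p)\<^sup>2)"
    by (simp add: power2_eq_square ac_simps)
  then have "(real n + 2) * (A n - A (Suc n))\<^sup>2 \<le> (\<Sum>p\<in>?I. (d p)\<^sup>2)"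
    by (subst (asm) mult_le_cancel_left_pos) auto
  moreover have "(real n + 1) * (A n - A (Suc n))\<^sup>2 \<le> (real n + 2) * (A n - A (Suc n))\<^sup>2"
    by (intro mult_right_mono) auto
  moreover have "(\<Sum>p\<in>?I. (d p)\<^sup>2) = (\<Sum>x\<le>n. (F x (n - x) - F (Suc x) (n - x))\<^sup>2) + (\<Sum>x\<le>n. (F x (n - x) - F x (Suc (n - x)))\<^sup>2)"
    unfolding sum_I by (simp add: d_def sum.distrib)
  ultimately show ?thesis by linarith
qed

text \<open>The averages over antidiagonals of one quadrant based at \<open>k\<close> start at
  \<open>f k\<close> and end at 0. Cauchy-Schwarz with weights \<open>n + 1\<close> leaves a
  harmonic sum, hence the logarithm; rightward and upward bonds are each charged at most
  \<open>16 * energy L f\<close> in the plane, which makes 32.\<close>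

lemma planar_capacity:
  fixes f :: "int ^ 'd::finite \<Rightarrow> real"
  assumes card: "CARD('d) = 2" and f: "\<And>i. i \<notin> \<Lambda> L \<Longrightarrow> f i = 0" and supp: "\<And>i. i \<notin> (+) z ` cube r \<Longrightarrow> f i = 0"
  shows "(f k)\<^sup>2 \<le> 32 * (1 + ln (real (4 * r + 2))) * energy L f"
proof (cases "k \<in> (+) z ` cube r")
  case False
  have "0 \<le> 32 * (1 + ln (real (4 * r + 2))) * energy L f"
    by (intro mult_nonneg_nonneg add_nonneg_nonneg energy_nonneg) auto
  then show ?thesis using supp[OF False] by simp
next
  case True
  obtain a b :: 'd where ab: "a \<noteq> b" "UNIV = {a, b}"
    using card by (auto simp: card_2_iff)
  define p where "p x y = k + (axis a (int x) + axis b (int y))" for x y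
  define F where "F x y = f (p x y)" for x y
  \<comment> \<open>Two points of the supporting cube differ by at most \<open>2 * r\<close> in each
    coordinate, so a quadrant path of more than \<open>4 * r\<close> steps has left it.\<close>
  define N where "N = 4 * r + 2"
  have comp: "p x y $ a = k $ a + int x" "p x y $ b = k $ b + int y" for x y
    using ab by (auto simp: p_def axis_def)
  have p_inj: "p x y = p x' y' \<longleftrightarrow> x = x' \<and> y = y'" for x y x' y'
    using comp[of x y] comp[of x' y'] by (metis add_left_cancel of_nat_eq_iff)
  have right: "p x y \<sim>\<^sub>1 p (Suc x) y" and up: "p x y \<sim>\<^sub>1 p x (Suc y)" for x y
  proof -
    have "p (Suc x) y = p x y + axis a 1" "p x (Suc y) = p x y + axis b 1"
      using ab by (auto simp: p_def axis_def vec_eq_iff)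
    then show "p x y \<sim>\<^sub>1 p (Suc x) y" "p x y \<sim>\<^sub>1 p x (Suc y)" by simp_all
  qed
  have far: "F x y = 0" if "x + y = N" for x y
  proof -
    have "p x y \<notin> (+) z ` cube r"
    proof
      assume "p x y \<in> (+) z ` cube r"
      then have 1: "\<bar>p x y $ e - z $ e\<bar> \<le> int r" for e by (auto simp: cube_def)
      have 2: "\<bar>k $ e - z $ e\<bar> \<le> int r" for e using True by (auto simp: cube_def)
      show False using 1[of a] 1[of b] 2[of a] 2[of b] that unfolding comp N_def by linarith
    qed
    then show ?thesis by (simp add: F_def supp)
  qed
  define A where "A n = (\<Sum>x\<le>n. F x (n - x)) / (real n + 1)" for n
  define R where "R n = (\<Sum>x\<le>n. (F x (n - x) - F (Suc x) (n - x))\<^sup>2)" for n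
  define T where "T n = (\<Sum>x\<le>n. (F x (n - x) - F x (Suc (n - x)))\<^sup>2)" for n
  have step: "(real n + 1) * (A n - A (Suc n))\<^sup>2 \<le> R n + T n" for n
    unfolding A_def R_def T_def by (rule antidiagonal_average_step)
  have "A N = 0" by (simp add: A_def far)
  moreover have "A 0 = f k" by (simp add: A_def F_def p_def axis_def vec_eq_iff cong: if_cong) (simp add: zero_vec_def[symmetric])
  ultimately have "f k = (\<Sum>n<N. A n - A (Suc n))"
    using sum_lessThan_telescope'[of A N] by simp
  also have "\<dots> = (\<Sum>n<N. 1 / sqrt (real n + 1) * (sqrt (real n + 1) * (A n - A (Suc n))))"
    by (intro sum.cong) auto
  finally have "(f k)\<^sup>2 \<le> (\<Sum>n<N. (1 / sqrt (real n + 1))\<^sup>2) * (\<Sum>n<N. (sqrt (real n + 1) * (A n - A (Suc n)))\<^sup>2)"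
    using Cauchy_Schwarz_ineq_sum[of "\<lambda>n. 1 / sqrt (real n + 1)" "\<lambda>n. sqrt (real n + 1) * (A n - A (Suc n))" "{..<N}"]
    by simp
  also have "\<dots> = (\<Sum>n<N. 1 / (real n + 1)) * (\<Sum>n<N. (real n + 1) * (A n - A (Suc n))\<^sup>2)"
    by (simp add: power_divide power_mult_distrib)
  also have "\<dots> \<le> (1 + ln (real N)) * (32 * energy L f)"
  proof (rule mult_mono)
    show "(\<Sum>n<N. 1 / (real n + 1)) \<le> 1 + ln (real N)" by (rule sum_inverse_le_ln) (simp add: N_def)
    let ?S = "SIGMA n:{..<N}. {..n}"
    have R: "(\<Sum>n<N. R n) \<le> 8 * real CARD('d) * energy L f"
    proof -
      let ?e = "\<lambda>(n, x). (p x (n - x), p (Suc x) (n - x))"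
      have inj: "inj_on ?e ?S"
        by (rule inj_onI) (auto simp: p_inj)
      have "(\<Sum>n<N. R n) = (\<Sum>(n, x)\<in>?S. (F x (n - x) - F (Suc x) (n - x))\<^sup>2)"
        unfolding R_def by (rule sum.Sigma) auto
      also have "\<dots> = (\<Sum>(i, j)\<in>?e ` ?S. (f i - f j)\<^sup>2)"
        using inj by (subst sum.reindex) (auto simp: F_def split_beta intro!: sum.cong)
      also have "\<dots> \<le> 8 * real CARD('d) * energy L f"
        using f right by (intro bonds_energy_le) auto
      finally show ?thesis .
    qed
    have T: "(\<Sum>n<N. T n) \<le> 8 * real CARD('d) * energy L f"
    proof -
      let ?e = "\<lambda>(n, x). (p x (n - x), p x (Suc (n - x)))"
      have inj: "inj_on ?e ?S"
        by (rule inj_onI) (auto simp: p_inj)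
      have "(\<Sum>n<N. T n) = (\<Sum>(n, x)\<in>?S. (F x (n - x) - F x (Suc (n - x)))\<^sup>2)"
        unfolding T_def by (rule sum.Sigma) auto
      also have "\<dots> = (\<Sum>(i, j)\<in>?e ` ?S. (f i - f j)\<^sup>2)"
        using inj by (subst sum.reindex) (auto simp: F_def split_beta intro!: sum.cong)
      also have "\<dots> \<le> 8 * real CARD('d) * energy L f"
        using f up by (intro bonds_energy_le) auto
      finally show ?thesis .
    qed
    have "(\<Sum>n<N. (real n + 1) * (A n - A (Suc n))\<^sup>2) \<le> (\<Sum>n<N. R n + T n)"
      by (rule sum_mono) (rule step)
    then show "(\<Sum>n<N. (real n + 1) * (A n - A (Suc n))\<^sup>2) \<le> 32 * energy L f"
      using R T card by (simp add: sum.distrib)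
  qed (auto simp: N_def intro!: sum_nonneg add_nonneg_nonneg)
  finally show ?thesis by (simp add: N_def algebra_simps)
qed

section \<open>The truncated logarithm as a test function of small energy\<close>

definition sup_norm :: "int ^ 'd::finite \<Rightarrow> nat" where
  "sup_norm i = Max (range (\<lambda>k. nat \<bar>i $ k\<bar>))"

lemma sup_norm_le_iff: "sup_norm i \<le> n \<longleftrightarrow> i \<in> cube n"
  unfolding sup_norm_def cube_def by (subst Max_le_iff) (auto simp: nat_le_iff)

lemma sup_norm_nearest:
  assumes "i \<sim>\<^sub>1 j"
  shows "sup_norm j \<le> sup_norm i + 1"
  unfolding sup_norm_le_iff
proof -
  have "i \<in> cube (sup_norm i)" by (simp add: sup_norm_le_iff[symmetric])
  then have "\<bar>i $ k\<bar> \<le> int (sup_norm i)" for k by (simp add: cube_def)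
  then have "\<bar>j $ k\<bar> \<le> int (sup_norm i + 1)" for k
  proof -
    have "\<bar>j $ k\<bar> \<le> \<bar>i $ k\<bar> + 1" using nearest_coord[OF assms, of k] by linarith
    also have "\<dots> \<le> int (sup_norm i) + 1" using \<open>\<bar>i $ k\<bar> \<le> int (sup_norm i)\<close> by simp
    finally show ?thesis by simp
  qed
  then show "j \<in> cube (sup_norm i + 1)" by (simp add: cube_def)
qed

text \<open>The shell of sup-norm \<open>s > 0\<close> in the plane has \<open>8 * s\<close> sites,
  so it contributes less than \<open>8 / (s + 1)\<close>.\<close>

lemma sum_cube_inverse_square:
  assumes card: "CARD('d::finite) = 2"
  shows "(\<Sum>i\<in>(cube r :: (int ^ 'd) set). 1 / (real (sup_norm i) + 1)\<^sup>2) \<le> 8 * (\<Sum>n<Suc r. 1 / (real n + 1))"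
proof (induction r)
  case 0
  have "cube 0 = {0 :: int ^ 'd}" by (auto simp: cube_def vec_eq_iff)
  moreover have "sup_norm (0 :: int ^ 'd) = 0" using sup_norm_le_iff[of "0 :: int ^ 'd" 0] by simp
  ultimately show ?case by simp
next
  case (Suc r)
  let ?S = "cube (Suc r) - cube r :: (int ^ 'd) set"
  have sub: "cube r \<subseteq> (cube (Suc r) :: (int ^ 'd) set)" by (auto simp: sup_norm_le_iff[symmetric])
  have "card ?S = (2 * Suc r + 1)\<^sup>2 - (2 * r + 1)\<^sup>2"
    using sub by (simp add: card_Diff_subset card_cube card)
  also have "\<dots> = 8 * Suc r" by (simp add: power2_eq_square algebra_simps)
  finally have card_S: "card ?S = 8 * Suc r" .
  have norm_S: "sup_norm i = Suc r" if "i \<in> ?S" for i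
    using that by (metis DiffD1 DiffD2 le_antisym not_less_eq_eq sup_norm_le_iff)
  have "(\<Sum>i\<in>cube (Suc r). 1 / (real (sup_norm (i :: int ^ 'd)) + 1)\<^sup>2) =
      (\<Sum>i\<in>?S. 1 / (real (sup_norm i) + 1)\<^sup>2) + (\<Sum>i\<in>cube r. 1 / (real (sup_norm (i :: int ^ 'd)) + 1)\<^sup>2)"
    using sub by (intro sum.subset_diff) auto
  also have "(\<Sum>i\<in>?S. 1 / (real (sup_norm i) + 1)\<^sup>2) = (\<Sum>i\<in>?S. 1 / (real (Suc r) + 1)\<^sup>2)"
    by (intro sum.cong) (auto simp: norm_S)
  also have "\<dots> = 8 * real (Suc r) / (real (Suc r) + 1)\<^sup>2" by (simp add: card_S)
  also have "\<dots> \<le> 8 * (1 / (real (Suc r) + 1))"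
    by (simp add: power2_eq_square divide_simps)
  finally show ?case using Suc by simp
qed

text \<open>A radial approximation to the equilibrium potential of the origin in a planar cube: 1 at
  the origin, 0 from sup-norm \<open>r\<close> on. The 1 added inside the logarithms avoids the
  singularity at the origin.\<close>

definition log_profile :: "nat \<Rightarrow> int ^ 'd::finite \<Rightarrow> real" where
  "log_profile r i = max 0 (1 - ln (1 + real (sup_norm i)) / ln (1 + real r))"

lemma ln_ratio_le:
  assumes "a \<le> c + 1"
  shows "ln (1 + real a) - ln (1 + real c) \<le> 2 / (real a + 1)"
proof (cases "a \<le> c")
  case True
  then have "ln (1 + real a) \<le> ln (1 + real c)" by simp
  moreover have "0 \<le> 2 / (real a + 1)" by simp
  ultimately show ?thesis by linarith
next
  case False
  then have a: "a = c + 1" using assms by simp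
  have "ln ((1 + real a) / (1 + real c)) \<le> (1 + real a) / (1 + real c) - 1"
    by (intro ln_le_minus_one) auto
  also have "\<dots> = 1 / (1 + real c)" by (simp add: a field_simps)
  also have "\<dots> \<le> 2 / (real a + 1)" by (simp add: a field_simps)
  finally show ?thesis by (simp add: ln_div)
qed

text \<open>A squared gradient at \<open>i\<close> is at most \<open>4 / l\<^sup>2\<close> over the
  square of \<open>sup_norm i + 1\<close>, and the shells sum to at most \<open>8 * (1 + l)\<close>.
  As \<open>r \<ge> 2\<close> forces \<open>l \<ge> 1\<close>, this is at most
  \<open>16 * l\<close>; the prefactor of the planar energy is \<open>1 / 16\<close>.\<close>

lemma energy_log_profile:
  assumes card: "CARD('d::finite) = 2" and r: "r \<ge> 2"
  shows "energy L (log_profile r :: int ^ 'd \<Rightarrow> real) \<le> 4 * real (lattice_degree TYPE('d)) / ln (1 + real r)"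
proof -
  let ?f = "log_profile r :: int ^ 'd \<Rightarrow> real"
  define l where "l = ln (1 + real r)"
  have "exp 1 \<le> 1 + real r" using exp_le r by linarith
  then have l: "1 \<le> l" unfolding l_def by (subst ln_ge_iff) auto
  have zero: "?f i = 0" if "r \<le> sup_norm i" for i
  proof -
    have "l \<le> ln (1 + real (sup_norm i))" using that by (simp add: l_def)
    then show ?thesis using l by (simp add: log_profile_def l_def[symmetric])
  qed
  have diff: "(?f i - ?f j)\<^sup>2 \<le> 4 / l\<^sup>2 * (if i \<in> cube r then 1 / (real (sup_norm i) + 1)\<^sup>2 else 0)" if ij: "i \<sim>\<^sub>1 j" for i j
  proof (cases "i \<in> cube r")
    case False
    then have "r < sup_norm i" by (simp add: sup_norm_le_iff[symmetric])
    moreover have "sup_norm i \<le> sup_norm j + 1" using ij by (intro sup_norm_nearest) (simp add: nearest_commute)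
    ultimately show ?thesis using zero[of i] zero[of j] by simp
  next
    case True
    have near: "sup_norm i \<le> sup_norm j + 1" "sup_norm j \<le> sup_norm i + 1"
      using sup_norm_nearest[OF ij] sup_norm_nearest[of j i] ij by (simp_all add: nearest_commute)
    let ?d = "2 / (real (sup_norm i) + 1)"
    have "\<bar>ln (1 + real (sup_norm i)) - ln (1 + real (sup_norm j))\<bar> \<le> ?d"
    proof -
      have "ln (1 + real (sup_norm j)) - ln (1 + real (sup_norm i)) \<le> ?d"
      proof (cases "sup_norm i \<le> sup_norm j")
        case True
        have "2 / (real (sup_norm j) + 1) \<le> ?d" using True by (intro divide_left_mono) auto
        then show ?thesis using ln_ratio_le[OF near(2)] by linarith
      next
        case False
        then have "ln (1 + real (sup_norm j)) \<le> ln (1 + real (sup_norm i))" by simp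
        moreover have "0 \<le> ?d" by simp
        ultimately show ?thesis by linarith
      qed
      then show ?thesis using ln_ratio_le[OF near(1)] by linarith
    qed
    then have "\<bar>ln (1 + real (sup_norm i)) - ln (1 + real (sup_norm j))\<bar> / l \<le> ?d / l"
      using l by (intro divide_right_mono) auto
    moreover have "\<bar>(1 - ln (1 + real (sup_norm i)) / l) - (1 - ln (1 + real (sup_norm j)) / l)\<bar> =
        \<bar>ln (1 + real (sup_norm i)) - ln (1 + real (sup_norm j))\<bar> / l"
      using l by (simp add: diff_divide_distrib[symmetric] abs_divide abs_minus_commute)
    ultimately have "\<bar>(1 - ln (1 + real (sup_norm i)) / l) - (1 - ln (1 + real (sup_norm j)) / l)\<bar> \<le> ?d / l"
      by linarith
    then have "\<bar>?f i - ?f j\<bar> \<le> ?d / l"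
      unfolding log_profile_def l_def[symmetric] by linarith
    then have "\<bar>?f i - ?f j\<bar>\<^sup>2 \<le> (?d / l)\<^sup>2" by (intro power_mono) auto
    then show ?thesis using True by (simp add: power_divide power_mult_distrib mult.commute)
  qed
  let ?g = "\<lambda>i :: int ^ 'd. 4 / l\<^sup>2 * (if i \<in> cube r then 1 / (real (sup_norm i) + 1)\<^sup>2 else 0)"
  have "(\<Sum>(i, j)\<in>bonds L. (?f i - ?f j)\<^sup>2) \<le> (\<Sum>(i, j)\<in>bonds L. ?g i)"
    using diff by (intro sum_mono) (auto simp: bonds_def)
  also have "\<dots> \<le> (\<Sum>(i, j)\<in>(SIGMA i:\<Lambda>_bar L. {j. i \<sim>\<^sub>1 j}). ?g i)"
    by (intro sum_mono2) (auto simp: bonds_def finite_\<Lambda>_bar)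
  also have "\<dots> = (\<Sum>i\<in>\<Lambda>_bar L. real (lattice_degree TYPE('d)) * ?g i)"
    by (subst sum.Sigma[symmetric]) (auto simp: finite_\<Lambda>_bar card_nearest)
  also have "\<dots> \<le> (\<Sum>i\<in>\<Lambda>_bar L \<union> cube r. real (lattice_degree TYPE('d)) * ?g i)"
    by (intro sum_mono2) (auto simp: finite_\<Lambda>_bar)
  also have "\<dots> = (\<Sum>i\<in>(cube r :: (int ^ 'd) set). real (lattice_degree TYPE('d)) * (4 / l\<^sup>2) * (1 / (real (sup_norm i) + 1)\<^sup>2))"
    by (intro sum.mono_neutral_cong_right) (auto simp: finite_\<Lambda>_bar)
  also have "\<dots> = real (lattice_degree TYPE('d)) * (4 / l\<^sup>2) * (\<Sum>i\<in>(cube r :: (int ^ 'd) set). 1 / (real (sup_norm i) + 1)\<^sup>2)"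
    by (simp only: sum_distrib_left)
  also have "\<dots> \<le> real (lattice_degree TYPE('d)) * (4 / l\<^sup>2) * (8 * (1 + l))"
  proof (rule mult_left_mono)
    show "(\<Sum>i\<in>(cube r :: (int ^ 'd) set). 1 / (real (sup_norm i) + 1)\<^sup>2) \<le> 8 * (1 + l)"
      using sum_cube_inverse_square[OF card, of r] sum_inverse_le_ln[of "Suc r"] by (simp add: l_def)
  qed auto
  also have "\<dots> \<le> real (lattice_degree TYPE('d)) * (4 / l\<^sup>2) * (8 * (2 * l))"
    using l by (intro mult_left_mono) auto
  also have "\<dots> = 64 * real (lattice_degree TYPE('d)) / l"
    using l by (simp add: power2_eq_square)
  finally show ?thesis using card by (simp add: energy_eq l_def)
qed

lemma log_profile_props:
  fixes i :: "int ^ 'd::finite"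
  assumes "r \<ge> 1"
  shows "log_profile r (0 :: int ^ 'd) = 1" "i \<notin> cube r \<Longrightarrow> log_profile r i = 0"
proof -
  have "sup_norm (0 :: int ^ 'd) = 0" using sup_norm_le_iff[of "0 :: int ^ 'd" 0] by simp
  then show "log_profile r (0 :: int ^ 'd) = 1" by (simp add: log_profile_def)
  assume "i \<notin> cube r"
  then have "r < sup_norm i" by (simp add: sup_norm_le_iff[symmetric])
  then have "1 \<le> ln (1 + real (sup_norm i)) / ln (1 + real r)" using assms by (simp add: le_divide_eq_1)
  then show "log_profile r i = 0" by (simp add: log_profile_def)
qed

subsection \<open>Entropic repulsion\<close>

lemma energy_unit_field:
  fixes x :: "int ^ 'd::finite"
  assumes "x \<in> \<Lambda> L"
  shows "energy L (unit_field x) = real (lattice_degree TYPE('d)) / (4 * real CARD('d))"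
proof -
  have "(\<Sum>j | x \<sim>\<^sub>1 j. unit_field x x - unit_field x j) = (\<Sum>j | x \<sim>\<^sub>1 j. 1::real)"
    by (intro sum.cong) auto
  also have "\<dots> = real (lattice_degree TYPE('d))" by (simp add: card_nearest)
  finally show ?thesis
    using energy_dirichlet[of L "unit_field x"] dirichlet_unit_field[OF assms, of "unit_field x"] by simp
qed

text \<open>Single-site blocks (\<open>r = 0\<close>) and the unit field, of energy
  \<open>e\<close>. With \<open>q = sqrt (ln n)\<close> and trial height
  \<open>q / (4 * sqrt e)\<close> the tilting exponent is \<open>q\<^sup>2 / 4 + 2 * q\<close>, so
  \<kappa> decays only like \<open>n\<close> to the power -1/4, up to smaller corrections, and
  multiplied by the square of \<open>n\<close> it exceeds the logarithmic bound that low heights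
  would impose.\<close>

theorem entropic_repulsion:
  "\<exists>c>0. \<exists>n0. \<forall>n\<ge>n0. \<forall>L\<ge>2 * n + 1. \<exists>k\<in>cube n. c * sqrt (ln (real n)) \<le> mean_height L (cube n :: (int ^ 'd::finite) set) k"
proof -
  let ?deg = "real (lattice_degree TYPE('d))"
  let ?d = "real CARD('d)"
  define e where "e = ?deg / (4 * ?d)"
  have deg: "?deg > 0" using lattice_degree_pos[where 'd = 'd] by simp
  have e: "e > 0" using deg by (simp add: e_def)
  have "\<forall>\<^sub>F n in sequentially. 4 * ln (real n) + 32 * sqrt (ln (real n)) < exp (- ln (real n) / 4 - 2 * sqrt (ln (real n))) * (real n)\<^sup>2"
    by real_asymp
  then obtain n1 where n1: "\<And>n. n \<ge> n1 \<Longrightarrow> 4 * ln (real n) + 32 * sqrt (ln (real n)) < exp (- ln (real n) / 4 - 2 * sqrt (ln (real n))) * (real n)\<^sup>2"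
    by (auto simp: eventually_sequentially)
  show ?thesis
  proof (intro exI conjI allI impI)
    show "1 / (4 * sqrt e) > 0" using e by simp
    fix n L :: nat assume n: "max n1 2 \<le> n" and L: "2 * n + 1 \<le> L"
    show "\<exists>k\<in>cube n. 1 / (4 * sqrt e) * sqrt (ln (real n)) \<le> mean_height L (cube n :: (int ^ 'd) set) k"
    proof (rule ccontr)
      assume low: "\<not> ?thesis"
      define q where "q = sqrt (ln (real n))"
      have ln_pos: "0 < ln (real n)" using n by simp
      have q: "q > 0" "q\<^sup>2 = ln (real n)" using ln_pos by (simp_all add: q_def)
      define h where "h = q / (4 * sqrt e)"
      have h: "h > 0" using q e by (simp add: h_def)
      have D: "cube n \<subseteq> (\<Lambda> L :: (int ^ 'd) set)" using L by (rule cube_subset_\<Lambda>)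
      have le_h: "mean_height L (cube n) k \<le> h" for k :: "int ^ 'd"
      proof (cases "k \<in> cube n")
        case True
        then show ?thesis using low by (auto simp: h_def q_def not_le less_imp_le)
      next
        case False
        then show ?thesis using mean_height_outside[OF D False] h by simp
      qed
      have "0 \<in> (\<Lambda> L :: (int ^ 'd) set)" using D zero_in_cube by blast
      then have energy_0: "energy L (unit_field (0 :: int ^ 'd)) = e" by (simp add: energy_unit_field e_def)
      \<comment> \<open>With \<open>C = 1 / e\<close> the tail exponent is
        \<open>(q / 2 + 4)\<^sup>2 = q\<^sup>2 / 4 + 4 * q + 16\<close>, which beats that of
        \<kappa> by at least 16 and so yields the factor \<open>1 / 8\<close>.\<close>
      define t where "t = (q / 2 + 4) / sqrt e"
      have t: "t > 0" using q e by (simp add: t_def add_pos_pos)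
      have he: "h * sqrt e = q / 4" "h\<^sup>2 * e = q\<^sup>2 / 16"
        using e by (simp_all add: h_def power_divide power_mult_distrib)
      have te: "t\<^sup>2 / (1 / e) = (q / 2 + 4)\<^sup>2"
        using e by (simp add: t_def power_divide)
      define \<kappa> where "\<kappa> = exp (- q\<^sup>2 / 4 - 2 * q)"
      have "\<kappa> / (8 * t) * (?d / ?deg) * (real n)\<^sup>2 \<le> real ((2 * 0 + 1) ^ CARD('d)) * h"
      proof (rule mean_height_lower_bound[where L = L and n = n and f = "unit_field (0 :: int ^ 'd)" and C = "1 / e"])
        show "unit_field (0 :: int ^ 'd) i = 0" if "i \<notin> cube 0" for i using that zero_in_cube[of 0] by auto
        have "- (2 * h)\<^sup>2 * e - 4 * (2 * h) * sqrt e = - 4 * (h\<^sup>2 * e) - 8 * (h * sqrt e)"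
          by (simp add: power_mult_distrib)
        also have "\<dots> = - q\<^sup>2 / 4 - 2 * q" unfolding he by simp
        finally show "\<kappa> \<le> exp (- (2 * h)\<^sup>2 * energy L (unit_field (0 :: int ^ 'd)) - 4 * (2 * h) * sqrt (energy L (unit_field (0 :: int ^ 'd))))"
          by (simp add: energy_0 \<kappa>_def)
        have "exp (- ((q / 2 + 4)\<^sup>2)) = exp (- q\<^sup>2 / 4 - 4 * q) * exp (- 16)"
          unfolding exp_add[symmetric] by (rule arg_cong[where f = exp]) (simp add: power2_eq_square algebra_simps)
        also have "\<dots> \<le> \<kappa> * (1 / 8)"
        proof (rule mult_mono)
          have "(8::real) \<le> exp 16" using exp_ge_add_one_self[of "16 :: real"] by simp
          then show "exp (- 16 :: real) \<le> 1 / 8" by (simp add: exp_minus field_simps)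
        qed (use q in \<open>auto simp: \<kappa>_def\<close>)
        finally show "real ((2 * 0 + 1) ^ CARD('d)) * exp (- (t\<^sup>2 / (1 / e))) \<le> \<kappa> / 8"
          unfolding te by simp
      next
        fix k :: "int ^ 'd" and g :: "int ^ 'd \<Rightarrow> real"
        assume g: "\<And>i. i \<notin> \<Lambda> L \<Longrightarrow> g i = 0" "\<exists>x. \<forall>i. i \<notin> (+) x ` cube 0 \<longrightarrow> g i = 0"
        have c0: "cube 0 = {0 :: int ^ 'd}" by (auto simp: cube_def vec_eq_iff)
        obtain x where "\<And>i. i \<notin> (+) x ` cube 0 \<Longrightarrow> g i = 0" using g(2) by blast
        then have x: "g i = 0" if "i \<noteq> x" for i using that by (auto simp: c0)
        show "(g k)\<^sup>2 \<le> 1 / e * energy L g"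
        proof (cases "k = x \<and> x \<in> \<Lambda> L")
          case True
          have "g = (\<lambda>i. g x * unit_field x i)" using x by (auto simp: fun_eq_iff)
          then have "energy L g = (g x)\<^sup>2 * energy L (unit_field x)"
            using energy_scale[of L "g x" "unit_field x"] by simp
          then show ?thesis using True e by (simp add: energy_unit_field e_def[symmetric])
        next
          case False
          then have "g k = 0" using g(1) x by metis
          then show ?thesis using e energy_nonneg[of L g] by simp
        qed
      qed (use L h t e le_h in \<open>auto simp: \<kappa>_def\<close>)
      then have "\<kappa> / (8 * t) * (?d / ?deg) * (real n)\<^sup>2 \<le> h" by simp
      then have "\<kappa> * (real n)\<^sup>2 \<le> h * t * (8 * ?deg / ?d)"
        using t deg by (simp add: field_simps)
      also have "h * t = q * (q / 2 + 4) / (4 * e)"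
        using e by (simp add: h_def t_def)
      also have "q * (q / 2 + 4) / (4 * e) * (8 * ?deg / ?d) = 4 * q\<^sup>2 + 32 * q"
        using deg by (simp add: e_def power2_eq_square field_simps)
      finally show False
        using n1[of n] n q by (simp add: \<kappa>_def q_def)
    qed
  qed
qed

text \<open>Blocks of radius \<open>r\<close> in a cube of radius \<open>r\<^sup>2\<close>. At trial
  height \<open>l / (8 * sqrt deg)\<close> the profile makes the tilting exponent at most
  \<open>l / 2 + 4\<close>, so \<kappa> is of order \<open>r\<close> to the power -1/2. Up to
  logarithms the paraboloid then forces a block sum of order \<open>r\<close> to the power 7/2, more
  than low heights on order \<open>r\<^sup>2\<close> sites allow.\<close>

theorem entropic_repulsion_planar:
  assumes card: "CARD('d::finite) = 2"
  shows "\<exists>c>0. \<exists>r0. \<forall>r\<ge>r0. \<forall>L\<ge>2 * r\<^sup>2 + 1. \<exists>k\<in>cube (r\<^sup>2). c * ln (real r) \<le> mean_height L (cube (r\<^sup>2) :: (int ^ 'd) set) k"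
proof -
  let ?deg = "real (lattice_degree TYPE('d))"
  let ?l = "\<lambda>r::nat. ln (1 + real r)"
  let ?\<kappa> = "\<lambda>r::nat. exp (- 4) / sqrt (1 + real r)"
  \<comment> \<open>Serves both as capacity bound and as depth: with \<open>C = t\<close> the tail
    is \<open>exp (- t)\<close>, at most \<open>4 * r + 2\<close> to the power -32, which pays for
    the number of block sites and for \<kappa>.\<close>
  let ?t = "\<lambda>r::nat. 32 * (1 + ln (real (4 * r + 2)))"
  have deg: "?deg > 0" using lattice_degree_pos[where 'd = 'd] by simp
  have "\<forall>\<^sub>F r in sequentially. (2 * real r + 1)\<^sup>2 * exp (- (32 * (1 + ln (4 * real r + 2)))) \<le> exp (- 4) / sqrt (1 + real r) / 8"
    by real_asymp
  then have "\<forall>\<^sub>F r in sequentially. (2 * real r + 1)\<^sup>2 * exp (- (?t r)) \<le> ?\<kappa> r / 8"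
    by (simp add: add.commute)
  then obtain r1 where r1: "\<And>r. r \<ge> r1 \<Longrightarrow> (2 * real r + 1)\<^sup>2 * exp (- (?t r)) \<le> ?\<kappa> r / 8"
    unfolding eventually_sequentially by blast
  have "filterlim (\<lambda>r::nat. exp (- 4) / sqrt (1 + real r) * 2 * ((real r)\<^sup>2 - real r)\<^sup>2 /
      ((2 * real r + 1)\<^sup>2 * ln (1 + real r) * (32 * (1 + ln (4 * real r + 2))))) at_top at_top"
    by real_asymp
  then have "\<forall>\<^sub>F r in sequentially. sqrt ?deg < ?\<kappa> r * 2 * ((real r)\<^sup>2 - real r)\<^sup>2 / ((2 * real r + 1)\<^sup>2 * ?l r * ?t r)"
    by (simp add: filterlim_at_top_dense add.commute)
  then obtain r2 where r2: "\<And>r. r \<ge> r2 \<Longrightarrow> sqrt ?deg < ?\<kappa> r * 2 * ((real r)\<^sup>2 - real r)\<^sup>2 / ((2 * real r + 1)\<^sup>2 * ?l r * ?t r)"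
    by (auto simp: eventually_sequentially)
  show ?thesis
  proof (intro exI conjI allI impI)
    show "1 / (8 * sqrt ?deg) > 0" using deg by simp
    fix r L :: nat assume r: "max 2 (max r1 r2) \<le> r" and L: "2 * r\<^sup>2 + 1 \<le> L"
    show "\<exists>k\<in>cube (r\<^sup>2). 1 / (8 * sqrt ?deg) * ln (real r) \<le> mean_height L (cube (r\<^sup>2) :: (int ^ 'd) set) k"
    proof (rule ccontr)
      assume low: "\<not> ?thesis"
      define l where "l = ?l r"
      have l: "l > 0" using r by (simp add: l_def)
      define h where "h = l / (8 * sqrt ?deg)"
      have h: "h > 0" using l deg by (simp add: h_def)
      have ln_le: "ln (real r) \<le> l" using r by (simp add: l_def)
      have D: "cube (r\<^sup>2) \<subseteq> (\<Lambda> L :: (int ^ 'd) set)" using L by (rule cube_subset_\<Lambda>)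
      have le_h: "mean_height L (cube (r\<^sup>2)) k \<le> h" for k :: "int ^ 'd"
      proof (cases "k \<in> cube (r\<^sup>2)")
        case True
        then have "mean_height L (cube (r\<^sup>2)) k < 1 / (8 * sqrt ?deg) * ln (real r)"
          using low by (auto simp: not_le)
        also have "\<dots> \<le> 1 / (8 * sqrt ?deg) * l" using ln_le by (intro mult_left_mono) auto
        finally show ?thesis by (simp add: h_def)
      next
        case False
        then show ?thesis using mean_height_outside[OF D False] h by simp
      qed
      define E where "E = energy L (log_profile r :: int ^ 'd \<Rightarrow> real)"
      have E: "0 \<le> E" "E \<le> 4 * ?deg / l"
        using energy_nonneg energy_log_profile[OF card, of r L] r by (simp_all add: E_def l_def)
      define \<kappa> where "\<kappa> = ?\<kappa> r"
      define t where "t = ?t r"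
      have ln_nonneg: "0 \<le> ln (real (4 * r + 2))" by (intro ln_ge_zero) simp
      have t: "t > 0" unfolding t_def by (intro mult_pos_pos add_pos_nonneg ln_nonneg) auto
      have m: "real (r\<^sup>2 - r) = (real r)\<^sup>2 - real r"
        by (simp add: of_nat_diff power2_eq_square)
      have "\<kappa> / (8 * t) * (real CARD('d) / ?deg) * (real (r\<^sup>2 - r))\<^sup>2 \<le> real ((2 * r + 1) ^ CARD('d)) * h"
      proof (rule mean_height_lower_bound[where L = L and n = "r\<^sup>2" and f = "log_profile r :: int ^ 'd \<Rightarrow> real" and C = t])
        show "log_profile r i = 0" if "i \<notin> cube r" for i :: "int ^ 'd"
          using log_profile_props(2)[of r i] r that by simp
        show "log_profile r (0 :: int ^ 'd) = 1" using log_profile_props(1)[of r] r by simp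
        show "r + (r\<^sup>2 - r) \<le> r\<^sup>2" by (simp add: power2_eq_square)
        show "\<kappa> \<le> exp (- (2 * h)\<^sup>2 * energy L (log_profile r :: int ^ 'd \<Rightarrow> real) - 4 * (2 * h) * sqrt (energy L (log_profile r :: int ^ 'd \<Rightarrow> real)))"
        proof -
          have "(2 * h)\<^sup>2 * E \<le> (2 * h)\<^sup>2 * (4 * ?deg / l)" using E by (intro mult_left_mono) auto
          also have "\<dots> = l / 4" using l deg by (simp add: h_def power_divide power_mult_distrib power2_eq_square)
          finally have 1: "(2 * h)\<^sup>2 * E \<le> l / 4" .
          have "4 * (2 * h) * sqrt E \<le> 4 * (2 * h) * sqrt (4 * ?deg / l)"
            using E h by (intro mult_left_mono) auto
          also have "\<dots> = 2 * sqrt l"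
            using l deg real_div_sqrt[of l] by (simp add: h_def real_sqrt_divide real_sqrt_mult field_simps)
          finally have 2: "4 * (2 * h) * sqrt E \<le> 2 * sqrt l" .
          \<comment> \<open>The square root term of the tilting cost is absorbed into
            \<open>l / 4 + 4\<close>; this is the origin of \<open>exp (- 4)\<close> in
            \<kappa>.\<close>
          have "0 \<le> (sqrt l / 2 - 2)\<^sup>2" by simp
          then have "2 * sqrt l \<le> l / 4 + 4" using l by (simp add: power2_diff power_divide)
          then have "exp (- 4 + - (l / 2)) \<le> exp (- (2 * h)\<^sup>2 * E - 4 * (2 * h) * sqrt E)"
            using 1 2 by simp
          moreover have exp_l: "exp (- (l / 2)) = 1 / sqrt (1 + real r)"
          proof -
            have "exp (l / 2) = sqrt (exp l)"
              by (rule real_sqrt_unique[symmetric]) (simp_all add: exp_double[symmetric])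
            then show ?thesis by (simp add: exp_minus l_def inverse_eq_divide)
          qed
          moreover have "\<kappa> = exp (- 4 + - (l / 2))"
            unfolding exp_add exp_l by (simp add: \<kappa>_def)
          ultimately show ?thesis by (simp only: E_def)
        qed
        have "t\<^sup>2 / t = t" using t by (simp add: power2_eq_square)
        then show "real ((2 * r + 1) ^ CARD('d)) * exp (- (t\<^sup>2 / t)) \<le> \<kappa> / 8"
          using r1[of r] r by (simp add: card \<kappa>_def t_def add.commute)
      next
        fix k :: "int ^ 'd" and g :: "int ^ 'd \<Rightarrow> real"
        assume g: "\<And>i. i \<notin> \<Lambda> L \<Longrightarrow> g i = 0" "\<exists>x. \<forall>i. i \<notin> (+) x ` cube r \<longrightarrow> g i = 0"
        then obtain x where "\<And>i. i \<notin> (+) x ` cube r \<Longrightarrow> g i = 0" by blast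
        then show "(g k)\<^sup>2 \<le> t * energy L g"
          unfolding t_def using g(1) planar_capacity[where f = g and z = x and r = r and k = k and L = L, OF card] by blast
      qed (use L h t le_h in \<open>auto simp: \<kappa>_def\<close>)
      then have "\<kappa> / (8 * t) * (2 / ?deg) * ((real r)\<^sup>2 - real r)\<^sup>2 \<le> (2 * real r + 1)\<^sup>2 * (l / (8 * sqrt ?deg))"
        unfolding m by (simp add: card h_def add.commute)
      then have "\<kappa> * 2 * ((real r)\<^sup>2 - real r)\<^sup>2 * sqrt ?deg \<le> (2 * real r + 1)\<^sup>2 * l * t * ?deg"
        using t deg by (simp add: field_simps)
      also have "\<dots> = (2 * real r + 1)\<^sup>2 * l * t * sqrt ?deg * sqrt ?deg" using deg by simp
      finally have "\<kappa> * 2 * ((real r)\<^sup>2 - real r)\<^sup>2 \<le> (2 * real r + 1)\<^sup>2 * l * t * sqrt ?deg"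
        using deg by simp
      moreover have pos: "(2 * real r + 1)\<^sup>2 * l * t > 0" using l t by (intro mult_pos_pos) auto
      ultimately have "\<kappa> * 2 * ((real r)\<^sup>2 - real r)\<^sup>2 / ((2 * real r + 1)\<^sup>2 * l * t) \<le> sqrt ?deg"
        by (simp add: pos_divide_le_eq mult.commute)
      then show False using r2[of r] r by (simp add: \<kappa>_def l_def t_def)
    qed
  qed
qed

subsection \<open>The pinned measure\<close>

lemma site_family_site_measure: "site_family (site_measure \<eta> L :: int ^ 'd \<Rightarrow> real measure)"
  using sigma_finite_pinned_lebesgue
  by (auto simp: site_family_def site_measure_def prob_space_return prob_space_imp_sigma_finite)

lemma energy_zero_ext: "energy L (zero_ext (\<Lambda>_bar L) \<phi>) = energy L (\<phi> :: int ^ 'd \<Rightarrow> real)"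
  unfolding energy_eq by (intro arg_cong[where f = "(*) _"] sum.cong) (auto simp: bonds_def zero_ext_def)

lemma measurable_energy_PiM:
  "energy L \<in> borel_measurable (Pi\<^sub>M (\<Lambda>_bar L) (site_measure \<eta> L :: int ^ 'd \<Rightarrow> real measure))"
proof -
  have "(\<lambda>\<phi>. energy L (zero_ext (\<Lambda>_bar L) \<phi>)) \<in> borel_measurable (Pi\<^sub>M (\<Lambda>_bar L) (site_measure \<eta> L :: int ^ 'd \<Rightarrow> real measure))"
    by (rule measurable_compose[OF measurable_zero_ext[OF site_family_site_measure] measurable_energy])
  then show ?thesis by (simp only: energy_zero_ext)
qed

lemma sets_gibbs_weight [simp]:
  "sets (gibbs_weight \<eta> L :: (int ^ 'd \<Rightarrow> real) measure) = sets (Pi\<^sub>M (\<Lambda>_bar L) (site_measure \<eta> L))"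
  "space (gibbs_weight \<eta> L :: (int ^ 'd \<Rightarrow> real) measure) = space (Pi\<^sub>M (\<Lambda>_bar L) (site_measure \<eta> L))"
  by (simp_all add: gibbs_weight_def)

text \<open>Passage from extensional product fields on \<open>\<Lambda>_bar L\<close> to
  zero-extended fields on \<open>\<Lambda> L\<close>: the energy reads no site outside
  \<open>\<Lambda>_bar L\<close>, and the Dirac sites of the boundary layer drop out.\<close>

lemma nn_integral_gibbs_weight:
  fixes G :: "(int ^ 'd \<Rightarrow> real) \<Rightarrow> ennreal"
  assumes [measurable]: "G \<in> borel_measurable fields"
  shows "(\<integral>\<^sup>+\<phi>. G (zero_ext (\<Lambda>_bar L) \<phi>) \<partial>gibbs_weight \<eta> L) =
    (\<integral>\<^sup>+\<phi>. G \<phi> * boltzmann L \<phi> \<partial>field_measure (\<lambda>_. pinned_lebesgue \<eta>) (\<Lambda> L))"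
proof -
  let ?M = "site_measure \<eta> L :: int ^ 'd \<Rightarrow> real measure"
  note M = site_family_site_measure[of \<eta> L, where 'd = 'd]
  note [measurable] = measurable_energy_PiM measurable_zero_ext[OF M]
  have "(\<integral>\<^sup>+\<phi>. G (zero_ext (\<Lambda>_bar L) \<phi>) \<partial>gibbs_weight \<eta> L) =
    (\<integral>\<^sup>+\<phi>. ennreal (exp (- energy L \<phi>)) * G (zero_ext (\<Lambda>_bar L) \<phi>) \<partial>Pi\<^sub>M (\<Lambda>_bar L) ?M)"
    unfolding gibbs_weight_def by (rule nn_integral_density) measurable
  also have "\<dots> = (\<integral>\<^sup>+\<phi>. G \<phi> * boltzmann L \<phi> \<partial>field_measure ?M (\<Lambda>_bar L))"
    by (subst nn_integral_field_measure[OF M]) (auto simp: energy_zero_ext boltzmann_def mult.commute)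
  also have "field_measure ?M (\<Lambda>_bar L) = field_measure ?M (\<Lambda> L \<union> (\<Lambda>_bar L - \<Lambda> L))"
    using \<Lambda>_subset_\<Lambda>_bar[of L, where 'a = 'd] by (simp add: Un_absorb1)
  also have "(\<integral>\<^sup>+\<phi>. G \<phi> * boltzmann L \<phi> \<partial>field_measure ?M (\<Lambda> L \<union> (\<Lambda>_bar L - \<Lambda> L))) =
      (\<integral>\<^sup>+\<phi>. G \<phi> * boltzmann L \<phi> \<partial>field_measure ?M (\<Lambda> L))"
    by (rule nn_integral_field_measure_return[OF M]) (auto simp: finite_\<Lambda>_bar site_measure_def)
  also have "field_measure ?M (\<Lambda> L) = field_measure (\<lambda>_. pinned_lebesgue \<eta>) (\<Lambda> L)"
    by (rule field_measure_cong) (simp add: site_measure_def)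
  finally show ?thesis .
qed

abbreviation box_integral :: "nat \<Rightarrow> real \<Rightarrow> ((int ^ 'd \<Rightarrow> real) \<Rightarrow> ennreal) \<Rightarrow> ennreal" where
  "box_integral L \<eta> \<equiv> plus_integral L \<eta> (\<Lambda> L) {}"

text \<open>The event \<open>\<Omega>_plus\<close> over the unnormalised measure. Its mass is
  computed first and shows that the normalising constant is positive.\<close>

definition plus_event :: "real \<Rightarrow> nat \<Rightarrow> (int ^ 'd \<Rightarrow> real) set" where
  "plus_event \<eta> L = {\<phi> \<in> space (gibbs_weight \<eta> L). \<forall>i\<in>\<Lambda> L. \<phi> i \<ge> 0}"

lemma measurable_gibbs_component:
  assumes "i \<in> \<Lambda>_bar L"
  shows "(\<lambda>\<phi>. \<phi> i) \<in> borel_measurable (gibbs_weight \<eta> L :: (int ^ 'd \<Rightarrow> real) measure)"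
proof -
  have "(\<lambda>\<phi>. \<phi> i) \<in> measurable (Pi\<^sub>M (\<Lambda>_bar L) (site_measure \<eta> L)) (site_measure \<eta> L i)"
    using assms by (rule measurable_component_singleton)
  then show ?thesis
    by (simp add: measurable_site_family(2)[OF site_family_site_measure] measurable_cong_sets[OF sets_gibbs_weight(1) refl])
qed

lemma plus_event_sets: "plus_event \<eta> L \<in> sets (gibbs_weight \<eta> L :: (int ^ 'd \<Rightarrow> real) measure)"
  unfolding plus_event_def
proof (rule sets.sets_Collect_finite_All[OF _ finite_\<Lambda>])
  fix i :: "int ^ 'd" assume "i \<in> \<Lambda> L"
  then have "i \<in> \<Lambda>_bar L" using \<Lambda>_subset_\<Lambda>_bar by blast
  then show "{\<phi> \<in> space (gibbs_weight \<eta> L). 0 \<le> \<phi> i} \<in> sets (gibbs_weight \<eta> L)"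
    by (intro borel_measurable_le measurable_gibbs_component) auto
qed

lemma nn_integral_plus_event:
  fixes G :: "(int ^ 'd \<Rightarrow> real) \<Rightarrow> ennreal"
  assumes [measurable]: "G \<in> borel_measurable fields"
  shows "(\<integral>\<^sup>+\<phi>. G (zero_ext (\<Lambda>_bar L) \<phi>) * indicator (plus_event \<eta> L) \<phi> \<partial>gibbs_weight \<eta> L) = box_integral L \<eta> G"
proof -
  note [measurable] = measurable_positive_on[OF finite_\<Lambda>[of L] finite.emptyI]
  have "(\<integral>\<^sup>+\<phi>. G (zero_ext (\<Lambda>_bar L) \<phi>) * indicator (plus_event \<eta> L) \<phi> \<partial>gibbs_weight \<eta> L) =
    (\<integral>\<^sup>+\<phi>. G (zero_ext (\<Lambda>_bar L) \<phi>) * indicator (positive_on (\<Lambda> L) {}) (zero_ext (\<Lambda>_bar L) \<phi>) \<partial>gibbs_weight \<eta> L)"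
  proof (rule nn_integral_cong)
    fix \<phi> :: "int ^ 'd \<Rightarrow> real" assume "\<phi> \<in> space (gibbs_weight \<eta> L)"
    then have "\<phi> \<in> plus_event \<eta> L \<longleftrightarrow> zero_ext (\<Lambda>_bar L) \<phi> \<in> positive_on (\<Lambda> L) {}"
      using \<Lambda>_subset_\<Lambda>_bar[of L] by (auto simp: plus_event_def positive_on_def zero_ext_def subset_iff)
    then show "G (zero_ext (\<Lambda>_bar L) \<phi>) * indicator (plus_event \<eta> L) \<phi> =
      G (zero_ext (\<Lambda>_bar L) \<phi>) * indicator (positive_on (\<Lambda> L) {}) (zero_ext (\<Lambda>_bar L) \<phi>)"
      by (simp add: indicator_def)
  qed
  also have "\<dots> = (\<integral>\<^sup>+\<phi>. G \<phi> * indicator (positive_on (\<Lambda> L) {}) \<phi> * boltzmann L \<phi> \<partial>field_measure (\<lambda>_. pinned_lebesgue \<eta>) (\<Lambda> L))"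
    by (rule nn_integral_gibbs_weight) measurable
  finally show ?thesis by (simp add: plus_integral_def mult.assoc)
qed

lemma emeasure_plus_event:
  "emeasure (gibbs_weight \<eta> L :: (int ^ 'd \<Rightarrow> real) measure) (plus_event \<eta> L) = box_integral L \<eta> (\<lambda>_::int ^ 'd \<Rightarrow> real. 1)"
  using nn_integral_plus_event[where G = "\<lambda>_::int ^ 'd \<Rightarrow> real. 1" and L = L and \<eta> = \<eta>] plus_event_sets[of \<eta> L, where 'd = 'd] by simp

lemma emeasure_gibbs_weight_space:
  fixes \<eta> :: real and L :: nat
  defines "Z \<equiv> emeasure (gibbs_weight \<eta> L) (space (gibbs_weight \<eta> L :: (int ^ 'd \<Rightarrow> real) measure))"
  shows "Z < \<infinity>" "Z > 0" "Z = ennreal (Z0 TYPE('d) \<eta> L)"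
proof -
  have "Z = (\<integral>\<^sup>+\<phi>. 1 \<partial>(gibbs_weight \<eta> L :: (int ^ 'd \<Rightarrow> real) measure))" by (simp add: Z_def)
  also have "\<dots> = (\<integral>\<^sup>+\<phi>. 1 * boltzmann L \<phi> \<partial>field_measure (\<lambda>_. pinned_lebesgue \<eta>) (\<Lambda> L :: (int ^ 'd) set))"
    by (rule nn_integral_gibbs_weight) measurable
  also have "\<dots> < \<infinity>"
    using nn_integral_boltzmann_finite[OF site_family_pinned order_refl _ nn_integral_gaussian_pinned_finite, of 1 \<eta> L]
    by (simp add: boltzmann_def)
  finally show Z: "Z < \<infinity>" .
  have "0 < emeasure (gibbs_weight \<eta> L :: (int ^ 'd \<Rightarrow> real) measure) (plus_event \<eta> L)"
    unfolding emeasure_plus_event by (rule plus_integral_pos) auto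
  also have "\<dots> \<le> Z" unfolding Z_def by (rule emeasure_space)
  finally show "Z > 0" .
  show "Z = ennreal (Z0 TYPE('d) \<eta> L)"
    using Z by (simp add: Z_def Z0_def measure_def)
qed

lemma Z0_pos: "Z0 TYPE('d::finite) \<eta> L > 0"
  using emeasure_gibbs_weight_space(2,3)[of \<eta> L, where 'd = 'd] by simp

lemma \<Omega>_plus_eq: "\<Omega>_plus \<eta> L = plus_event \<eta> L"
  by (simp add: \<Omega>_plus_def plus_event_def \<mu>0_def space_scale_measure)

lemma box_integral_finite:
  "box_integral L \<eta> (\<lambda>_::int ^ 'd \<Rightarrow> real. 1) < \<infinity>" "box_integral L \<eta> (\<lambda>\<phi>. ennreal (\<phi> (k :: int ^ 'd))) < \<infinity>"
  by (rule plus_integral_finite; simp)+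

lemma box_integral_pos: "0 < box_integral L \<eta> (\<lambda>_::int ^ 'd \<Rightarrow> real. 1)"
  by (rule plus_integral_pos) auto

lemma emeasure_\<Omega>_plus:
  "emeasure (\<mu>0 \<eta> L) (\<Omega>_plus \<eta> L :: (int ^ 'd \<Rightarrow> real) set) =
    ennreal (1 / Z0 TYPE('d) \<eta> L) * box_integral L \<eta> (\<lambda>_::int ^ 'd \<Rightarrow> real. 1)"
  unfolding \<Omega>_plus_eq by (simp add: \<mu>0_def emeasure_plus_event)

lemma Z_plus_eq: "Z_plus TYPE('d::finite) \<eta> L = enn2real (box_integral L \<eta> (\<lambda>_::int ^ 'd \<Rightarrow> real. 1))"
  using Z0_pos[of \<eta> L, where 'd = 'd]
  by (simp add: Z_plus_def measure_def emeasure_\<Omega>_plus enn2real_mult)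

lemma Z_plus_pos: "Z_plus TYPE('d::finite) \<eta> L > 0"
  using box_integral_pos[of L \<eta>, where 'd = 'd] box_integral_finite(1)[of L \<eta>, where 'd = 'd]
  by (simp add: Z_plus_eq enn2real_positive_iff)

text \<open>The factor \<open>1 / Z0\<close> occurs in the numerator and in the probability of the
  conditioning event, and cancels. \<open>L \<ge> 1\<close> places the origin in the box, so the
  height is almost surely nonnegative and the Bochner integral is an extended one.\<close>

lemma expectation_height:
  assumes L: "L \<ge> 1"
  shows "(\<integral>\<phi>. \<phi> (0 :: int ^ 'd::finite) \<partial>\<mu>_plus \<eta> L) =
    enn2real (box_integral L \<eta> (\<lambda>\<phi>. ennreal (\<phi> (0 :: int ^ 'd)))) / Z_plus TYPE('d) \<eta> L"
proof -
  let ?g = "gibbs_weight \<eta> L :: (int ^ 'd \<Rightarrow> real) measure"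
  let ?c = "1 / Z0 TYPE('d) \<eta> L"
  have c: "?c > 0" using Z0_pos[of \<eta> L, where 'd = 'd] by simp
  have "cube 0 \<subseteq> (\<Lambda> L :: (int ^ 'd) set)" using L by (intro cube_subset_\<Lambda>) simp
  then have 0: "0 \<in> (\<Lambda> L :: (int ^ 'd) set)" "0 \<in> (\<Lambda>_bar L :: (int ^ 'd) set)"
    using \<Lambda>_subset_\<Lambda>_bar zero_in_cube by blast+
  have sets: "sets (\<mu>0 \<eta> L) = sets ?g" by (simp add: \<mu>0_def)
  have ev: "\<Omega>_plus \<eta> L \<in> sets (\<mu>0 \<eta> L :: (int ^ 'd \<Rightarrow> real) measure)"
    using plus_event_sets[of \<eta> L, where 'd = 'd] by (simp add: \<Omega>_plus_eq \<mu>0_def)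
  have m: "(\<lambda>\<phi>. \<phi> (0 :: int ^ 'd)) \<in> borel_measurable ?g" by (rule measurable_gibbs_component[OF 0(2)])
  then have m0: "(\<lambda>\<phi>. \<phi> (0 :: int ^ 'd)) \<in> borel_measurable (\<mu>0 \<eta> L :: (int ^ 'd \<Rightarrow> real) measure)"
    by (simp cong: measurable_cong_sets[OF sets refl])
  then have mp: "(\<lambda>\<phi>. \<phi> (0 :: int ^ 'd)) \<in> borel_measurable (\<mu>_plus \<eta> L :: (int ^ 'd \<Rightarrow> real) measure)"
    by (simp add: \<mu>_plus_def)
  have "AE \<phi> in \<mu>_plus \<eta> L. 0 \<le> \<phi> (0 :: int ^ 'd)"
    unfolding \<mu>_plus_def by (rule AE_uniform_measureI[OF ev]) (use 0 in \<open>auto simp: \<Omega>_plus_def\<close>)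
  then have "(\<integral>\<phi>. \<phi> (0 :: int ^ 'd) \<partial>\<mu>_plus \<eta> L) = enn2real (\<integral>\<^sup>+\<phi>. ennreal (\<phi> (0 :: int ^ 'd)) \<partial>\<mu>_plus \<eta> L)"
    using mp by (intro integral_eq_nn_integral) auto
  also have "(\<integral>\<^sup>+\<phi>. ennreal (\<phi> (0 :: int ^ 'd)) \<partial>\<mu>_plus \<eta> L) =
      (\<integral>\<^sup>+\<phi>. ennreal (\<phi> (0 :: int ^ 'd)) * indicator (\<Omega>_plus \<eta> L) \<phi> \<partial>\<mu>0 \<eta> L) / emeasure (\<mu>0 \<eta> L) (\<Omega>_plus \<eta> L :: (int ^ 'd \<Rightarrow> real) set)"
    unfolding \<mu>_plus_def using m0 ev by (intro nn_integral_uniform_measure) auto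
  also have "(\<integral>\<^sup>+\<phi>. ennreal (\<phi> (0 :: int ^ 'd)) * indicator (\<Omega>_plus \<eta> L) \<phi> \<partial>\<mu>0 \<eta> L) =
      ennreal ?c * (\<integral>\<^sup>+\<phi>. ennreal (\<phi> (0 :: int ^ 'd)) * indicator (plus_event \<eta> L) \<phi> \<partial>?g)"
    unfolding \<mu>0_def \<Omega>_plus_eq
    by (intro nn_integral_scale_measure borel_measurable_times_ennreal borel_measurable_indicator
      plus_event_sets measurable_compose[OF m measurable_ennreal])
  also have "(\<integral>\<^sup>+\<phi>. ennreal (\<phi> (0 :: int ^ 'd)) * indicator (plus_event \<eta> L) \<phi> \<partial>?g) = box_integral L \<eta> (\<lambda>\<phi>. ennreal (\<phi> (0 :: int ^ 'd)))"
    using nn_integral_plus_event[where G = "\<lambda>\<phi>. ennreal (\<phi> (0 :: int ^ 'd))" and L = L and \<eta> = \<eta>] 0 by (simp add: zero_ext_def)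
  finally have eq: "(\<integral>\<phi>. \<phi> (0 :: int ^ 'd) \<partial>\<mu>_plus \<eta> L) = enn2real (ennreal ?c * box_integral L \<eta> (\<lambda>\<phi>. ennreal (\<phi> (0 :: int ^ 'd))) /
      (ennreal ?c * box_integral L \<eta> (\<lambda>_::int ^ 'd \<Rightarrow> real. 1)))"
    unfolding emeasure_\<Omega>_plus .
  define p where "p = enn2real (box_integral L \<eta> (\<lambda>\<phi>. ennreal (\<phi> (0 :: int ^ 'd))))"
  define q where "q = Z_plus TYPE('d) \<eta> L"
  have p: "box_integral L \<eta> (\<lambda>\<phi>. ennreal (\<phi> (0 :: int ^ 'd))) = ennreal p" "p \<ge> 0"
    using box_integral_finite(2)[of L \<eta> "0 :: int ^ 'd"] by (simp_all add: p_def)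
  have q: "box_integral L \<eta> (\<lambda>_::int ^ 'd \<Rightarrow> real. 1) = ennreal q" "q > 0"
    using box_integral_finite(1)[of L \<eta>, where 'd = 'd] Z_plus_pos[of \<eta> L, where 'd = 'd]
    by (simp_all add: q_def Z_plus_eq)
  have "ennreal ?c * ennreal p / (ennreal ?c * ennreal q) = ennreal (?c * p / (?c * q))"
    using c p(2) q(2) by (simp only: ennreal_mult'[OF less_imp_le[OF c], symmetric])
      (rule divide_ennreal, auto)
  also have "?c * p / (?c * q) = p / q" using c by simp
  finally show ?thesis
    unfolding eq p(1) q(1) using p(2) q(2) by (simp add: p_def[symmetric] q_def[symmetric])
qed

subsection \<open>Changing the box\<close>

lemma measurable_indicator_positive_on:
  assumes "S \<subseteq> \<Lambda> L"
  shows "(\<lambda>\<phi>. indicator (positive_on (\<Lambda> L) S) \<phi> * boltzmann L \<phi>) \<in> borel_measurable (fields :: (int ^ 'd \<Rightarrow> real) measure)"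
proof -
  note [measurable] = measurable_positive_on[OF finite_\<Lambda> finite_subset[OF assms finite_\<Lambda>]]
  show ?thesis by measurable
qed

text \<open>A field vanishing off \<open>D\<close> has the same energy in every larger box, and the
  positivity constraint at the additional sites is trivially met.\<close>

lemma plus_integral_box:
  assumes "D \<subseteq> \<Lambda> L" "S \<subseteq> D" "L \<le> L'" and G: "G \<in> borel_measurable fields"
  shows "plus_integral L' \<eta> D S G = plus_integral L \<eta> D S G"
  unfolding plus_integral_def
proof (rule nn_integral_field_measure_cong[OF site_family_pinned])
  have "S \<subseteq> \<Lambda> L" "S \<subseteq> \<Lambda> L'" using assms \<Lambda>_mono[OF assms(3)] by blast+
  note [measurable] = measurable_indicator_positive_on[OF this(1)] measurable_indicator_positive_on[OF this(2)] G
  show "(\<lambda>\<phi>. G \<phi> * (indicator (positive_on (\<Lambda> L') S) \<phi> * boltzmann L' \<phi>)) \<in> borel_measurable fields"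
    "(\<lambda>\<phi>. G \<phi> * (indicator (positive_on (\<Lambda> L) S) \<phi> * boltzmann L \<phi>)) \<in> borel_measurable fields"
    by measurable
  fix \<phi> :: "int ^ 'a \<Rightarrow> real"
  assume \<phi>: "\<And>i. i \<notin> D \<Longrightarrow> \<phi> i = 0"
  have out: "\<phi> i = 0" if "i \<notin> \<Lambda> L" for i using \<phi>[of i] assms(1) that by blast
  have "energy L' \<phi> = energy L \<phi>" using out assms(3) by (rule energy_mono_box)
  moreover have "\<phi> \<in> positive_on (\<Lambda> L') S \<longleftrightarrow> \<phi> \<in> positive_on (\<Lambda> L) S"
    using out \<Lambda>_mono[OF assms(3)] unfolding positive_on_def by (auto simp: subset_iff)
  ultimately show "G \<phi> * (indicator (positive_on (\<Lambda> L') S) \<phi> * boltzmann L' \<phi>) =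
      G \<phi> * (indicator (positive_on (\<Lambda> L) S) \<phi> * boltzmann L \<phi>)"
    by (simp add: boltzmann_def indicator_def)
qed

lemma plus_integral_translate:
  fixes D S :: "(int ^ 'd) set"
  assumes D: "D \<subseteq> \<Lambda> L" "(+) j ` D \<subseteq> \<Lambda> L" and S: "S \<subseteq> D" and G: "G \<in> borel_measurable fields"
  shows "plus_integral L \<eta> ((+) j ` D) ((+) j ` S) G = plus_integral L \<eta> D S (\<lambda>\<phi>. G (\<lambda>i. \<phi> (i - j)))"
proof -
  have sub: "S \<subseteq> \<Lambda> L" "(+) j ` S \<subseteq> \<Lambda> L" using S D by blast+
  let ?w = "\<lambda>S \<phi>. indicator (positive_on (\<Lambda> L) S) \<phi> * boltzmann L \<phi>"
  have m: "(\<lambda>\<phi>. G \<phi> * ?w ((+) j ` S) \<phi>) \<in> borel_measurable fields"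
    using measurable_indicator_positive_on[OF sub(2)] G by measurable
  have fin: "finite D" using D(1) finite_\<Lambda> by (rule finite_subset)
  have "plus_integral L \<eta> ((+) j ` D) ((+) j ` S) G =
    (\<integral>\<^sup>+\<phi>. G (\<lambda>i. \<phi> (i - j)) * ?w ((+) j ` S) (\<lambda>i. \<phi> (i - j)) \<partial>field_measure (\<lambda>_. pinned_lebesgue \<eta>) D)"
    unfolding plus_integral_def
    using nn_integral_field_measure_reindex[OF site_family_pinned fin _ _ m, of "\<lambda>i. i - j" "(+) j"] by simp
  also have "\<dots> = plus_integral L \<eta> D S (\<lambda>\<phi>. G (\<lambda>i. \<phi> (i - j)))"
    unfolding plus_integral_def
  proof (rule nn_integral_field_measure_cong[OF site_family_pinned])
    have G': "(\<lambda>\<phi>. G (\<lambda>i. \<phi> (i - j))) \<in> borel_measurable fields"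
      by (rule measurable_compose[OF measurable_fields_reindex G])
    show "(\<lambda>\<phi>. G (\<lambda>i. \<phi> (i - j)) * ?w ((+) j ` S) (\<lambda>i. \<phi> (i - j))) \<in> borel_measurable fields"
      using measurable_compose[OF measurable_fields_reindex m] by simp
    show "(\<lambda>\<phi>. G (\<lambda>i. \<phi> (i - j)) * ?w S \<phi>) \<in> borel_measurable fields"
      using G' measurable_indicator_positive_on[OF sub(1)] by measurable
    fix \<phi> :: "int ^ 'd \<Rightarrow> real"
    assume \<phi>: "\<And>i. i \<notin> D \<Longrightarrow> \<phi> i = 0"
    have out: "\<phi> i = 0" if "i \<notin> \<Lambda> L" for i using \<phi>[of i] D(1) that by blast
    have out': "\<phi> (i - j) = 0" if "i \<notin> \<Lambda> L" for i
    proof -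
      have "i - j \<notin> D"
      proof
        assume "i - j \<in> D"
        then have "j + (i - j) \<in> (+) j ` D" by blast
        then show False using that D(2) by auto
      qed
      then show ?thesis by (rule \<phi>)
    qed
    have "energy L (\<lambda>i. \<phi> (i - j)) = energy L \<phi>" using out out' by (rule energy_translate)
    moreover have "(\<lambda>i. \<phi> (i - j)) \<in> positive_on (\<Lambda> L) ((+) j ` S) \<longleftrightarrow> \<phi> \<in> positive_on (\<Lambda> L) S"
    proof -
      have "(\<forall>i\<in>\<Lambda> L. 0 \<le> \<phi> (i - j)) \<longleftrightarrow> (\<forall>i. 0 \<le> \<phi> i)"
        using out' by (metis add_diff_cancel_left' order_refl)
      moreover have "(\<forall>i\<in>\<Lambda> L. 0 \<le> \<phi> i) \<longleftrightarrow> (\<forall>i. 0 \<le> \<phi> i)"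
        using out by (metis order_refl)
      ultimately show ?thesis by (simp add: positive_on_def)
    qed
    ultimately show "G (\<lambda>i. \<phi> (i - j)) * ?w ((+) j ` S) (\<lambda>i. \<phi> (i - j)) = G (\<lambda>i. \<phi> (i - j)) * ?w S \<phi>"
      by (simp add: boltzmann_def indicator_def)
  qed
  finally show ?thesis .
qed

text \<open>Strict positivity on all of \<open>D\<close> removes every atom, so \<eta> disappears
  and the Lebesgue integrals defining \<open>mean_height\<close> appear. Strict and weak positivity
  differ only by a null set there.\<close>

lemma plus_integral_unpinned:
  fixes D :: "(int ^ 'd) set"
  assumes D: "D \<subseteq> \<Lambda> L"
  shows "plus_integral L \<eta> D D (\<lambda>_. 1) = ennreal (\<integral>\<phi>. plus_weight L D \<phi> \<partial>field_measure (\<lambda>_. lborel) D)"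
    and "plus_integral L \<eta> D D (\<lambda>\<phi>. ennreal (\<phi> k)) = ennreal (\<integral>\<phi>. \<phi> k * plus_weight L D \<phi> \<partial>field_measure (\<lambda>_. lborel) D)"
proof -
  have fin: "finite D" using D finite_\<Lambda> by (rule finite_subset)
  note mw[measurable] = measurable_plus_weight[OF D]
  have conv: "plus_integral L \<eta> D D (\<lambda>\<phi>. ennreal (g \<phi>)) = (\<integral>\<^sup>+\<phi>. ennreal (g \<phi> * plus_weight L D \<phi>) \<partial>field_measure (\<lambda>_. lborel) D)"
    if g[measurable]: "g \<in> borel_measurable fields" for g
  proof -
    have m: "(\<lambda>\<phi>. ennreal (g \<phi> * plus_weight L D \<phi>)) \<in> borel_measurable fields" by measurable
    have "(\<integral>\<^sup>+\<phi>. ennreal (g \<phi> * plus_weight L D \<phi>) \<partial>field_measure (\<lambda>_. lborel) D) =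
      (\<integral>\<^sup>+\<phi>. (\<Prod>i\<in>D. if \<phi> i = 0 then 0 else 1) * ennreal (g \<phi> * plus_weight L D \<phi>) \<partial>field_measure (\<lambda>_. pinned_lebesgue \<eta>) D)"
      by (rule nn_integral_lborel_pinned[OF fin m])
    also have "\<dots> = plus_integral L \<eta> D D (\<lambda>\<phi>. ennreal (g \<phi>))"
      unfolding plus_integral_def
    proof (rule nn_integral_field_measure_cong[OF site_family_pinned])
      have "(\<lambda>\<phi>. \<Prod>i\<in>D. if \<phi> i = 0 then 0 else 1 :: ennreal) \<in> borel_measurable fields"
        using measurable_prod_fields[of "\<lambda>_ y. if y = 0 then 0 else 1" D] by simp
      then show "(\<lambda>\<phi>. (\<Prod>i\<in>D. if \<phi> i = 0 then 0 else 1) * ennreal (g \<phi> * plus_weight L D \<phi>)) \<in> borel_measurable fields"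
        by measurable
      show "(\<lambda>\<phi>. ennreal (g \<phi>) * (indicator (positive_on (\<Lambda> L) D) \<phi> * boltzmann L \<phi>)) \<in> borel_measurable fields"
        using measurable_indicator_positive_on[OF D] by measurable
      fix \<phi> :: "int ^ 'd \<Rightarrow> real"
      assume \<phi>: "\<And>i. i \<notin> D \<Longrightarrow> \<phi> i = 0"
      show "(\<Prod>i\<in>D. if \<phi> i = 0 then 0 else 1) * ennreal (g \<phi> * plus_weight L D \<phi>) =
        ennreal (g \<phi>) * (indicator (positive_on (\<Lambda> L) D) \<phi> * boltzmann L \<phi>)"
      proof (cases "\<phi> \<in> positive_on (\<Lambda> L) D")
        case True
        then have "\<forall>i\<in>D. 0 < \<phi> i" by (auto simp: positive_on_def)
        then have "(\<Prod>i\<in>D. if \<phi> i = 0 then 0 else 1 :: ennreal) = 1" "plus_weight L D \<phi> = exp (- energy L \<phi>)"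
          by (auto simp: plus_weight_eq[OF D] indicator_def intro!: prod.neutral less_imp_le)
        then show ?thesis using True by (simp add: boltzmann_def ennreal_mult'')
      next
        case False
        then have "(\<exists>i\<in>D. \<phi> i = 0) \<or> (\<exists>i\<in>D. \<phi> i < 0)"
          using \<phi> by (auto simp: positive_on_def not_le not_less le_less)
        then show ?thesis
        proof
          assume "\<exists>i\<in>D. \<phi> i = 0"
          then have "(\<Prod>i\<in>D. if \<phi> i = 0 then 0 else 1 :: ennreal) = 0" using fin by (intro prod_zero) auto
          then show ?thesis using False by simp
        next
          assume "\<exists>i\<in>D. \<phi> i < 0"
          then have "plus_weight L D \<phi> = 0" by (auto simp: plus_weight_eq[OF D] not_le)
          then show ?thesis using False by simp
        qed
      qed
    qed
    finally show ?thesis by simp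
  qed
  show "plus_integral L \<eta> D D (\<lambda>_. 1) = ennreal (\<integral>\<phi>. plus_weight L D \<phi> \<partial>field_measure (\<lambda>_. lborel) D)"
    using conv[of "\<lambda>_. 1"] nn_integral_eq_integral[OF integrable_plus_weight[OF D]] plus_weight_nonneg[OF D] by simp
  show "plus_integral L \<eta> D D (\<lambda>\<phi>. ennreal (\<phi> k)) = ennreal (\<integral>\<phi>. \<phi> k * plus_weight L D \<phi> \<partial>field_measure (\<lambda>_. lborel) D)"
    using conv[of "\<lambda>\<phi>. \<phi> k"] nn_integral_eq_integral[OF integrable_height[OF D] AE_height_nonneg[OF D]] by simp
qed

lemma plus_integral_unpinned_mean:
  fixes D :: "(int ^ 'd) set"
  assumes D: "D \<subseteq> \<Lambda> L"
  shows "plus_integral L \<eta> D D (\<lambda>\<phi>. ennreal (\<phi> k)) = ennreal (mean_height L D k) * plus_integral L \<eta> D D (\<lambda>_. 1)"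
  unfolding plus_integral_unpinned[OF D]
  using integral_plus_weight_pos[OF D] mean_height_nonneg[OF D, of k]
  by (simp add: ennreal_mult'[symmetric] mean_height_def)

section \<open>Linearity and monotonicity of the unnormalised expectations\<close>

lemma positive_on_sets:
  "S \<subseteq> \<Lambda> L \<Longrightarrow> positive_on (\<Lambda> L) S \<in> sets (fields :: (int ^ 'd \<Rightarrow> real) measure)"
  by (rule measurable_positive_on[OF finite_\<Lambda> finite_subset[OF _ finite_\<Lambda>]])

lemma plus_integral_add:
  assumes "S \<subseteq> \<Lambda> L" and [measurable]: "F \<in> borel_measurable fields" "G \<in> borel_measurable fields"
  shows "plus_integral L \<eta> D S (\<lambda>\<phi>. F \<phi> + G \<phi>) = plus_integral L \<eta> D S F + plus_integral L \<eta> D S G"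
proof -
  note [measurable] = positive_on_sets[OF assms(1)]
  show ?thesis unfolding plus_integral_def distrib_right by (rule nn_integral_add) measurable
qed

lemma plus_integral_cmult:
  assumes "S \<subseteq> \<Lambda> L" and [measurable]: "F \<in> borel_measurable fields"
  shows "plus_integral L \<eta> D S (\<lambda>\<phi>. c * F \<phi>) = c * plus_integral L \<eta> D S F"
proof -
  note [measurable] = positive_on_sets[OF assms(1)]
  show ?thesis unfolding plus_integral_def mult.assoc by (rule nn_integral_cmult) measurable
qed

lemma plus_integral_const:
  "S \<subseteq> \<Lambda> L \<Longrightarrow> plus_integral L \<eta> D S (\<lambda>_. c) = c * plus_integral L \<eta> D S (\<lambda>_. 1)"
  using plus_integral_cmult[of S L "\<lambda>_. 1" \<eta> D c] by simp

lemma plus_integral_sum: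
  assumes "S \<subseteq> \<Lambda> L" "finite I" "\<And>k. k \<in> I \<Longrightarrow> F k \<in> borel_measurable fields"
  shows "plus_integral L \<eta> D S (\<lambda>\<phi>. \<Sum>k\<in>I. F k \<phi>) = (\<Sum>k\<in>I. plus_integral L \<eta> D S (F k))"
  using assms(2,3)
proof (induction I rule: finite_induct)
  case empty
  then show ?case by (simp add: plus_integral_def)
next
  case (insert k I)
  then show ?case using plus_integral_add[OF assms(1), of "F k" "\<lambda>\<phi>. \<Sum>k\<in>I. F k \<phi>"] by simp
qed

lemma plus_integral_mono:
  "(\<And>\<phi>. \<phi> \<in> positive_on (\<Lambda> L) S \<Longrightarrow> F \<phi> \<le> G \<phi>) \<Longrightarrow> plus_integral L \<eta> D S F \<le> plus_integral L \<eta> D S G"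
  unfolding plus_integral_def by (intro nn_integral_mono) (auto simp: indicator_def intro: mult_right_mono)

lemma plus_integral_antimono:
  "S' \<subseteq> S \<Longrightarrow> plus_integral L \<eta> D S F \<le> plus_integral L \<eta> D S' F"
  unfolding plus_integral_def positive_on_def
  by (intro nn_integral_mono mult_left_mono mult_right_mono) (auto simp: indicator_def)

lemma box_integral_mono:
  fixes F :: "(int ^ 'd \<Rightarrow> real) \<Rightarrow> ennreal"
  assumes "\<eta> \<le> \<eta>'" "D \<subseteq> \<Lambda> L" and [measurable]: "F \<in> borel_measurable fields"
  shows "plus_integral L \<eta> D {} F \<le> plus_integral L \<eta>' D {} F"
proof -
  note [measurable] = positive_on_sets[OF empty_subsetI, of L, where 'd = 'd]
  show ?thesis
    unfolding plus_integral_def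
    by (rule nn_integral_pinned_mono[OF assms(1) finite_subset[OF assms(2) finite_\<Lambda>]]) measurable
qed

lemma Z_plus_mono: "\<eta> \<le> \<eta>' \<Longrightarrow> Z_plus TYPE('d::finite) \<eta> L \<le> Z_plus TYPE('d) \<eta>' L"
  using box_integral_mono[of \<eta> \<eta>' "\<Lambda> L" L "\<lambda>_::int ^ 'd \<Rightarrow> real. 1"] box_integral_finite(1)[of L \<eta>', where 'd = 'd]
  unfolding Z_plus_eq by (intro enn2real_mono) auto

text \<open>The mass \<open>ennreal \<eta>\<close> of the atom is 0 for every \<eta> \<le>
  0.\<close>

lemma Z_plus_nonpos: "\<eta> \<le> 0 \<Longrightarrow> Z_plus TYPE('d::finite) \<eta> L = Z_plus TYPE('d) 0 L"
  unfolding Z_plus_eq plus_integral_def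
  using measurable_indicator_positive_on[where S = "{} :: (int ^ 'd) set" and L = L]
  by (simp add: nn_integral_pinned_zero)

subsection \<open>Counting pinned sites\<close>

text \<open>The probability of a pin at \<open>k\<close> times \<open>Z_plus\<close>, left
  unnormalised.\<close>

definition pin_mass :: "nat \<Rightarrow> real \<Rightarrow> int ^ 'd::finite \<Rightarrow> real" where
  "pin_mass L \<eta> k = enn2real (box_integral L \<eta> (indicator {\<phi>. \<phi> k = 0}))"

lemma box_integral_pin:
  "box_integral L \<eta> (indicator {\<phi>. \<phi> k = 0}) = ennreal (pin_mass L \<eta> (k :: int ^ 'd::finite))"
proof -
  have "box_integral L \<eta> (indicator {\<phi>. \<phi> k = 0}) \<le> box_integral L \<eta> (\<lambda>_::int ^ 'd \<Rightarrow> real. 1)"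
    by (rule plus_integral_mono) (auto simp: indicator_def)
  also have "\<dots> < \<infinity>" by (rule box_integral_finite)
  finally show ?thesis by (simp add: pin_mass_def)
qed

lemma pin_mass_nonneg: "0 \<le> pin_mass L \<eta> k"
  by (simp add: pin_mass_def)

lemma box_integral_one: "box_integral L \<eta> (\<lambda>_::int ^ 'd::finite \<Rightarrow> real. 1) = ennreal (Z_plus TYPE('d) \<eta> L)"
  using box_integral_finite(1)[of L \<eta>, where 'd = 'd] by (simp add: Z_plus_eq)

text \<open>Jensen's inequality for \<open>\<alpha> ^ (number of pins)\<close>, in the form \<open>exp y \<ge> exp y\<^sub>0 (1 + y - y\<^sub>0)\<close>.\<close>

lemma pin_mass_le_free_energy:
  assumes \<alpha>: "\<alpha> > 1" and \<eta>: "\<eta> > 0"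
  shows "(\<Sum>k\<in>\<Lambda> L. pin_mass L \<eta> (k :: int ^ 'd::finite)) * ln \<alpha> \<le>
    Z_plus TYPE('d) \<eta> L * ln (Z_plus TYPE('d) (\<alpha> * \<eta>) L / Z_plus TYPE('d) 0 L)"
proof -
  define Z where "Z = Z_plus TYPE('d) \<eta> L"
  define Z' where "Z' = Z_plus TYPE('d) (\<alpha> * \<eta>) L"
  define a where "a = ln \<alpha>"
  have a: "a > 0" using \<alpha> by (simp add: a_def)
  have Z: "Z > 0" "Z' > 0" by (simp_all add: Z_def Z'_def Z_plus_pos)
  \<comment> \<open>The mean number of pins; \<open>a * m\<close> is the tangent point in Jensen's
    inequality.\<close>
  define m where "m = (\<Sum>k\<in>\<Lambda> L. pin_mass L \<eta> (k :: int ^ 'd)) / Z"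
  have m: "m \<ge> 0" using Z by (simp add: m_def sum_nonneg pin_mass_nonneg)
  have mZ: "(\<Sum>k\<in>\<Lambda> L. pin_mass L \<eta> (k :: int ^ 'd)) = m * Z" using Z by (simp add: m_def)
  define N where "N \<phi> = (\<Sum>k\<in>\<Lambda> L. indicator {\<phi>. \<phi> k = 0} \<phi> :: real)" for \<phi> :: "int ^ 'd \<Rightarrow> real"
  define E where "E = exp (a * m)"
  have [measurable]: "N \<in> borel_measurable fields" unfolding N_def[abs_def] by measurable
  note [measurable] = positive_on_sets[OF empty_subsetI, of L, where 'd = 'd]
  have "(\<Prod>i\<in>\<Lambda> L. if \<phi> i = 0 then ennreal \<alpha> else 1) = ennreal (exp (a * N \<phi>))" for \<phi> :: "int ^ 'd \<Rightarrow> real"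
  proof -
    have "exp (a * N \<phi>) = (\<Prod>i\<in>\<Lambda> L. exp (a * indicator {\<phi>. \<phi> i = 0} \<phi>))"
      unfolding N_def sum_distrib_left by (rule exp_sum) simp
    also have "\<dots> = (\<Prod>i\<in>\<Lambda> L. if \<phi> i = 0 then \<alpha> else 1)"
      using \<alpha> by (intro prod.cong) (auto simp: a_def)
    finally have "ennreal (exp (a * N \<phi>)) = (\<Prod>i\<in>\<Lambda> L. ennreal (if \<phi> i = 0 then \<alpha> else 1))"
      using \<alpha> by (simp add: prod_ennreal)
    also have "\<dots> = (\<Prod>i\<in>\<Lambda> L. if \<phi> i = 0 then ennreal \<alpha> else 1)" by (intro prod.cong) auto
    finally show ?thesis by simp
  qed
  then have Z'_eq: "ennreal Z' = box_integral L \<eta> (\<lambda>\<phi> :: int ^ 'd \<Rightarrow> real. ennreal (exp (a * N \<phi>)))"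
    unfolding Z'_def box_integral_one[symmetric] plus_integral_def
    using \<alpha> \<eta> by (subst nn_integral_pinned_mult) (auto simp: mult.assoc)
  have nonneg: "0 \<le> E * m * a" "0 \<le> E" "0 \<le> E * a" using m a by (simp_all add: E_def)
  have N_nonneg: "0 \<le> N \<phi>" for \<phi> by (simp add: N_def sum_nonneg)
  \<comment> \<open>The tangent inequality with its negative term moved to the other side, so that
    both sides are sums of nonnegative terms and can be integrated in the extended reals.\<close>
  have "box_integral L \<eta> (\<lambda>\<phi> :: int ^ 'd \<Rightarrow> real. ennreal E + (\<Sum>k\<in>\<Lambda> L. ennreal (E * a) * indicator {\<phi>. \<phi> k = 0} \<phi>)) \<le>
    box_integral L \<eta> (\<lambda>\<phi> :: int ^ 'd \<Rightarrow> real. ennreal (exp (a * N \<phi>)) + ennreal (E * m * a))"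
  proof (rule plus_integral_mono)
    fix \<phi> :: "int ^ 'd \<Rightarrow> real"
    have "E * (1 + (a * N \<phi> - a * m)) \<le> E * exp (a * N \<phi> - a * m)"
      using nonneg by (intro mult_left_mono exp_ge_add_one_self)
    also have "\<dots> = exp (a * N \<phi>)" by (simp add: E_def exp_add[symmetric])
    finally have le: "E + E * a * N \<phi> \<le> exp (a * N \<phi>) + E * m * a" by (simp add: algebra_simps)
    have "(\<Sum>k\<in>\<Lambda> L. ennreal (E * a) * indicator {\<phi>. \<phi> k = 0} \<phi>) = ennreal (E * a * N \<phi>)"
    proof -
      have "(\<Sum>k\<in>\<Lambda> L. ennreal (E * a) * indicator {\<phi>. \<phi> k = 0} \<phi>) = (\<Sum>k\<in>\<Lambda> L. ennreal (E * a * indicator {\<phi>. \<phi> k = 0} \<phi>))"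
        by (intro sum.cong) (auto simp: indicator_def)
      also have "\<dots> = ennreal (E * a * N \<phi>)"
        using nonneg by (subst sum_ennreal) (auto simp: N_def sum_distrib_left)
      finally show ?thesis .
    qed
    then show "ennreal E + (\<Sum>k\<in>\<Lambda> L. ennreal (E * a) * indicator {\<phi>. \<phi> k = 0} \<phi>) \<le> ennreal (exp (a * N \<phi>)) + ennreal (E * m * a)"
      using le nonneg N_nonneg[of \<phi>] by (simp add: ennreal_plus[symmetric] ennreal_leI del: ennreal_plus)
  qed
  moreover have "box_integral L \<eta> (\<lambda>\<phi> :: int ^ 'd \<Rightarrow> real. ennreal E + (\<Sum>k\<in>\<Lambda> L. ennreal (E * a) * indicator {\<phi>. \<phi> k = 0} \<phi>)) = ennreal (E * Z + E * a * (m * Z))"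
  proof -
    have "box_integral L \<eta> (\<lambda>\<phi> :: int ^ 'd \<Rightarrow> real. ennreal E + (\<Sum>k\<in>\<Lambda> L. ennreal (E * a) * indicator {\<phi>. \<phi> k = 0} \<phi>)) =
      box_integral L \<eta> (\<lambda>\<phi> :: int ^ 'd \<Rightarrow> real. ennreal E) + (\<Sum>k\<in>\<Lambda> L. ennreal (E * a) * box_integral L \<eta> (indicator {\<phi> :: int ^ 'd \<Rightarrow> real. \<phi> k = 0}))"
      by (subst plus_integral_add, simp, simp, measurable, subst plus_integral_sum) (auto simp: plus_integral_cmult)
    also have "\<dots> = ennreal (E * Z) + (\<Sum>k\<in>\<Lambda> L. ennreal (E * a * pin_mass L \<eta> (k :: int ^ 'd)))"
      using nonneg Z by (simp add: plus_integral_const box_integral_pin box_integral_one Z_def[symmetric] ennreal_mult' pin_mass_nonneg)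
    also have "(\<Sum>k\<in>\<Lambda> L. ennreal (E * a * pin_mass L \<eta> (k :: int ^ 'd))) = ennreal (E * a * (m * Z))"
      using nonneg by (subst sum_ennreal) (auto simp: pin_mass_nonneg mZ[symmetric] sum_distrib_left)
    finally show ?thesis using nonneg Z m by simp
  qed
  moreover have "box_integral L \<eta> (\<lambda>\<phi> :: int ^ 'd \<Rightarrow> real. ennreal (exp (a * N \<phi>)) + ennreal (E * m * a)) = ennreal (Z' + E * m * a * Z)"
    using nonneg Z by (subst plus_integral_add)
      (auto simp: plus_integral_const[of "{}" L \<eta> "\<Lambda> L" "ennreal (E * m * a)"] Z'_eq[symmetric] box_integral_one Z_def[symmetric] ennreal_mult'[symmetric])
  ultimately have "ennreal (E * Z + E * a * (m * Z)) \<le> ennreal (Z' + E * m * a * Z)"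
    by (simp only:)
  moreover have "0 \<le> Z' + E * m * a * Z" using nonneg Z m a by (intro add_nonneg_nonneg mult_nonneg_nonneg) auto
  ultimately have "E * Z + E * a * (m * Z) \<le> Z' + E * m * a * Z"
    by (simp only: ennreal_le_iff)
  then have "E * Z \<le> Z'" by (simp add: algebra_simps)
  then have "E \<le> Z' / Z" using Z by (simp add: field_simps)
  then have "a * m \<le> ln (Z' / Z)" using Z by (simp add: E_def ln_ge_iff)
  \<comment> \<open>Convexity compares with strength \<eta>; passing to strength 0 only decreases
    the denominator and produces the free energy.\<close>
  also have "\<dots> \<le> ln (Z' / Z_plus TYPE('d) 0 L)"
  proof (rule ln_mono)
    show "Z' / Z \<le> Z' / Z_plus TYPE('d) 0 L"
      using Z Z_plus_mono[of 0 \<eta> L, where 'd = 'd] \<eta> Z_plus_pos[of 0 L, where 'd = 'd]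
      by (intro divide_left_mono) (auto simp: Z_def)
  qed (use Z in auto)
  finally have "Z * (a * m) \<le> Z * ln (Z' / Z_plus TYPE('d) 0 L)" using Z by (intro mult_left_mono) auto
  then show ?thesis unfolding mZ by (simp add: Z_def Z'_def a_def mult_ac)
qed

text \<open>Double counting over the admissible centres: for each offset in the cube a site is
  counted at most once. The centres form a box of side \<open>L - 2 * n\<close>, at least half of
  \<open>L\<close>, and this half turns \<open>2 * n + 1\<close> into
  \<open>4 * n + 2\<close>.\<close>

lemma exists_unpinned_cube:
  assumes n: "4 * n + 1 \<le> L" and P: "(\<Sum>k\<in>\<Lambda> L. pin_mass L \<eta> (k :: int ^ 'd::finite)) \<le> \<delta> * real L ^ CARD('d)"
  obtains j where "(+) j ` cube n \<subseteq> (\<Lambda> L :: (int ^ 'd) set)" "(\<Sum>y\<in>cube n. pin_mass L \<eta> (j + y)) \<le> (4 * real n + 2) ^ CARD('d) * \<delta>"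
proof -
  let ?d = "CARD('d)"
  define T where "T = {i :: int ^ 'd. \<forall>k. i $ k \<in> {- \<lceil>real L / 2\<rceil> + 1 + int n..\<lfloor>real L / 2\<rfloor> - int n}}"
  have finT: "finite T" unfolding T_def by (rule finite_vec_box)
  have width: "\<lfloor>real L / 2\<rfloor> - int n - (- \<lceil>real L / 2\<rceil> + 1 + int n) + 1 = int L - 2 * int n"
    using floor_plus_ceiling_half[of L] by simp
  have "card T = nat (int L - 2 * int n) ^ ?d"
    unfolding T_def card_vec_box width ..
  then have cardT: "card T = (L - 2 * n) ^ ?d" using n by (simp add: nat_diff_distrib nat_mult_distrib)
  have T: "j + y \<in> \<Lambda> L" if "j \<in> T" "y \<in> cube n" for j y
    unfolding \<Lambda>_def
  proof safe
    fix k
    have "j $ k \<in> {- \<lceil>real L / 2\<rceil> + 1 + int n..\<lfloor>real L / 2\<rfloor> - int n}" "\<bar>y $ k\<bar> \<le> int n"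
      using that by (auto simp: T_def cube_def)
    then show "(j + y) $ k \<in> {- \<lceil>real L / 2\<rceil> + 1..\<lfloor>real L / 2\<rfloor>}" by auto
  qed
  define q where "q j = (\<Sum>y\<in>cube n. pin_mass L \<eta> (j + y))" for j :: "int ^ 'd"
  have "\<exists>j\<in>T. q j \<le> (4 * real n + 2) ^ ?d * \<delta>"
  proof (rule ccontr)
    assume "\<not> ?thesis"
    then have big: "(4 * real n + 2) ^ ?d * \<delta> < q j" if "j \<in> T" for j using that by (auto simp: not_le)
    have ne: "card T > 0" using n by (simp add: cardT)
    then have "T \<noteq> {}" by auto
    have "real (card T) * ((4 * real n + 2) ^ ?d * \<delta>) = (\<Sum>j\<in>T. (4 * real n + 2) ^ ?d * \<delta>)" by simp
    also have "\<dots> < (\<Sum>j\<in>T. q j)" using finT \<open>T \<noteq> {}\<close> big by (intro sum_strict_mono) auto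
    also have "\<dots> = (\<Sum>y\<in>cube n. \<Sum>j\<in>T. pin_mass L \<eta> (j + y))" unfolding q_def by (rule sum.swap)
    also have "\<dots> \<le> (\<Sum>y\<in>(cube n :: (int ^ 'd) set). \<Sum>k\<in>\<Lambda> L. pin_mass L \<eta> (k :: int ^ 'd))"
    proof (rule sum_mono)
      fix y :: "int ^ 'd" assume y: "y \<in> cube n"
      have "(\<Sum>j\<in>T. pin_mass L \<eta> (j + y)) = (\<Sum>k\<in>(\<lambda>j. j + y) ` T. pin_mass L \<eta> k)"
        by (subst sum.reindex) (auto simp: inj_on_def)
      also have "\<dots> \<le> (\<Sum>k\<in>\<Lambda> L. pin_mass L \<eta> (k :: int ^ 'd))"
        using T y by (intro sum_mono2) (auto simp: pin_mass_nonneg)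
      finally show "(\<Sum>j\<in>T. pin_mass L \<eta> (j + y)) \<le> (\<Sum>k\<in>\<Lambda> L. pin_mass L \<eta> (k :: int ^ 'd))" .
    qed
    also have "\<dots> = real ((2 * n + 1) ^ ?d) * (\<Sum>k\<in>\<Lambda> L. pin_mass L \<eta> (k :: int ^ 'd))" by (simp only: sum_constant card_cube)
    also have "\<dots> \<le> real ((2 * n + 1) ^ ?d) * (\<delta> * real L ^ ?d)" using P by (intro mult_left_mono) auto
    finally have 1: "real ((L - 2 * n) ^ ?d) * ((4 * real n + 2) ^ ?d * \<delta>) < real ((2 * n + 1) ^ ?d) * (\<delta> * real L ^ ?d)"
      by (simp add: cardT)
    have "0 \<le> \<delta> * real L ^ ?d" using P by (rule order_trans[rotated]) (auto intro: sum_nonneg pin_mass_nonneg)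
    moreover have "0 < real L ^ ?d" using n by simp
    ultimately have \<delta>: "0 \<le> \<delta>" by (auto simp: zero_le_mult_iff)
    have "(2 * real n + 1) ^ ?d * real L ^ ?d \<le> real (L - 2 * n) ^ ?d * (4 * real n + 2) ^ ?d"
      unfolding power_mult_distrib[symmetric]
    proof (rule power_mono)
      have "real L \<le> 2 * real (L - 2 * n)" using n by (simp add: of_nat_diff)
      then have "(2 * real n + 1) * real L \<le> (2 * real n + 1) * (2 * real (L - 2 * n))" by (intro mult_left_mono) auto
      then show "(2 * real n + 1) * real L \<le> real (L - 2 * n) * (4 * real n + 2)" by (simp add: algebra_simps)
    qed simp
    from mult_right_mono[OF this \<delta>] 1 show False by (simp add: algebra_simps)
  qed
  then obtain j where "j \<in> T" "q j \<le> (4 * real n + 2) ^ ?d * \<delta>" by blast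
  then show ?thesis using that[of j] T by (auto simp: q_def)
qed

text \<open>Union bound: a nonnegative field fails to be strictly positive on \<open>S\<close> only
  through a pin at some site of \<open>S\<close>.\<close>

lemma unpinned_probability:
  assumes S: "S \<subseteq> (\<Lambda> L :: (int ^ 'd::finite) set)" and half: "(\<Sum>k\<in>S. pin_mass L \<eta> k) \<le> Z_plus TYPE('d) \<eta> L / 2"
  shows "ennreal (1 / 2) * box_integral L \<eta> (\<lambda>_::int ^ 'd \<Rightarrow> real. 1) \<le> plus_integral L \<eta> (\<Lambda> L) S (\<lambda>_. 1)"
proof -
  define Z where "Z = Z_plus TYPE('d) \<eta> L"
  have Z: "Z > 0" by (simp add: Z_def Z_plus_pos)
  have fin: "finite S" using S finite_\<Lambda> by (rule finite_subset)
  have S0: "S \<subseteq> \<Lambda> L" by (rule S)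
  note [measurable] = measurable_positive_on[OF finite_\<Lambda>[of L] fin]
  define Q where "Q = plus_integral L \<eta> (\<Lambda> L) S (\<lambda>_. 1)"
  have "Q < \<infinity>" unfolding Q_def using S by (intro plus_integral_finite) auto
  then obtain Q' where Q': "Q = ennreal Q'" "Q' \<ge> 0" by (cases Q) auto
  have "ennreal Z = box_integral L \<eta> (\<lambda>_::int ^ 'd \<Rightarrow> real. 1)" by (simp add: box_integral_one Z_def)
  also have "\<dots> \<le> box_integral L \<eta> (\<lambda>\<phi>. indicator (positive_on (\<Lambda> L) S) \<phi> + (\<Sum>k\<in>S. indicator {\<phi>. \<phi> k = 0} \<phi>))"
  proof (rule plus_integral_mono)
    fix \<phi> :: "int ^ 'd \<Rightarrow> real" assume pos: "\<phi> \<in> positive_on (\<Lambda> L) {}"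
    show "1 \<le> indicator (positive_on (\<Lambda> L) S) \<phi> + (\<Sum>k\<in>S. indicator {\<phi>. \<phi> k = 0} \<phi> :: ennreal)"
    proof (cases "\<phi> \<in> positive_on (\<Lambda> L) S")
      case False
      then obtain k where k: "k \<in> S" "\<phi> k = 0"
        using pos S by (auto simp: positive_on_def not_less subset_iff) (metis antisym)
      then have "indicator {\<phi>. \<phi> k = 0} \<phi> \<le> (\<Sum>k\<in>S. indicator {\<phi>. \<phi> k = 0} \<phi> :: ennreal)"
        using fin by (intro member_le_sum) auto
      then show ?thesis using k False by simp
    qed simp
  qed
  also have "\<dots> = box_integral L \<eta> (indicator (positive_on (\<Lambda> L) S)) + (\<Sum>k\<in>S. box_integral L \<eta> (indicator {\<phi>. \<phi> k = 0}))"
    using fin by (subst plus_integral_add) (auto simp: plus_integral_sum)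
  also have "box_integral L \<eta> (indicator (positive_on (\<Lambda> L) S)) = Q"
    unfolding Q_def plus_integral_def by (intro nn_integral_cong) (auto simp: indicator_def positive_on_def)
  also have "(\<Sum>k\<in>S. box_integral L \<eta> (indicator {\<phi>. \<phi> k = 0})) = ennreal (\<Sum>k\<in>S. pin_mass L \<eta> k)"
    by (simp add: box_integral_pin sum_ennreal pin_mass_nonneg)
  also have "Q + ennreal (\<Sum>k\<in>S. pin_mass L \<eta> k) \<le> ennreal (Q' + Z / 2)"
    using half Q' Z by (simp add: Z_def[symmetric] sum_nonneg pin_mass_nonneg ennreal_leI flip: ennreal_plus)
  finally have "Z \<le> Q' + Z / 2" using Q' Z by (simp add: ennreal_le_iff del: ennreal_plus)
  then have "ennreal (1 / 2 * Z) \<le> ennreal Q'" by (intro ennreal_leI) simp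
  moreover have "ennreal (1 / 2) * ennreal Z = ennreal (1 / 2 * Z)" by (rule ennreal_mult'[symmetric]) simp
  ultimately show ?thesis unfolding box_integral_one Z_def[symmetric] Q_def[symmetric] Q'(1) by simp
qed

subsection \<open>Comparison with an unpinned cube\<close>

lemma measurable_height: "(\<lambda>\<phi>. ennreal (\<phi> k)) \<in> borel_measurable fields"
  by measurable

text \<open>Translate by \<open>- z\<close> with \<open>z = j + k\<close>, so that the favourable
  site of the empty cube becomes the origin; \<open>T\<close> is the translated cube and
  \<open>D\<close> the translated small box. Heights grow from \<open>T\<close> to \<open>D\<close>
  while \<open>T\<close> stays barred from the wall; lifting the bar costs the factor one half, by
  hypothesis; heights grow again from \<open>D\<close> to \<open>\<Lambda> L\<close>.\<close>

lemma height_ge_mean_height: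
  fixes j k :: "int ^ 'd::finite"
  assumes \<eta>: "\<eta> > 0" and S: "(+) j ` cube n \<subseteq> \<Lambda> L1" and k: "k \<in> cube n"
    and L: "4 * L1 + 1 \<le> L" "2 * n + 1 \<le> L"
    and half: "ennreal (1 / 2) * box_integral L1 \<eta> (\<lambda>_::int ^ 'd \<Rightarrow> real. 1) \<le> plus_integral L1 \<eta> (\<Lambda> L1) ((+) j ` cube n) (\<lambda>_. 1)"
  shows "mean_height L (cube n) k / 2 \<le> (\<integral>\<phi>. \<phi> (0 :: int ^ 'd) \<partial>\<mu>_plus \<eta> L)"
proof -
  define z where "z = j + k"
  define D where "D = (+) (- z) ` \<Lambda> L1"
  define T where "T = (+) (- z) ` (+) j ` cube n"
  have T_eq: "T = (+) (- k) ` cube n"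
    unfolding T_def z_def image_image by (rule image_cong) auto
  have z: "z \<in> \<Lambda> L1" using S k by (auto simp: z_def)
  \<comment> \<open>Both \<open>y\<close> and \<open>z\<close> have sup-norm at most
    \<open>L1\<close>; hence the requirement \<open>4 * L1 + 1 \<le> L\<close>.\<close>
  have "D \<subseteq> cube (2 * L1)"
  proof
    fix i assume "i \<in> D"
    then obtain y where y: "i = - z + y" "y \<in> \<Lambda> L1" by (auto simp: D_def)
    have "\<bar>i $ e\<bar> \<le> int (2 * L1)" for e
    proof -
      have "y \<in> cube L1" "z \<in> cube L1" using y(2) z \<Lambda>_subset_cube by blast+
      then have "\<bar>y $ e\<bar> \<le> int L1" "\<bar>z $ e\<bar> \<le> int L1" by (auto simp: cube_def)
      then show ?thesis by (simp add: y(1))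
    qed
    then show "i \<in> cube (2 * L1)" by (simp add: cube_def)
  qed
  moreover have "cube (2 * L1) \<subseteq> (\<Lambda> L :: (int ^ 'd) set)" using L by (intro cube_subset_\<Lambda>) simp
  ultimately have D: "D \<subseteq> \<Lambda> L" by blast
  have TD: "T \<subseteq> D" using S by (auto simp: T_def D_def)
  then have T: "T \<subseteq> \<Lambda> L" using D by blast
  have L1: "\<Lambda> L1 \<subseteq> (\<Lambda> L :: (int ^ 'd) set)" "L1 \<le> L" using L by (auto intro!: \<Lambda>_mono)
  have C: "cube n \<subseteq> (\<Lambda> L :: (int ^ 'd) set)" using L(2) by (rule cube_subset_\<Lambda>)
  let ?J = "plus_integral L \<eta> :: (int ^ 'd) set \<Rightarrow> (int ^ 'd) set \<Rightarrow> _"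
  let ?h = "\<lambda>\<phi> :: int ^ 'd \<Rightarrow> real. ennreal (\<phi> 0)"
  define m where "m = mean_height L (cube n) k"
  have mono: "?h \<phi> \<le> ?h (\<lambda>i. max (\<phi> i) (\<psi> i))" for \<phi> \<psi> by (simp add: ennreal_leI)
  have m: "0 \<le> m" unfolding m_def by (rule mean_height_nonneg[OF C])
  have "?J T T ?h = ?J (cube n) (cube n) (\<lambda>\<phi>. ennreal (\<phi> k))"
    using plus_integral_translate[of "cube n" L "- k" "cube n" ?h \<eta>] C T by (simp add: T_eq)
  also have "\<dots> = ennreal m * ?J (cube n) (cube n) (\<lambda>_. 1)"
    unfolding m_def by (rule plus_integral_unpinned_mean[OF C])
  also have "?J (cube n) (cube n) (\<lambda>_. 1) = ?J T T (\<lambda>_. 1)"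
    using plus_integral_translate[of "cube n" L "- k" "cube n" "\<lambda>_. 1" \<eta>] C T by (simp add: T_eq)
  finally have T_mean: "?J T T ?h = ennreal m * ?J T T (\<lambda>_. 1)" .
  have T_fin: "?J T T (\<lambda>_. 1) < \<infinity>" "?J T T (\<lambda>_. 1) > 0"
    using T by (auto intro!: plus_integral_finite plus_integral_pos simp del: infinity_ennreal_def)
  have "?J T T ?h * ?J D T (\<lambda>_. 1) \<le> ?J T T (\<lambda>_. 1) * ?J D T ?h"
    by (rule plus_integral_domination[OF \<eta> order_refl order_refl TD TD D measurable_height mono])
  then have "?J T T (\<lambda>_. 1) * (ennreal m * ?J D T (\<lambda>_. 1)) \<le> ?J T T (\<lambda>_. 1) * ?J D T ?h"
    unfolding T_mean by (simp add: ac_simps)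
  then have 1: "ennreal m * ?J D T (\<lambda>_. 1) \<le> ?J D T ?h"
    using T_fin by (simp add: ennreal_mult_le_mult_iff)
  have 2: "?J D T ?h \<le> ?J D {} ?h" by (rule plus_integral_antimono) simp
  have 3: "ennreal (1 / 2) * ?J D {} (\<lambda>_. 1) \<le> ?J D T (\<lambda>_. 1)"
  proof -
    have "?J D T (\<lambda>_. 1) = ?J (\<Lambda> L1) ((+) j ` cube n) (\<lambda>_. 1)"
      unfolding D_def T_def using L1 D S
      by (subst plus_integral_translate) (auto simp: D_def)
    also have "\<dots> = plus_integral L1 \<eta> (\<Lambda> L1) ((+) j ` cube n) (\<lambda>_. 1)"
      using S L1 by (intro plus_integral_box) auto
    finally have a: "?J D T (\<lambda>_. 1) = plus_integral L1 \<eta> (\<Lambda> L1) ((+) j ` cube n) (\<lambda>_. 1)" .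
    have "?J D {} (\<lambda>_. 1) = ?J (\<Lambda> L1) {} (\<lambda>_. 1)"
      unfolding D_def using L1 D plus_integral_translate[of "\<Lambda> L1" L "- z" "{}" "\<lambda>_. 1" \<eta>] by (simp add: D_def)
    also have "\<dots> = box_integral L1 \<eta> (\<lambda>_::int ^ 'd \<Rightarrow> real. 1)"
      using L1 by (intro plus_integral_box) auto
    finally show ?thesis using half a by simp
  qed
  have 4: "?J D {} ?h * ?J (\<Lambda> L) {} (\<lambda>_. 1) \<le> ?J D {} (\<lambda>_. 1) * ?J (\<Lambda> L) {} ?h"
    by (rule plus_integral_domination[OF \<eta> order_refl empty_subsetI D empty_subsetI order_refl measurable_height mono])
  have D_fin: "?J D {} (\<lambda>_. 1) < \<infinity>" "?J D {} (\<lambda>_. 1) > 0"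
    using D by (auto intro!: plus_integral_finite plus_integral_pos simp del: infinity_ennreal_def)
  have "?J D {} (\<lambda>_. 1) * (ennreal (m / 2) * ?J (\<Lambda> L) {} (\<lambda>_. 1)) =
      (ennreal m * (ennreal (1 / 2) * ?J D {} (\<lambda>_. 1))) * ?J (\<Lambda> L) {} (\<lambda>_. 1)"
  proof -
    have "ennreal (m / 2) = ennreal m * ennreal (1 / 2)" using m ennreal_mult'[of m "1 / 2"] by simp
    then show ?thesis by (simp only: ac_simps)
  qed
  also have "\<dots> \<le> ?J D {} ?h * ?J (\<Lambda> L) {} (\<lambda>_. 1)"
    by (intro mult_right_mono order_trans[OF mult_left_mono[OF 3] order_trans[OF 1 2]]) auto
  also note 4
  finally have "ennreal (m / 2) * ?J (\<Lambda> L) {} (\<lambda>_. 1) \<le> ?J (\<Lambda> L) {} ?h"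
    using D_fin by (simp add: ennreal_mult_le_mult_iff)
  then have "enn2real (ennreal (m / 2) * ?J (\<Lambda> L) {} (\<lambda>_. 1)) \<le> enn2real (?J (\<Lambda> L) {} ?h)"
    using box_integral_finite(2)[of L \<eta> "0 :: int ^ 'd"] by (intro enn2real_mono) auto
  then have "m / 2 * Z_plus TYPE('d) \<eta> L \<le> enn2real (?J (\<Lambda> L) {} ?h)"
    using m by (simp add: enn2real_mult Z_plus_eq)
  then show ?thesis
    using expectation_height[of L \<eta>, where 'd = 'd] Z_plus_pos[of \<eta> L, where 'd = 'd] L
    by (simp add: m_def pos_le_divide_eq)
qed

text \<open>Comparison with the one-site domain at the origin; the numerator is smallest at strength
  0 and the denominator largest at \<open>\<eta>'\<close>. It provides for all strengths at which
  the logarithm of the free energy stays bounded.\<close>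

lemma height_uniform_lower_bound:
  "\<exists>c>0. \<forall>\<eta> L. 0 < \<eta> \<longrightarrow> \<eta> \<le> \<eta>' \<longrightarrow> 1 \<le> L \<longrightarrow> c \<le> (\<integral>\<phi>. \<phi> (0 :: int ^ 'd::finite) \<partial>\<mu>_plus \<eta> L)"
proof -
  let ?O = "{0 :: int ^ 'd}"
  let ?h = "\<lambda>\<phi> :: int ^ 'd \<Rightarrow> real. ennreal (\<phi> 0)"
  have O: "?O \<subseteq> \<Lambda> L" if "1 \<le> L" for L
  proof -
    have "0 \<in> (cube 0 :: (int ^ 'd) set)" "cube 0 \<subseteq> (\<Lambda> L :: (int ^ 'd) set)"
      using that by (simp, intro cube_subset_\<Lambda>, simp)
    then show ?thesis by blast
  qed
  define a where "a = plus_integral 1 0 ?O {} ?h"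
  define b where "b = plus_integral 1 \<eta>' ?O {} (\<lambda>_. 1)"
  have fin: "a < \<infinity>" "b < \<infinity>" "b > 0"
    unfolding a_def b_def using O[of 1] by (auto intro!: plus_integral_finite plus_integral_pos simp del: infinity_ennreal_def)
  have "a \<noteq> 0"
  proof
    assume "a = 0"
    let ?M = "field_measure (\<lambda>_. pinned_lebesgue 0) ?O"
    note [measurable] = positive_on_sets[OF O[OF order_refl]] positive_on_sets[OF empty_subsetI, of 1, where 'd = 'd]
    have "AE \<phi> in ?M. ?h \<phi> * (indicator (positive_on (\<Lambda> 1) {}) \<phi> * boltzmann 1 \<phi>) = 0"
      using \<open>a = 0\<close> unfolding a_def plus_integral_def by (subst (asm) nn_integral_0_iff_AE) auto
    then have "AE \<phi> in ?M. 1 * (indicator (positive_on (\<Lambda> 1) ?O) \<phi> * boltzmann 1 \<phi>) = 0"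
    proof eventually_elim
      case (elim \<phi>)
      show ?case
      proof (cases "\<phi> \<in> positive_on (\<Lambda> 1) ?O")
        case True
        then have "\<phi> \<in> positive_on (\<Lambda> 1) {}" "?h \<phi> \<noteq> 0" by (auto simp: positive_on_def)
        then have "boltzmann 1 \<phi> = 0" using elim by (simp add: indicator_def)
        then show ?thesis by simp
      qed simp
    qed
    then have "plus_integral 1 0 ?O ?O (\<lambda>_. 1) = 0"
      unfolding plus_integral_def by (subst nn_integral_0_iff_AE) auto
    then show False using plus_integral_pos[OF O[OF order_refl] order_refl, of 0] by simp
  qed
  then obtain a' where a': "a = ennreal a'" "a' > 0"
    using fin by (cases a) (auto simp: less_le)
  obtain b' where b': "b = ennreal b'" "b' > 0"
    using fin by (cases b) (auto simp: less_le)
  show ?thesis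
  proof (intro exI[of _ "a' / b'"] conjI allI impI)
    show "a' / b' > 0" using a' b' by simp
    fix \<eta> L assume \<eta>: "0 < \<eta>" "\<eta> \<le> \<eta>'" and L: "1 \<le> (L :: nat)"
    have mono: "?h \<phi> \<le> ?h (\<lambda>i. max (\<phi> i) (\<psi> i))" for \<phi> \<psi> by (simp add: ennreal_leI)
    have "a \<le> plus_integral 1 \<eta> ?O {} ?h"
      unfolding a_def using \<eta> O[of 1] measurable_height by (intro box_integral_mono) auto
    also have "\<dots> = plus_integral L \<eta> ?O {} ?h"
      using O[of 1] L measurable_height by (intro plus_integral_box[symmetric]) auto
    finally have a: "a \<le> plus_integral L \<eta> ?O {} ?h" .
    have "plus_integral L \<eta> ?O {} (\<lambda>_. 1) = plus_integral 1 \<eta> ?O {} (\<lambda>_. 1)"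
      using O[of 1] L by (intro plus_integral_box) auto
    also have "\<dots> \<le> b" unfolding b_def using \<eta> O[of 1] by (intro box_integral_mono) auto
    finally have b: "plus_integral L \<eta> ?O {} (\<lambda>_. 1) \<le> b" .
    have "a * box_integral L \<eta> (\<lambda>_::int ^ 'd \<Rightarrow> real. 1) \<le> plus_integral L \<eta> ?O {} ?h * box_integral L \<eta> (\<lambda>_::int ^ 'd \<Rightarrow> real. 1)"
      using a by (intro mult_right_mono) auto
    also have "\<dots> \<le> plus_integral L \<eta> ?O {} (\<lambda>_. 1) * box_integral L \<eta> ?h"
      by (rule plus_integral_domination[OF \<eta>(1) order_refl empty_subsetI O[OF L] empty_subsetI order_refl measurable_height mono])
    also have "\<dots> \<le> b * box_integral L \<eta> ?h" using b by (intro mult_right_mono) auto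
    finally have "enn2real (a * box_integral L \<eta> (\<lambda>_::int ^ 'd \<Rightarrow> real. 1)) \<le> enn2real (b * box_integral L \<eta> ?h)"
      using box_integral_finite(2)[of L \<eta> "0 :: int ^ 'd"] fin by (intro enn2real_mono) (auto simp: ennreal_mult_less_top)
    then have "a' * Z_plus TYPE('d) \<eta> L \<le> b' * enn2real (box_integral L \<eta> ?h)"
      using a' b' by (simp add: enn2real_mult Z_plus_eq)
    then show "a' / b' \<le> (\<integral>\<phi>. \<phi> (0 :: int ^ 'd) \<partial>\<mu>_plus \<eta> L)"
      unfolding expectation_height[OF L, of \<eta>, where 'd = 'd]
      using Z_plus_pos[of \<eta> L, where 'd = 'd] b'
      by (simp add: pos_divide_le_eq pos_le_divide_eq ac_simps)
  qed
qed

text \<open>With \<open>x = f\<close> to the power \<open>- 1 / (4 * d)\<close> and \<open>r\<close>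
  its integer part, a cube of radius \<open>r\<^sup>2\<close> has volume at most of order
  \<open>f\<close> to the power -1/2. Multiplied by \<open>f\<close> this still tends to 0, while
  \<open>ln r\<close> remains comparable to the modulus of \<open>ln f\<close>.\<close>

lemma scale_choice:
  fixes a :: real and d r0 :: nat
  assumes a: "a > 0" and d: "d \<ge> 1"
  shows "\<exists>f0>0. f0 < 1 \<and> (\<forall>f. 0 < f \<longrightarrow> f < f0 \<longrightarrow> (\<exists>r\<ge>r0. 1 \<le> r \<and> (4 * (real r)\<^sup>2 + 2) ^ d * (4 * f) \<le> a \<and> \<bar>ln f\<bar> / (8 * real d) \<le> ln (real r)))"
proof -
  \<comment> \<open>Collects three lower bounds on \<open>- ln f\<close>: for the loss of
    \<open>ln 2\<close> in rounding, for \<open>r \<ge> r0\<close>, and for the volume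
    bound.\<close>
  define S where "S = 1 + \<bar>8 * real d * ln 2\<bar> + \<bar>4 * real d * ln (2 * (real r0 + 1))\<bar> + \<bar>2 * ln (4 * 6 ^ d / a)\<bar>"
  have S: "S > 0" by (simp add: S_def add_pos_nonneg)
  show ?thesis
  proof (intro exI[of _ "exp (- S)"] conjI allI impI)
    show "exp (- S) < 1" using S by simp
    fix f :: real assume f: "0 < f" "f < exp (- S)"
    define u where "u = - ln f"
    have "ln f < - S" using f ln_less_cancel_iff[of f "exp (- S)"] by simp
    then have u: "u > S" by (simp add: u_def)
    have f_eq: "f = exp (- u)" using f by (simp add: u_def)
    define x where "x = exp (u / (4 * real d))"
    have x: "x > 0" by (simp add: x_def)
    have u1: "8 * real d * ln 2 \<le> u" "4 * real d * ln (2 * (real r0 + 1)) \<le> u" "2 * ln (4 * 6 ^ d / a) \<le> u"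
      using u unfolding S_def by linarith+
    have "ln (2 * (real r0 + 1)) \<le> u / (4 * real d)" using u1(2) d by (simp add: field_simps)
    then have "exp (ln (2 * (real r0 + 1))) \<le> x" unfolding x_def by (simp only: exp_le_cancel_iff)
    then have x2: "2 * (real r0 + 1) \<le> x" by simp
    define r where "r = nat \<lfloor>x\<rfloor>"
    have "real r = of_int \<lfloor>x\<rfloor>" using x by (simp add: r_def)
    then have r: "real r \<le> x" "x - 1 < real r" by linarith+
    have "2 \<le> x" using x2 of_nat_0_le_iff[of r0, where 'a = real] by argo
    then have r_half: "x / 2 \<le> real r" using r(2) by argo
    show "\<exists>r\<ge>r0. 1 \<le> r \<and> (4 * (real r)\<^sup>2 + 2) ^ d * (4 * f) \<le> a \<and> \<bar>ln f\<bar> / (8 * real d) \<le> ln (real r)"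
    proof (intro exI[of _ r] conjI)
      have "real (r0 + 1) \<le> real r" using r_half x2 by simp
      then have "r0 + 1 \<le> r" by (simp only: of_nat_le_iff)
      then show "r0 \<le> r" "1 \<le> r" by simp_all
      have "4 * (real r)\<^sup>2 + 2 \<le> 6 * x\<^sup>2"
      proof -
        have "(real r)\<^sup>2 \<le> x\<^sup>2" using r(1) by (intro power_mono) auto
        moreover have "1\<^sup>2 \<le> x\<^sup>2" using x2 by (intro power_mono) auto
        ultimately show ?thesis by simp
      qed
      then have "(4 * (real r)\<^sup>2 + 2) ^ d \<le> (6 * x\<^sup>2) ^ d" by (intro power_mono) auto
      also have "(6 * x\<^sup>2) ^ d = 6 ^ d * exp (u / 2)"
      proof -
        have "(x\<^sup>2) ^ d = exp (real (2 * d) * (u / (4 * real d)))"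
          unfolding x_def exp_of_nat_mult power_mult ..
        also have "real (2 * d) * (u / (4 * real d)) = u / 2" using d by simp
        finally show ?thesis by (simp add: power_mult_distrib)
      qed
      finally have "(4 * (real r)\<^sup>2 + 2) ^ d * (4 * f) \<le> 6 ^ d * exp (u / 2) * (4 * f)"
        using f by (intro mult_right_mono) auto
      also have "\<dots> = 4 * 6 ^ d * exp (- (u / 2))"
      proof -
        have "exp (u / 2) * exp (- u) = exp (- (u / 2))" by (simp add: exp_add[symmetric])
        then show ?thesis by (simp add: f_eq)
      qed
      also have "\<dots> \<le> a"
      proof -
        have "exp (ln (4 * 6 ^ d / a)) \<le> exp (u / 2)" using u1(3) by simp
        then have "4 * 6 ^ d / a \<le> exp (u / 2)" using a by simp
        then show ?thesis using a by (simp add: exp_minus field_simps)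
      qed
      finally show "(4 * (real r)\<^sup>2 + 2) ^ d * (4 * f) \<le> a" .
      have "u / (8 * real d) = u / (4 * real d) - u / (8 * real d)" by simp
      also have "\<dots> \<le> u / (4 * real d) - ln 2" using u1(1) d by (simp add: field_simps)
      also have "\<dots> = ln (x / 2)" using x by (simp add: ln_div x_def)
      also have "\<dots> \<le> ln (real r)" using r_half x by (intro ln_mono) auto
      finally show "\<bar>ln f\<bar> / (8 * real d) \<le> ln (real r)" using u S by (simp add: u_def)
    qed
  qed simp
qed

subsection \<open>The main theorem\<close>

definition log_ratio :: "'d::finite itself \<Rightarrow> real \<Rightarrow> nat \<Rightarrow> real" where
  "log_ratio _ \<eta> L = ln (Z_plus TYPE('d) \<eta> L / Z_plus TYPE('d) 0 L) / real (card (\<Lambda> L :: (int ^ 'd) set))"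

lemma free_energy_eq: "free_energy TYPE('d::finite) \<eta> = lim (log_ratio TYPE('d) \<eta>)"
  by (simp add: free_energy_def log_ratio_def[abs_def])

lemma log_ratio_mono:
  assumes "\<eta> \<le> \<eta>'"
  shows "log_ratio TYPE('d::finite) \<eta> L \<le> log_ratio TYPE('d) \<eta>' L"
proof -
  note pos = Z_plus_pos[of _ L, where 'd = 'd]
  have "ln (Z_plus TYPE('d) \<eta> L / Z_plus TYPE('d) 0 L) \<le> ln (Z_plus TYPE('d) \<eta>' L / Z_plus TYPE('d) 0 L)"
    using pos[of \<eta>] pos[of 0] Z_plus_mono[OF assms, of L, where 'd = 'd]
    by (intro ln_mono divide_right_mono divide_pos_pos) auto
  then show ?thesis unfolding log_ratio_def by (intro divide_right_mono) auto
qed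

lemma log_ratio_nonpos: "\<eta> \<le> 0 \<Longrightarrow> log_ratio TYPE('d::finite) \<eta> L = 0"
  using Z_plus_pos[of 0 L, where 'd = 'd] Z_plus_nonpos[of \<eta> L, where 'd = 'd] by (simp add: log_ratio_def)

lemma free_energy_nonpos:
  assumes "\<eta> \<le> 0"
  shows "free_energy TYPE('d::finite) \<eta> = 0"
proof -
  have "log_ratio TYPE('d) \<eta> = (\<lambda>_. 0)" using log_ratio_nonpos[OF assms] by (rule ext)
  then show ?thesis by (simp add: free_energy_eq limI)
qed

lemma expectation_height_nonneg:
  assumes "1 \<le> L"
  shows "0 \<le> (\<integral>\<phi>. \<phi> (0 :: int ^ 'd::finite) \<partial>\<mu>_plus \<eta> L)"
  using expectation_height[OF assms, of \<eta>, where 'd = 'd] Z_plus_pos[of \<eta> L, where 'd = 'd] by simp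

text \<open>Existence of the free energy is not needed: where the sequence diverges, \<open>free_energy\<close>
  takes a fixed junk value, for which a constant lower bound suffices.\<close>

lemma free_energy_divergent:
  "\<exists>K. \<forall>\<eta>. \<not> convergent (log_ratio TYPE('d::finite) \<eta>) \<longrightarrow> free_energy TYPE('d) \<eta> = K"
proof (intro exI allI impI)
  fix \<eta> assume "\<not> convergent (log_ratio TYPE('d) \<eta>)"
  then have "(\<lambda>l. log_ratio TYPE('d) \<eta> \<longlonglongrightarrow> l) = (\<lambda>_. False)" by (auto simp: convergent_def)
  then show "free_energy TYPE('d) \<eta> = (THE l. False)" by (simp add: free_energy_eq lim_def)
qed

text \<open>Few pins on average give a large cube without pins, by averaging over its position.\<close>

lemma height_ge_of_small_free_energy:
  assumes \<eta>: "\<eta> > 0" and \<alpha>: "\<alpha> > 1" and f: "log_ratio TYPE('d::finite) (\<alpha> * \<eta>) \<longlonglongrightarrow> f" "f > 0"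
    and n: "(4 * real n + 2) ^ CARD('d) * (4 * f) \<le> ln \<alpha>"
    and rep: "\<And>L. L \<ge> 2 * n + 1 \<Longrightarrow> \<exists>k\<in>cube n. H \<le> mean_height L (cube n :: (int ^ 'd) set) k"
  shows "\<exists>L0. \<forall>L\<ge>L0. H / 2 \<le> (\<integral>\<phi>. \<phi> (0 :: int ^ 'd) \<partial>\<mu>_plus \<eta> L)"
proof -
  let ?d = "CARD('d)"
  have "\<forall>\<^sub>F L in sequentially. log_ratio TYPE('d) (\<alpha> * \<eta>) L < 2 * f"
    using f by (intro order_tendstoD(2)[OF f(1)]) simp
  then obtain L2 where L2: "\<And>L. L \<ge> L2 \<Longrightarrow> log_ratio TYPE('d) (\<alpha> * \<eta>) L < 2 * f"
    by (auto simp: eventually_sequentially)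
  \<comment> \<open>One fixed box on which the finite-volume free energy is below twice its limit;
    it depends on \<eta> but not on the final \<open>L\<close>.\<close>
  define L1 where "L1 = max L2 (4 * n + 1)"
  define Z where "Z = Z_plus TYPE('d) \<eta> L1"
  have Z: "Z > 0" by (simp add: Z_def Z_plus_pos)
  have a: "ln \<alpha> > 0" using \<alpha> by simp
  have L1pos: "0 < real L1 ^ ?d" by (simp add: L1_def)
  have "ln (Z_plus TYPE('d) (\<alpha> * \<eta>) L1 / Z_plus TYPE('d) 0 L1) / real L1 ^ ?d < 2 * f"
    using L2[of L1] by (simp add: log_ratio_def card_\<Lambda> L1_def)
  then have "ln (Z_plus TYPE('d) (\<alpha> * \<eta>) L1 / Z_plus TYPE('d) 0 L1) \<le> 2 * f * real L1 ^ ?d"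
    using L1pos by (simp add: pos_divide_less_eq less_imp_le)
  then have "Z * ln (Z_plus TYPE('d) (\<alpha> * \<eta>) L1 / Z_plus TYPE('d) 0 L1) \<le> Z * (2 * f * real L1 ^ ?d)"
    using Z by (intro mult_left_mono) auto
  with pin_mass_le_free_energy[OF \<alpha> \<eta>, of L1, where 'd = 'd]
  have "(\<Sum>k\<in>\<Lambda> L1. pin_mass L1 \<eta> (k :: int ^ 'd)) * ln \<alpha> \<le> Z * (2 * f * real L1 ^ ?d)"
    by (simp add: Z_def)
  then have pins: "(\<Sum>k\<in>\<Lambda> L1. pin_mass L1 \<eta> (k :: int ^ 'd)) \<le> (Z * 2 * f / ln \<alpha>) * real L1 ^ ?d"
    using a by (simp add: field_simps)
  have n1: "4 * n + 1 \<le> L1" by (simp add: L1_def)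
  obtain j where j: "(+) j ` cube n \<subseteq> (\<Lambda> L1 :: (int ^ 'd) set)"
    "(\<Sum>y\<in>cube n. pin_mass L1 \<eta> (j + y)) \<le> (4 * real n + 2) ^ ?d * (Z * 2 * f / ln \<alpha>)"
    by (rule exists_unpinned_cube[OF n1 pins])
  \<comment> \<open>The factor 4 in the hypothesis on \<open>n\<close> is 2 from the finite-volume
    error times 2 from the target probability one half.\<close>
  have "(4 * real n + 2) ^ ?d * (Z * 2 * f / ln \<alpha>) = (4 * real n + 2) ^ ?d * (4 * f) * (Z / (2 * ln \<alpha>))"
    by simp
  also have "\<dots> \<le> ln \<alpha> * (Z / (2 * ln \<alpha>))" using n Z a by (intro mult_right_mono) auto
  also have "\<dots> = Z / 2" using a by simp
  finally have "(\<Sum>k\<in>(+) j ` cube n. pin_mass L1 \<eta> k) \<le> Z / 2"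
    using j(2) by (subst sum.reindex) auto
  then have half: "ennreal (1 / 2) * box_integral L1 \<eta> (\<lambda>_::int ^ 'd \<Rightarrow> real. 1) \<le> plus_integral L1 \<eta> (\<Lambda> L1) ((+) j ` cube n) (\<lambda>_. 1)"
    unfolding Z_def by (rule unpinned_probability[OF j(1)])
  show ?thesis
  proof (intro exI allI impI)
    fix L assume L: "max (4 * L1 + 1) (2 * n + 1) \<le> L"
    then have "2 * n + 1 \<le> L" by simp
    then obtain k where k: "k \<in> cube n" "H \<le> mean_height L (cube n :: (int ^ 'd) set) k"
      using rep by blast
    have "mean_height L (cube n) k / 2 \<le> (\<integral>\<phi>. \<phi> (0 :: int ^ 'd) \<partial>\<mu>_plus \<eta> L)"
      using L by (intro height_ge_mean_height[OF \<eta> j(1) k(1) _ _ half]) auto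
    then show "H / 2 \<le> (\<integral>\<phi>. \<phi> (0 :: int ^ 'd) \<partial>\<mu>_plus \<eta> L)" using k(2) by simp
  qed
qed

theorem theorem2:
  fixes \<alpha> :: real
  assumes "CARD('d::finite) \<ge> 2" and "\<alpha> > 1"
  shows "\<exists>\<eta>'. \<eta>' > \<eta>_crit TYPE('d) \<and> (\<exists>c::real. c > 0 \<and>
    (\<forall>\<eta>. \<eta>_crit TYPE('d) < \<eta> \<and> \<eta> < \<eta>' \<longrightarrow> (\<exists>L0::nat. \<forall>L\<ge>L0.
      (CARD('d) = 2 \<longrightarrow>
        (\<integral>\<phi>. \<phi> (0 :: int ^ 'd) \<partial>(\<mu>_plus \<eta> L)) \<ge> c * \<bar>ln (free_energy TYPE('d) (\<alpha> * \<eta>))\<bar>) \<and>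
      (CARD('d) \<ge> 3 \<longrightarrow>
        (\<integral>\<phi>. \<phi> (0 :: int ^ 'd) \<partial>(\<mu>_plus \<eta> L)) \<ge> c * sqrt \<bar>ln (free_energy TYPE('d) (\<alpha> * \<eta>))\<bar>))))"
proof -
  let ?d = "CARD('d)"
  let ?F = "free_energy TYPE('d)"
  let ?s = "log_ratio TYPE('d)"
  let ?h = "\<lambda>\<eta> L. \<integral>\<phi>. \<phi> (0 :: int ^ 'd) \<partial>(\<mu>_plus \<eta> L)"
  \<comment> \<open>Treats both dimensions at once: the identity in the plane, the square root
    otherwise.\<close>
  define \<psi> :: "real \<Rightarrow> real" where "\<psi> = (if ?d = 2 then (\<lambda>x. x) else sqrt)"
  have \<psi>_mono: "\<psi> x \<le> \<psi> y" if "x \<le> y" for x y using that by (simp add: \<psi>_def)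
  have \<psi>_le: "\<psi> x \<le> x" if "1 \<le> x" for x
    using that by (simp add: \<psi>_def real_sqrt_le_iff' self_le_power)
  have \<psi>_scale: "\<psi> y / q \<le> \<psi> (y / q)" if "1 \<le> q" "0 \<le> y" for y q
  proof -
    have "sqrt q \<le> q" using that by (simp add: real_sqrt_le_iff' self_le_power)
    then have "sqrt y / q \<le> sqrt y / sqrt q" using that by (intro divide_left_mono) auto
    then show ?thesis by (simp add: \<psi>_def real_sqrt_divide)
  qed
  obtain c1 r0 where c1: "c1 > 0" and rep: "\<And>r L. r \<ge> r0 \<Longrightarrow> L \<ge> 2 * r\<^sup>2 + 1 \<Longrightarrow>
      \<exists>k\<in>cube (r\<^sup>2). c1 * \<psi> (ln (real r)) \<le> mean_height L (cube (r\<^sup>2) :: (int ^ 'd) set) k"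
  proof (cases "?d = 2")
    case True
    then have "\<psi> = (\<lambda>x. x)" by (simp add: \<psi>_def)
    then show ?thesis using entropic_repulsion_planar[OF True] that by metis
  next
    case False
    obtain c n0 where c: "c > 0" and cn: "\<And>n L. n \<ge> n0 \<Longrightarrow> L \<ge> 2 * n + 1 \<Longrightarrow>
        \<exists>k\<in>cube n. c * sqrt (ln (real n)) \<le> mean_height L (cube n :: (int ^ 'd) set) k"
      using entropic_repulsion[where 'd = 'd] by blast
    have "\<exists>k\<in>cube (r\<^sup>2). c * \<psi> (ln (real r)) \<le> mean_height L (cube (r\<^sup>2) :: (int ^ 'd) set) k"
      if r: "max n0 1 \<le> r" and L: "2 * r\<^sup>2 + 1 \<le> L" for r L
    proof -
      have "r \<le> r\<^sup>2" by (simp add: power2_nat_le_imp_le self_le_power)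
      then obtain k where k: "k \<in> cube (r\<^sup>2)" "c * sqrt (ln (real (r\<^sup>2))) \<le> mean_height L (cube (r\<^sup>2) :: (int ^ 'd) set) k"
        using cn[of "r\<^sup>2" L] r L by auto
      have "ln (real r) \<le> ln (real (r\<^sup>2))" using r \<open>r \<le> r\<^sup>2\<close> by (intro ln_mono) (auto simp del: of_nat_power)
      then have "c * sqrt (ln (real r)) \<le> c * sqrt (ln (real (r\<^sup>2)))" using c by (intro mult_left_mono) auto
      then show ?thesis using k False by (auto simp: \<psi>_def intro!: bexI[of _ k])
    qed
    then show ?thesis using that[OF c] by blast
  qed
  obtain K where K: "\<And>\<eta>. \<not> convergent (?s \<eta>) \<Longrightarrow> ?F \<eta> = K"
    using free_energy_divergent[where 'd = 'd] by blast
  \<comment> \<open>An upper bound on the free energy near criticality ensures that a large modulus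
    of its logarithm comes from a small value. Monotonicity in \<eta> gives it from one point of
    convergence; if there is none, the condition on \<open>M\<close> is vacuous.\<close>
  obtain \<eta>' M where \<eta>': "\<eta>' > \<eta>_crit TYPE('d)"
    and M: "\<And>\<eta>. \<eta>_crit TYPE('d) < \<eta> \<Longrightarrow> \<eta> < \<eta>' \<Longrightarrow> convergent (?s (\<alpha> * \<eta>)) \<Longrightarrow> ?F (\<alpha> * \<eta>) \<le> M"
  proof (cases "\<exists>\<eta>'>\<eta>_crit TYPE('d). convergent (?s (\<alpha> * \<eta>'))")
    case True
    then obtain \<eta>' where e: "\<eta>' > \<eta>_crit TYPE('d)" "convergent (?s (\<alpha> * \<eta>'))" by blast
    have "?F (\<alpha> * \<eta>) \<le> ?F (\<alpha> * \<eta>')" if "\<eta> < \<eta>'" "convergent (?s (\<alpha> * \<eta>))" for \<eta>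
    proof (rule LIMSEQ_le)
      show "?s (\<alpha> * \<eta>) \<longlonglongrightarrow> ?F (\<alpha> * \<eta>)" "?s (\<alpha> * \<eta>') \<longlonglongrightarrow> ?F (\<alpha> * \<eta>')"
        using that e unfolding free_energy_eq by (simp_all add: convergent_LIMSEQ_iff)
      show "\<exists>N. \<forall>n\<ge>N. ?s (\<alpha> * \<eta>) n \<le> ?s (\<alpha> * \<eta>') n"
        using that assms(2) by (intro exI allI impI log_ratio_mono) auto
    qed
    then show ?thesis using that[OF e(1)] by blast
  next
    case False
    then show ?thesis using that[of "\<eta>_crit TYPE('d) + 1"] by auto
  qed
  obtain c0 where c0: "c0 > 0" and low: "\<And>\<eta> L. 0 < \<eta> \<Longrightarrow> \<eta> \<le> \<eta>' \<Longrightarrow> 1 \<le> L \<Longrightarrow> c0 \<le> ?h \<eta> L"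
    using height_uniform_lower_bound[of \<eta>', where 'd = 'd] by blast
  have "ln \<alpha> > 0" "1 \<le> ?d" using assms by simp_all
  from scale_choice[OF this, of r0] obtain f0 where f0: "f0 > 0" "f0 < 1"
    and scale: "\<And>f. 0 < f \<Longrightarrow> f < f0 \<Longrightarrow> \<exists>r\<ge>r0. 1 \<le> r \<and> (4 * (real r)\<^sup>2 + 2) ^ ?d * (4 * f) \<le> ln \<alpha> \<and> \<bar>ln f\<bar> / (8 * real ?d) \<le> ln (real r)"
    by blast
  \<comment> \<open>Below this threshold the constant bound \<open>c0\<close> suffices;
    \<open>K\<close> covers divergence, \<open>M\<close> and \<open>f0\<close> the values not below
    \<open>f0\<close>, and the final 1 gives \<open>\<psi> B \<le> B\<close>.\<close>
  define B where "B = \<bar>ln f0\<bar> + \<bar>ln M\<bar> + \<bar>ln K\<bar> + 1"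
  have B: "B \<ge> 1" by (simp add: B_def)
  \<comment> \<open>The 16 is 8 from the choice of scale times 2 from the comparison with the empty
    cube.\<close>
  define c where "c = min (c1 / (16 * real ?d)) (c0 / B)"
  have c: "c > 0" using c1 c0 B by (simp add: c_def)
  have "\<exists>L0. \<forall>L\<ge>L0. c * \<psi> \<bar>ln (?F (\<alpha> * \<eta>))\<bar> \<le> ?h \<eta> L"
    if \<eta>: "\<eta>_crit TYPE('d) < \<eta>" "\<eta> < \<eta>'" for \<eta>
  proof (cases "\<eta> \<le> 0")
    case True
    then have "\<alpha> * \<eta> \<le> 0" using assms(2) by (simp add: mult_nonneg_nonpos)
    then have "?F (\<alpha> * \<eta>) = 0" by (rule free_energy_nonpos)
    \<comment> \<open>The convention \<open>ln 0 = 0\<close> makes the claimed bound 0 here.\<close>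
    then show ?thesis using expectation_height_nonneg[of _ \<eta>, where 'd = 'd]
      by (intro exI[of _ 1]) (auto simp: \<psi>_def)
  next
    case pos: False
    define f where "f = ?F (\<alpha> * \<eta>)"
    show ?thesis
    proof (cases "\<bar>ln f\<bar> \<le> B")
      case True
      have "c * \<psi> \<bar>ln f\<bar> \<le> c * \<psi> B" using True c by (intro mult_left_mono \<psi>_mono) auto
      also have "\<dots> \<le> c0 / B * B" using B c0 c \<psi>_le[OF B] \<psi>_mono[of 0 B]
        by (intro mult_mono) (auto simp: c_def \<psi>_def)
      also have "\<dots> = c0" using B by simp
      finally have "c * \<psi> \<bar>ln f\<bar> \<le> c0" .
      then show ?thesis using low[of \<eta>] pos \<eta>
        by (intro exI[of _ 1]) (auto simp: f_def intro: order_trans)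
    next
      case large: False
      have conv: "convergent (?s (\<alpha> * \<eta>))"
      proof (rule ccontr)
        assume "\<not> ?thesis"
        then have "f = K" using K by (simp add: f_def)
        then show False using large by (simp add: B_def)
      qed
      then have lim: "?s (\<alpha> * \<eta>) \<longlonglongrightarrow> f"
        by (simp add: f_def free_energy_eq convergent_LIMSEQ_iff)
      have "0 \<le> ?s (\<alpha> * \<eta>) L" for L
        using log_ratio_mono[of 0 "\<alpha> * \<eta>" L, where 'd = 'd] log_ratio_nonpos[of 0 L, where 'd = 'd] pos assms(2) by simp
      then have "0 \<le> f" using lim by (intro LIMSEQ_le_const[OF lim]) auto
      \<comment> \<open>Again \<open>ln 0 = 0\<close>: a vanishing free energy would fall under the
        bounded case.\<close>
      moreover have "f \<noteq> 0" using large B by auto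
      ultimately have f: "f > 0" by simp
      have "f \<le> M" using M[OF \<eta> conv] by (simp add: f_def)
      have "f < f0"
      proof (rule ccontr)
        assume "\<not> ?thesis"
        then have "ln f0 \<le> ln f" using f0 by simp
        moreover have "ln f \<le> ln M" using f \<open>f \<le> M\<close> by simp
        ultimately have "\<bar>ln f\<bar> \<le> \<bar>ln f0\<bar> + \<bar>ln M\<bar>" by linarith
        then show False using large by (simp add: B_def)
      qed
      from scale[OF f this] obtain r where r: "r0 \<le> r" "1 \<le> r"
        "(4 * (real r)\<^sup>2 + 2) ^ ?d * (4 * f) \<le> ln \<alpha>" "\<bar>ln f\<bar> / (8 * real ?d) \<le> ln (real r)" by blast
      have d1: "1 \<le> 8 * real ?d" using assms(1) by simp
      have "\<psi> \<bar>ln f\<bar> / (8 * real ?d) \<le> \<psi> (\<bar>ln f\<bar> / (8 * real ?d))" by (rule \<psi>_scale[OF d1]) simp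
      also have "\<dots> \<le> \<psi> (ln (real r))" by (rule \<psi>_mono[OF r(4)])
      finally have "c1 / 2 * (\<psi> \<bar>ln f\<bar> / (8 * real ?d)) \<le> c1 / 2 * \<psi> (ln (real r))"
        using c1 by (intro mult_left_mono) auto
      then have H: "c1 / (16 * real ?d) * \<psi> \<bar>ln f\<bar> \<le> c1 * \<psi> (ln (real r)) / 2" by simp
      have "0 \<le> \<psi> \<bar>ln f\<bar>" using \<psi>_mono[of 0 "\<bar>ln f\<bar>"] by (auto simp: \<psi>_def)
      then have "c * \<psi> \<bar>ln f\<bar> \<le> c1 / (16 * real ?d) * \<psi> \<bar>ln f\<bar>"
        by (intro mult_right_mono) (auto simp: c_def)
      then have le: "c * \<psi> \<bar>ln f\<bar> \<le> c1 * \<psi> (ln (real r)) / 2" using H by linarith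
      obtain L0 where "\<And>L. L \<ge> L0 \<Longrightarrow> c1 * \<psi> (ln (real r)) / 2 \<le> ?h \<eta> L"
        using height_ge_of_small_free_energy[OF _ assms(2) lim f, of "r\<^sup>2" "c1 * \<psi> (ln (real r))"]
          pos r rep[OF r(1)] by (auto simp: of_nat_power)
      then have "\<forall>L\<ge>L0. c * \<psi> \<bar>ln f\<bar> \<le> ?h \<eta> L" using le order_trans by blast
      then show ?thesis unfolding f_def by blast
    qed
  qed
  then have "\<exists>L0. \<forall>L\<ge>L0. (?d = 2 \<longrightarrow> c * \<bar>ln (?F (\<alpha> * \<eta>))\<bar> \<le> ?h \<eta> L) \<and>
      (?d \<ge> 3 \<longrightarrow> c * sqrt \<bar>ln (?F (\<alpha> * \<eta>))\<bar> \<le> ?h \<eta> L)" if "\<eta>_crit TYPE('d) < \<eta> \<and> \<eta> < \<eta>'" for \<eta>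
    using that unfolding \<psi>_def by (cases "?d = 2") (simp_all, blast)
  then show ?thesis using \<eta>' c by blast
qed

end
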